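(* For all integers $k,g\ge 3$, one can compute $f(k,g)$ in $O_{k,g}(1)$ time; that is, there is an algorithm which, for given integers $k,g\geq 3$, determines the exact value of $f(k,g)$ using a finite number of computation steps bounded by a quantity depending only on $k$ and $g$.
   Context: All graphs are finite and simple. A $(k;g,d)$-graph is a $k$-regular graph of girth $g$ and diameter exactly $d$, and $n(k;g,d)$ is the minimum order of a $(k;g,d)$-graph. $f(k,g)$ denotes the smallest real number such that, as the diameter $d$ goes to infinity, $n(k;g,d)\le f(k,g)\,d+O_{k,g}(1)$, where $O_{k,g}(1)$ denotes a quantity bounded by a constant depending only on $k$ and $g$. *)

theory Defs
  imports
    "Graph_Theory.Pair_Digraph"
    "Graph_Theory.Shortest_Path"
    "HOL-Library.Extended_Nat"
    "HOL-Library.Extended_Real"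
begin

section \<open>Graphs of given degree, girth and diameter\<close>

text \<open>
  A finite simple graph is a \<^locale>\<open>pair_graph\<close>: a finite, loop-free, symmetric relation
  on a set of vertices. As every edge is a pair of opposite arcs, going back and forth along
  an edge is a library cycle of length 2; hence the restriction to length at least 3.
\<close>

definition graph_girth :: "'a pair_pre_digraph \<Rightarrow> enat" where
  "graph_girth G =
     (INF p \<in> {p. pre_digraph.cycle (with_proj G) p \<and> 3 \<le> length p}. enat (length p))"

text \<open>The diameter is infinite for disconnected graphs and \<open>-\<infinity>\<close> for the empty graph.\<close>

definition graph_diameter :: "'a pair_pre_digraph \<Rightarrow> ereal" where
  "graph_diameter G =
     (SUP u \<in> pverts G. SUP v \<in> pverts G. wf_digraph.\<mu> (with_proj G) (\<lambda>_. 1) u v)"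

definition kgd_graph :: "nat \<Rightarrow> nat \<Rightarrow> nat \<Rightarrow> 'a pair_pre_digraph \<Rightarrow> bool" where
  "kgd_graph k g d G \<longleftrightarrow>
     pair_graph G \<and>
     (\<forall>v \<in> pverts G. out_degree (with_proj G) v = k) \<and>
     graph_girth G = enat g \<and>
     graph_diameter G = ereal (real d)"

text \<open>
  Every finite graph is isomorphic to one with vertices in \<^typ>\<open>nat\<close>.
  The value is \<open>\<infinity>\<close> if there is no such graph.
\<close>

definition min_order :: "nat \<Rightarrow> nat \<Rightarrow> nat \<Rightarrow> enat" where
  "min_order k g d =
     (INF G \<in> {G :: nat pair_pre_digraph. kgd_graph k g d G}. enat (card (pverts G)))"

definition order_bound :: "nat \<Rightarrow> nat \<Rightarrow> real \<Rightarrow> bool" where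
  "order_bound k g c \<longleftrightarrow>
     (\<exists>C :: real. \<forall>\<^sub>F d in sequentially.
        ereal_of_enat (min_order k g d) \<le> ereal (c * real d + C))"

definition growth_rate :: "nat \<Rightarrow> nat \<Rightarrow> real" where
  "growth_rate k g = (LEAST c. order_bound k g c)"


section \<open>Algorithms\<close>

text \<open>
  The model of computation are WHILE programs over registers holding natural numbers,
  a structured form of Minsky's counter machines and hence Turing complete.
\<close>

datatype prog =
    Inc nat
  | Dec nat
  | Seq prog prog
  | While nat prog  \<comment> \<open>repeat the body as long as the register is nonzero\<close>

text \<open>
  \<open>runs P s t s'\<close>: started in register contents \<open>s\<close>, the program \<open>P\<close> halts with register
  contents \<open>s'\<close> after exactly \<open>t\<close> steps. Increments, decrements and loop tests take one step.
\<close>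

inductive runs :: "prog \<Rightarrow> (nat \<Rightarrow> nat) \<Rightarrow> nat \<Rightarrow> (nat \<Rightarrow> nat) \<Rightarrow> bool" where
  Inc: "runs (Inc r) s 1 (s(r := s r + 1))"
| Dec: "runs (Dec r) s 1 (s(r := s r - 1))"
| Seq: "runs P s t s' \<Longrightarrow> runs Q s' u s'' \<Longrightarrow> runs (Seq P Q) s (t + u) s''"
| While_stop: "s r = 0 \<Longrightarrow> runs (While r P) s 1 s"
| While_step: "s r \<noteq> 0 \<Longrightarrow> runs P s t s' \<Longrightarrow> runs (While r P) s' u s''
    \<Longrightarrow> runs (While r P) s (1 + t + u) s''"

definition input :: "nat \<Rightarrow> nat \<Rightarrow> (nat \<Rightarrow> nat)" where
  "input a b = (\<lambda>_. 0)(0 := a, 1 := b)"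

text \<open>
  The exact value of a nonnegative rational number is returned as numerator in register 0 and
  nonzero denominator in register 1.
\<close>

definition outputs :: "(nat \<Rightarrow> nat) \<Rightarrow> real \<Rightarrow> bool" where
  "outputs s x \<longleftrightarrow> s 1 \<noteq> 0 \<and> x = real (s 0) / real (s 1)"

end

theory Submission
  imports Defs "HOL-Combinatorics.Permutations" "HOL-Library.Nat_Bijection"
begin

text \<open>
  Closing up a \<open>k\<close>-regular graph of girth \<open>g\<close> along a geodesic of length \<open>d\<close>, by removing the first
  and the last edge of the path and linking infinitely many copies of the rest, gives a periodic
  graph made of layers, with \<open>d - 1\<close> layers and the same number of vertices per period. Conversely,
  any number of periods of such a graph can be completed to a \<open>(k;g,d)\<close>-graph, for every large \<open>d\<close>,
  at the cost of boundedly many additional vertices. Hence \<open>f(k,g)\<close> is the infimum of \<open>w / m\<close> over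
  the periodic layered graphs with \<open>m\<close> layers and \<open>w\<close> vertices per period.

  Being such a graph is a condition on windows of \<open>2 * g + 3\<close> consecutive layers. If the same
  window occurs twice in a period, the period splits into two, one of which has a ratio at most
  \<open>w / m\<close>. So the infimum is attained at a bounded period, and a finite search finds it.
\<close>

section \<open>Girth\<close>

text \<open>The two removed path edges are replaced by two links to the next copy, joining
  \<open>p (d - 1)\<close> to \<open>p 1\<close> and \<open>p d\<close> to \<open>p 0\<close>. All
  degrees survive, and a short cycle through links would yield a short cycle through a removed edge.
  So closing up costs no vertices and gives the exact ratio \<open>n / (d - 1)\<close>. The obstacle
  in the converse is the diameter, which must be exactly \<open>d\<close>. Completing a long piece
  controls a distance only from below. The bound from above comes from the minimality of the ratio:
  two vertices too far apart would be the ends of a geodesic to close up along, and the result would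
  beat the optimum. What is then missing to \<open>d\<close> is bounded and is supplied by a tail of
  suitable depth, glued to a root of degree \<open>k - 2\<close>. For even \<open>k\<close>, degrees
  can only be filled up if the missing degrees have an even sum; this parity is carried along as
  evenness of all cuts between layers. No explicit running time is estimated: whether a ratio is
  optimal is decided by a finite check and some ratio is optimal, so an unbounded search halts, and
  its time depends on the input alone.\<close>

text \<open>An edge \<open>u v\<close> lies on no cycle shorter than \<open>g\<close> iff the distance of its ends in the graph without
  the edge is at least \<open>g - 1\<close>, which is witnessed by a function that is 1-Lipschitz on the other
  edges. Such functions extend easily when graphs are glued together.\<close>

definition potential :: "nat \<Rightarrow> ('a \<Rightarrow> 'a \<Rightarrow> bool) \<Rightarrow> 'a \<Rightarrow> 'a \<Rightarrow> ('a \<Rightarrow> int) \<Rightarrow> bool" where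
  "potential g E u v \<phi> \<longleftrightarrow> \<phi> u + int g \<le> \<phi> v + 1 \<and>
     (\<forall>x y. E x y \<longrightarrow> {x, y} \<noteq> {u, v} \<longrightarrow> \<phi> x \<le> \<phi> y + 1)"

definition girth_ge :: "nat \<Rightarrow> ('a \<Rightarrow> 'a \<Rightarrow> bool) \<Rightarrow> bool" where
  "girth_ge g E \<longleftrightarrow> (\<forall>u v. E u v \<longrightarrow> (\<exists>\<phi>. potential g E u v \<phi>))"

definition ugraph :: "'a set \<Rightarrow> ('a \<Rightarrow> 'a \<Rightarrow> bool) \<Rightarrow> bool" where
  "ugraph V E \<longleftrightarrow> finite V \<and> (\<forall>x y. E x y \<longrightarrow> x \<in> V \<and> y \<in> V \<and> x \<noteq> y \<and> E y x)"

definition deg :: "('a \<Rightarrow> 'a \<Rightarrow> bool) \<Rightarrow> 'a \<Rightarrow> nat" where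
  "deg E v = card {w. E v w}"

lemma graph_sym: "ugraph V E \<Longrightarrow> E x y \<Longrightarrow> E y x"
  by (auto simp: ugraph_def)

lemma graph_finite: "ugraph V E \<Longrightarrow> finite V"
  by (auto simp: ugraph_def)

lemma graph_nbrs: "ugraph V E \<Longrightarrow> finite {w. E v w}"
  by (rule finite_subset[of _ V]) (auto simp: ugraph_def)

lemma potentialI:
  assumes "\<phi> u + int g \<le> \<phi> v + 1"
    and "\<And>x y. E x y \<Longrightarrow> {x, y} \<noteq> {u, v} \<Longrightarrow> \<phi> x \<le> \<phi> y + 1"
  shows "potential g E u v \<phi>"
  using assms by (auto simp: potential_def)

lemma potential_le: "potential g E u v \<phi> \<Longrightarrow> E x y \<Longrightarrow> {x, y} \<noteq> {u, v} \<Longrightarrow> \<phi> x \<le> \<phi> y + 1"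
  by (auto simp: potential_def)

lemma potential_swap:
  assumes "potential g E u v \<phi>" and sym: "\<And>x y. E x y \<Longrightarrow> E y x"
  shows "potential g E v u (\<lambda>x. - \<phi> x)"
proof (rule potentialI)
  show "- \<phi> v + int g \<le> - \<phi> u + 1"
    using assms(1) by (auto simp: potential_def)
  fix x y assume "E x y" "{x, y} \<noteq> {v, u}"
  then show "- \<phi> x \<le> - \<phi> y + 1"
    using potential_le[OF assms(1), of y x] sym by (simp add: insert_commute)
qed

text \<open>Shifting and truncating preserve the Lipschitz condition. With values between 0 and
  \<open>g - 1\<close>, a potential can be continued over a glued piece whose ends are at distance
  at least \<open>g - 1\<close>.\<close>

lemma potential_clamp:
  assumes "potential g E u v \<phi>" "g > 0"
  shows "\<exists>\<psi>. potential g E u v \<psi> \<and> \<psi> u = 0 \<and> \<psi> v = int g - 1 \<and>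
    (\<forall>x. 0 \<le> \<psi> x \<and> \<psi> x \<le> int g - 1)"
proof (intro exI conjI allI)
  let ?\<psi> = "\<lambda>x. max 0 (min (int g - 1) (\<phi> x - \<phi> u))"
  show "potential g E u v ?\<psi>"
  proof (rule potentialI)
    show "?\<psi> u + int g \<le> ?\<psi> v + 1"
      using assms by (auto simp: potential_def)
    fix x y assume "E x y" "{x, y} \<noteq> {u, v}"
    then show "?\<psi> x \<le> ?\<psi> y + 1"
      using potential_le[OF assms(1), of x y] by auto
  qed
  show "?\<psi> u = 0" "?\<psi> v = int g - 1"
    using assms by (auto simp: potential_def)
  show "0 \<le> ?\<psi> x" "?\<psi> x \<le> int g - 1" for x
    using \<open>g > 0\<close> by auto
qed

lemma girth_geI:
  assumes sym: "\<And>x y. E x y \<Longrightarrow> E y x"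
    and "\<And>u v. E u v \<Longrightarrow> (\<exists>\<phi>. potential g E u v \<phi>) \<or> (\<exists>\<phi>. potential g E v u \<phi>)"
  shows "girth_ge g E"
  unfolding girth_ge_def
proof (intro allI impI)
  fix u v assume "E u v"
  then consider \<phi> where "potential g E u v \<phi>" | \<phi> where "potential g E v u \<phi>"
    using assms(2) by blast
  then show "\<exists>\<phi>. potential g E u v \<phi>"
    by cases (auto dest: potential_swap[OF _ sym])
qed

text \<open>Potentials pull back along homomorphisms. Injectivity on the non-isolated vertices
  ensures that no second edge is mapped onto the image of \<open>u v\<close>, where the potential
  may jump.\<close>

lemma girth_ge_hom:
  assumes "girth_ge g E" "inj_on f {x. \<exists>y. E' x y \<or> E' y x}"
    and hom: "\<And>x y. E' x y \<Longrightarrow> E (f x) (f y)"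
  shows "girth_ge g E'"
  unfolding girth_ge_def
proof (intro allI impI)
  fix u v assume uv: "E' u v"
  then obtain \<phi> where \<phi>: "potential g E (f u) (f v) \<phi>"
    using assms(1) hom unfolding girth_ge_def by blast
  have "potential g E' u v (\<phi> \<circ> f)"
  proof (rule potentialI)
    show "(\<phi> \<circ> f) u + int g \<le> (\<phi> \<circ> f) v + 1"
      using \<phi> by (auto simp: potential_def)
    fix x y assume xy: "E' x y" "{x, y} \<noteq> {u, v}"
    have "f ` {x, y} \<noteq> f ` {u, v}"
      using xy uv inj_on_image_eq_iff[OF assms(2), of "{x,y}" "{u,v}"] by auto
    then show "(\<phi> \<circ> f) x \<le> (\<phi> \<circ> f) y + 1"
      using potential_le[OF \<phi> hom[OF xy(1)]] by auto
  qed
  then show "\<exists>\<phi>. potential g E' u v \<phi>" by blast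
qed

lemma girth_ge_mono: "girth_ge g E \<Longrightarrow> (\<And>x y. E' x y \<Longrightarrow> E x y) \<Longrightarrow> girth_ge g E'"
  by (rule girth_ge_hom[of g E id]) auto

lemma relpowp_lipschitz:
  fixes \<phi> :: "'a \<Rightarrow> int"
  assumes "\<And>x y. E x y \<Longrightarrow> \<phi> x \<le> \<phi> y + 1" "(E ^^ n) x y"
  shows "\<phi> x \<le> \<phi> y + int n"
  using assms(2)
proof (induction n arbitrary: y)
  case (Suc n)
  then obtain z where "(E ^^ n) x z" "E z y" by auto
  then show ?case using Suc.IH[of z] assms(1)[of z y] by auto
qed auto

definition avoid :: "('a \<Rightarrow> 'a \<Rightarrow> bool) \<Rightarrow> 'a \<Rightarrow> 'a \<Rightarrow> 'a \<Rightarrow> 'a \<Rightarrow> bool" where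
  "avoid E u v x y \<longleftrightarrow> E x y \<and> {x, y} \<noteq> {u, v}"

text \<open>In one direction the potential is minus the distance from \<open>v\<close> in the graph
  without the edge, cut off at \<open>g\<close>.\<close>

lemma potential_walk_iff:
  "(\<exists>\<phi>. potential g E u v \<phi>) \<longleftrightarrow> (\<forall>n. Suc n < g \<longrightarrow> \<not> (avoid E u v ^^ n) v u)"
proof safe
  fix \<phi> n assume "potential g E u v \<phi>" "Suc n < g" "(avoid E u v ^^ n) v u"
  then show False
    using relpowp_lipschitz[of "avoid E u v" \<phi> n v u] by (auto simp: potential_def avoid_def)
next
  assume *: "\<forall>n. Suc n < g \<longrightarrow> \<not> (avoid E u v ^^ n) v u"
  \<comment> \<open>The disjunct \<open>n = g\<close> is the cut-off: it makes the least element
    exist also for vertices without a walk from \<open>v\<close>.\<close>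
  define W where "W x n \<longleftrightarrow> (avoid E u v ^^ n) v x \<or> n = g" for x n
  define \<phi> where "\<phi> x = - int (LEAST n. W x n)" for x
  have W: "W x (LEAST n. W x n)" for x
    by (rule LeastI[of _ g]) (simp add: W_def)
  have le: "(LEAST n. W x n) \<le> n" if "W x n" for x n
    using that by (rule Least_le)
  have "potential g E u v \<phi>"
  proof (rule potentialI)
    have "(LEAST n. W v n) = 0"
      using le[of v 0] by (simp add: W_def)
    moreover have "Suc (LEAST n. W u n) \<ge> g"
      using W[of u] * by (auto simp: W_def not_less)
    ultimately show "\<phi> u + int g \<le> \<phi> v + 1" by (simp add: \<phi>_def)
    fix x y assume "E x y" "{x, y} \<noteq> {u, v}"
    then have "avoid E u v x y" by (simp add: avoid_def)
    then have "W y (Suc (LEAST n. W x n)) \<or> (LEAST n. W x n) = g"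
      using W[of x] by (auto simp: W_def)
    then have "(LEAST n. W y n) \<le> Suc (LEAST n. W x n)"
      using le[of y] le[of y g] by (metis W_def le_SucI)
    then show "\<phi> x \<le> \<phi> y + 1" by (simp add: \<phi>_def)
  qed
  then show "\<exists>\<phi>. potential g E u v \<phi>" by blast
qed

section \<open>Regular graphs of large girth\<close>

text \<open>The reduced words are the vertices of the ball of radius \<open>R\<close> in the
  \<open>k\<close>-regular tree, edges being coloured by the letter put in front.
  \<open>flip\<close> crosses the edge of colour \<open>i\<close>, or stays put if that would leave
  the ball. The Cayley graph of the permutations of the ball with these \<open>k\<close> involutions
  is a classical regular graph of large girth.\<close>

definition words :: "nat \<Rightarrow> nat \<Rightarrow> nat list set" where
  "words k R = {w. set w \<subseteq> {..<k} \<and> length w \<le> R \<and> distinct_adj w}"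

definition flip :: "nat \<Rightarrow> nat \<Rightarrow> nat \<Rightarrow> nat list \<Rightarrow> nat list" where
  "flip k R i w = (if w \<in> words k R then
     (if w \<noteq> [] \<and> hd w = i then tl w else if length w < R then i # w else w) else w)"

definition acts :: "nat \<Rightarrow> nat \<Rightarrow> nat list \<Rightarrow> nat list \<Rightarrow> nat list" where
  "acts k R ws = foldr (flip k R) ws"

text \<open>The vertex set is the full symmetric group of the ball, which avoids speaking of the
  generated subgroup; connectedness is not claimed.\<close>

definition cayley :: "nat \<Rightarrow> nat \<Rightarrow> (nat list \<Rightarrow> nat list) \<Rightarrow> (nat list \<Rightarrow> nat list) \<Rightarrow> bool" where
  "cayley k R f h \<longleftrightarrow> f permutes words k R \<and> (\<exists>i<k. h = flip k R i \<circ> f)"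

lemma finite_words: "finite (words k R)"
proof (rule finite_subset)
  show "words k R \<subseteq> {w. set w \<subseteq> {..<k} \<and> length w \<le> R}"
    by (auto simp: words_def)
qed (rule finite_lists_length_le, simp)

lemma flip_words: "i < k \<Longrightarrow> w \<in> words k R \<Longrightarrow> flip k R i w \<in> words k R"
  by (cases w) (auto simp: flip_def words_def distinct_adj_Cons)

lemma flip_flip: "i < k \<Longrightarrow> flip k R i (flip k R i w) = w"
  using flip_words[of i k w R]
  by (cases w) (auto simp: flip_def words_def distinct_adj_Cons)

lemma flip_permutes: "i < k \<Longrightarrow> flip k R i permutes words k R"
proof (rule bij_imp_permutes)
  assume "i < k"
  then show "bij_betw (flip k R i) (words k R) (words k R)"
    by (intro bij_betwI[of _ _ _ "flip k R i"]) (auto simp: flip_words flip_flip)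
qed (simp add: flip_def)

lemma cayley_permutes:
  "cayley k R f h \<Longrightarrow> f permutes words k R \<and> h permutes words k R"
  by (auto simp: cayley_def intro: permutes_compose flip_permutes)

lemma Nil_words: "[] \<in> words k R"
  by (simp add: words_def)

lemma flip_Nil: "R > 0 \<Longrightarrow> flip k R i [] = [i]"
  by (simp add: flip_def Nil_words)

text \<open>All flips move the root \<open>[]\<close>, and to different words. Evaluating at its
  preimage under \<open>f\<close> shows that neighbours differ and that there are \<open>k\<close>
  of them.\<close>

lemma permutes_hits_Nil: "f permutes words k R \<Longrightarrow> \<exists>w. f w = []"
  by (metis permutes_surj surjD)

text \<open>Nothing cancels when the letters of a reduced word are applied to the root. So a
  nonempty reduced word acts nontrivially, which excludes short closed walks.\<close>

lemma acts_reduced: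
  "ws \<in> words k R \<Longrightarrow> acts k R ws [] = ws"
proof (induction ws)
  case (Cons i ws)
  then have "ws \<in> words k R" "length ws < R" "ws \<noteq> [] \<longrightarrow> hd ws \<noteq> i"
    by (auto simp: words_def distinct_adj_Cons)
  with Cons.IH show ?case by (auto simp: acts_def flip_def)
qed (simp add: acts_def)

lemma cayley_graph:
  assumes "R > 0"
  shows "ugraph {f. f permutes words k R} (cayley k R)"
  unfolding ugraph_def
proof (intro conjI allI impI)
  show "finite {f. f permutes words k R}"
    by (rule finite_permutations[OF finite_words])
  fix f h assume fh: "cayley k R f h"
  then show "f \<in> {f. f permutes words k R}" "h \<in> {f. f permutes words k R}"
    by (auto dest: cayley_permutes)
  from fh obtain i where i: "i < k" "h = flip k R i \<circ> f" by (auto simp: cayley_def)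
  obtain w where "f w = []" using fh by (auto simp: cayley_def dest: permutes_hits_Nil)
  then have "h w \<noteq> f w" using i assms by (simp add: flip_Nil)
  then show "f \<noteq> h" by auto
  show "cayley k R h f"
  proof -
    have "f = flip k R i \<circ> h" using i by (simp add: fun_eq_iff flip_flip)
    then show ?thesis
      unfolding cayley_def using cayley_permutes[OF fh] i by blast
  qed
qed

lemma cayley_deg:
  assumes "R > 0" "f permutes words k R"
  shows "deg (cayley k R) f = k"
proof -
  have "{h. cayley k R f h} = (\<lambda>i. flip k R i \<circ> f) ` {..<k}"
    using assms by (auto simp: cayley_def)
  moreover have "inj_on (\<lambda>i. flip k R i \<circ> f) {..<k}"
  proof (rule inj_onI)
    fix i j assume eq: "flip k R i \<circ> f = flip k R j \<circ> f"
    obtain w where "f w = []" using permutes_hits_Nil assms by blast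
    then show "i = j"
      using fun_cong[OF eq, of w] \<open>R > 0\<close> by (simp add: flip_Nil)
  qed
  ultimately show ?thesis by (simp add: deg_def card_image)
qed

text \<open>A walk that avoids the edge between \<open>u\<close> and \<open>flip i u\<close> corresponds to a word whose
  free reduction still ends in \<open>i\<close>, hence is not empty.\<close>

lemma cayley_walk:
  assumes "i < k" "v = flip k R i \<circ> u" "(avoid (cayley k R) u v ^^ n) v h" "R > n"
  shows "\<exists>ws \<in> words k R. ws \<noteq> [] \<and> last ws = i \<and> length ws \<le> Suc n \<and> h = acts k R ws \<circ> u"
  using assms(3,4)
proof (induction n arbitrary: h)
  case 0
  then show ?case using assms
    by (intro bexI[of _ "[i]"]) (auto simp: acts_def words_def fun_eq_iff)
next
  case (Suc n)
  then obtain h' where "(avoid (cayley k R) u v ^^ n) v h'" and h': "avoid (cayley k R) u v h' h"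
    by auto
  with Suc obtain ws where ws: "ws \<in> words k R" "ws \<noteq> []" "last ws = i"
    "length ws \<le> Suc n" "h' = acts k R ws \<circ> u" by (meson Suc_lessD)
  from h' obtain j where j: "j < k" "h = flip k R j \<circ> h'" by (auto simp: avoid_def cayley_def)
  show ?case
  proof (cases "hd ws = j")
    case True
    then obtain ws' where ws': "ws = j # ws'" using ws(2) by (cases ws) auto
    \<comment> \<open>A letter cancelling the whole word would be a step back along the avoided
      edge.\<close>
    have "ws' \<noteq> []"
    proof
      assume "ws' = []"
      then have "h' = v" "h = u"
        using ws ws' j assms by (auto simp: acts_def fun_eq_iff flip_flip)
      with h' show False by (auto simp: avoid_def)
    qed
    then show ?thesis using ws ws' j
      by (intro bexI[of _ ws']) (auto simp: acts_def words_def distinct_adj_Cons fun_eq_iff flip_flip)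
  next
    case False
    then show ?thesis using ws j Suc.prems
      by (intro bexI[of _ "j # ws"]) (auto simp: acts_def words_def distinct_adj_Cons)
  qed
qed

lemma cayley_girth_ge:
  assumes "R > g"
  shows "girth_ge g (cayley k R)"
  unfolding girth_ge_def
proof (intro allI impI)
  fix u v assume uv: "cayley k R u v"
  then obtain i where i: "i < k" "v = flip k R i \<circ> u" by (auto simp: cayley_def)
  obtain w where w: "u w = []" using uv by (auto simp: cayley_def dest: permutes_hits_Nil)
  show "\<exists>\<phi>. potential g (cayley k R) u v \<phi>"
    unfolding potential_walk_iff
  proof (intro allI impI notI)
    fix n assume n: "Suc n < g" "(avoid (cayley k R) u v ^^ n) v u"
    from cayley_walk[OF i this(2)] n assms obtain ws where
      "ws \<in> words k R" "ws \<noteq> []" and eq: "u = acts k R ws \<circ> u" by auto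
    moreover have "acts k R ws (u w) = u w"
      using fun_cong[OF eq, of w] unfolding comp_apply by (rule sym)
    ultimately show False using w acts_reduced[of ws k R] by simp
  qed
qed

section \<open>Transport of graphs along injections\<close>

definition relabel :: "('a \<Rightarrow> 'b) \<Rightarrow> ('a \<Rightarrow> 'a \<Rightarrow> bool) \<Rightarrow> 'b \<Rightarrow> 'b \<Rightarrow> bool" where
  "relabel f E x y \<longleftrightarrow> (\<exists>u v. E u v \<and> x = f u \<and> y = f v)"

lemma relabel_graph:
  assumes "ugraph V E" "inj_on f V"
  shows "ugraph (f ` V) (relabel f E)"
  unfolding ugraph_def
proof (intro conjI allI impI)
  show "finite (f ` V)" using assms by (simp add: ugraph_def)
  fix x y assume "relabel f E x y"
  then obtain u v where uv: "E u v" "x = f u" "y = f v" by (auto simp: relabel_def)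
  with assms(1) have *: "u \<in> V" "v \<in> V" "u \<noteq> v" "E v u" by (auto simp: ugraph_def)
  show "x \<in> f ` V" "y \<in> f ` V" using uv * by auto
  show "x \<noteq> y" using uv * assms(2) by (auto dest: inj_onD)
  show "relabel f E y x" using uv * by (auto simp: relabel_def)
qed

lemma relabel_nbrs:
  assumes "ugraph V E" "inj_on f V" "v \<in> V"
  shows "{y. relabel f E (f v) y} = f ` {w. E v w}"
proof -
  have "relabel f E (f v) y \<longleftrightarrow> (\<exists>w. E v w \<and> y = f w)" for y
  proof
    assume "relabel f E (f v) y"
    then obtain u w where "E u w" "f v = f u" "y = f w" by (auto simp: relabel_def)
    moreover from this have "u \<in> V" using assms(1) by (auto simp: ugraph_def)
    ultimately show "\<exists>w. E v w \<and> y = f w" using assms by (auto dest: inj_onD)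
  qed (auto simp: relabel_def)
  then show ?thesis by auto
qed

lemma relabel_deg:
  assumes "ugraph V E" "inj_on f V" "v \<in> V"
  shows "deg (relabel f E) (f v) = deg E v"
proof -
  have "inj_on f {w. E v w}"
    using assms by (auto intro: inj_on_subset simp: ugraph_def)
  then show ?thesis
    unfolding deg_def relabel_nbrs[OF assms] by (rule card_image)
qed

lemma relabel_girth_ge:
  assumes "ugraph V E" "inj_on f V" "girth_ge g E"
  shows "girth_ge g (relabel f E)"
proof (rule girth_ge_hom[OF assms(3), where f = "inv_into V f"])
  have sub: "{x. \<exists>y. relabel f E x y \<or> relabel f E y x} \<subseteq> f ` V"
    using assms(1) by (auto simp: relabel_def ugraph_def)
  show "inj_on (inv_into V f) {x. \<exists>y. relabel f E x y \<or> relabel f E y x}"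
    by (rule inj_on_subset[OF inj_on_inv_into sub]) simp
  fix x y assume "relabel f E x y"
  then obtain u v where "E u v" "x = f u" "y = f v" by (auto simp: relabel_def)
  moreover from this have "u \<in> V" "v \<in> V" using assms(1) by (auto simp: ugraph_def)
  ultimately show "E (inv_into V f x) (inv_into V f y)"
    using assms(2) by simp
qed

text \<open>A lower bound on the girth is enough here: the graph is a reservoir of vertices of
  degree \<open>k\<close>, used to raise degrees elsewhere.\<close>

lemma exists_regular_graph:
  obtains V :: "nat set" and E where
    "ugraph V E" "girth_ge g E" "V \<noteq> {}" "\<And>v. v \<in> V \<Longrightarrow> deg E v = k"
proof -
  let ?R = "Suc g"
  let ?V = "{f. f permutes words k ?R}"
  have G: "ugraph ?V (cayley k ?R)" by (rule cayley_graph) simp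
  then obtain f :: "_ \<Rightarrow> nat" where f: "inj_on f ?V"
    using finite_imp_inj_to_nat_seg graph_finite by metis
  show thesis
  proof
    show "ugraph (f ` ?V) (relabel f (cayley k ?R))" by (rule relabel_graph[OF G f])
    show "girth_ge g (relabel f (cayley k ?R))" by (rule relabel_girth_ge[OF G f cayley_girth_ge]) simp
    show "f ` ?V \<noteq> {}" using permutes_id[of "words k ?R"] by blast
    show "deg (relabel f (cayley k ?R)) v = k" if "v \<in> f ` ?V" for v
      using that relabel_deg[OF G f] cayley_deg[of ?R _ k] by auto
  qed
qed

section \<open>Filling up degrees\<close>

lemma fresh_embedding:
  fixes A :: "'a set"
  assumes "infinite (UNIV :: 'a set)" "finite A"
  obtains f :: "nat \<Rightarrow> 'a" where "inj f" "range f \<inter> A = {}"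
proof -
  have "infinite (- A)" using assms by (simp add: Compl_eq_Diff_UNIV)
  then obtain f :: "nat \<Rightarrow> 'a" where "inj f" "range f \<subseteq> - A"
    using infinite_countable_subset by blast
  then show thesis using that by blast
qed

text \<open>Opening the edge \<open>a b\<close> of a regular graph \<open>F\<close> and tying its
  ends to \<open>v\<close> and \<open>w\<close> raises the degrees of \<open>v\<close> and
  \<open>w\<close> and leaves those of \<open>F\<close> unchanged. The case \<open>v = w\<close> is
  allowed and raises the degree by 2.\<close>

definition bridge2 ::
  "('a \<Rightarrow> 'a \<Rightarrow> bool) \<Rightarrow> 'a \<Rightarrow> 'a \<Rightarrow> 'a \<Rightarrow> 'a \<Rightarrow> ('a \<Rightarrow> 'a \<Rightarrow> bool) \<Rightarrow> 'a \<Rightarrow> 'a \<Rightarrow> bool" where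
  "bridge2 E v w a b F x y \<longleftrightarrow> E x y \<or> avoid F a b x y \<or> {x, y} = {v, a} \<or> {x, y} = {w, b}"

locale gadget =
  fixes V :: "'a set" and E L F v w a b g
  assumes E: "ugraph V E" and F: "ugraph L F" and disj: "V \<inter> L = {}"
    and vw: "v \<in> V" "w \<in> V" and ab: "F a b"
    and girth_geE: "girth_ge g E" and girth_geF: "girth_ge g F" and g: "g \<ge> 3"
begin

abbreviation "E' \<equiv> bridge2 E v w a b F"

lemma E_in: "E x y \<Longrightarrow> x \<in> V \<and> y \<in> V \<and> x \<noteq> y \<and> E y x \<and> x \<notin> L \<and> y \<notin> L"
  using E disj by (auto simp: ugraph_def)

lemma F_in: "F x y \<Longrightarrow> x \<in> L \<and> y \<in> L \<and> x \<noteq> y \<and> F y x \<and> x \<notin> V \<and> y \<notin> V"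
  using F disj by (auto simp: ugraph_def)

lemma ab_in: "a \<in> L" "b \<in> L" "a \<noteq> b" "F b a" "a \<notin> V" "b \<notin> V" "v \<notin> L" "w \<notin> L"
  using F_in[OF ab] vw disj by auto

lemma ugraph': "ugraph (V \<union> L) E'"
  unfolding ugraph_def
proof (intro conjI allI impI)
  show "finite (V \<union> L)" using E F by (simp add: graph_finite)
  fix x y assume xy: "E' x y"
  then consider "E x y" | "avoid F a b x y" | "{x, y} = {v, a}" | "{x, y} = {w, b}"
    by (auto simp: bridge2_def)
  then have "x \<in> V \<union> L \<and> y \<in> V \<union> L \<and> x \<noteq> y \<and> E' y x"
  proof cases
    case 1
    then show ?thesis using E_in[OF 1] by (simp add: bridge2_def)
  next
    case 2
    then show ?thesis using F_in[of x y] by (auto simp: bridge2_def avoid_def insert_commute)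
  next
    case 3
    then have "{y, x} = {v, a}" by (simp add: insert_commute)
    with 3 show ?thesis using ab_in vw by (auto simp: bridge2_def doubleton_eq_iff)
  next
    case 4
    then have "{y, x} = {w, b}" by (simp add: insert_commute)
    with 4 show ?thesis using ab_in vw by (auto simp: bridge2_def doubleton_eq_iff)
  qed
  then show "x \<in> V \<union> L" "y \<in> V \<union> L" "x \<noteq> y" "E' y x" by simp_all
qed

lemma old_edges: "x \<in> V \<Longrightarrow> y \<in> V \<Longrightarrow> E' x y \<longleftrightarrow> E x y"
  using F_in[of x y] ab_in by (auto simp: bridge2_def avoid_def doubleton_eq_iff)

lemma cross_edges: "E' x y \<Longrightarrow> x \<in> L \<Longrightarrow> y \<in> V \<Longrightarrow> y = v \<or> y = w"
  using F_in[of x y] E_in[of x y] ab_in by (auto simp: bridge2_def avoid_def doubleton_eq_iff)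

lemma deg_old:
  assumes "x \<in> V"
  shows "deg E' x = deg E x + of_bool (x = v) + of_bool (x = w)"
proof -
  have fin: "finite {y. E x y}" using E by (rule graph_nbrs)
  have "{y. E' x y} = {y. E x y} \<union> (if x = v then {a} else {}) \<union> (if x = w then {b} else {})"
    using F_in[of x] ab_in vw assms by (auto simp: bridge2_def avoid_def doubleton_eq_iff)
  moreover have "a \<notin> {y. E x y}" "b \<notin> {y. E x y}" using E_in[of x] ab_in by auto
  ultimately show ?thesis using fin ab_in by (auto simp: deg_def)
qed

lemma deg_new:
  assumes "x \<in> L"
  shows "deg E' x = deg F x"
proof -
  have fin: "finite {y. F x y}" using F by (rule graph_nbrs)
  have "v \<notin> {y. F x y}" "w \<notin> {y. F x y}" using F_in[of x] ab_in by auto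
  have "{y. E' x y} = (if x = a then insert v ({y. F x y} - {b})
      else if x = b then insert w ({y. F x y} - {a}) else {y. F x y})"
    using E_in[of x] ab_in vw assms by (auto simp: bridge2_def avoid_def doubleton_eq_iff)
  moreover have pos: "card {y. F a y} > 0" "card {y. F b y} > 0"
    using ab ab_in graph_nbrs[OF F] by (auto simp: card_gt_0_iff)
  then have "card (insert v ({y. F a y} - {b})) = card {y. F a y}"
    using F ab ab_in F_in[of a] vw by (subst card.insert) (auto simp: graph_nbrs)
  moreover have "card (insert w ({y. F b y} - {a})) = card {y. F b y}"
    using pos F ab ab_in F_in[of b] vw by (subst card.insert) (auto simp: graph_nbrs)
  ultimately show ?thesis by (auto simp: deg_def)
qed

text \<open>Inside each of the two graphs the condition is inherited, so only the two connecting
  edges need care.\<close>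

lemma potential_split:
  assumes "\<And>x y. E x y \<Longrightarrow> {x, y} \<noteq> {s, t} \<Longrightarrow> \<phi> x \<le> \<phi> y + 1"
    and "\<And>x y. avoid F a b x y \<Longrightarrow> {x, y} \<noteq> {s, t} \<Longrightarrow> \<psi> x \<le> \<psi> y + 1"
    and "{v, a} \<noteq> {s, t} \<Longrightarrow> \<bar>\<phi> v - \<psi> a\<bar> \<le> 1" "{w, b} \<noteq> {s, t} \<Longrightarrow> \<bar>\<phi> w - \<psi> b\<bar> \<le> 1"
    and "(if s \<in> V then \<phi> s else \<psi> s) + int g \<le> (if t \<in> V then \<phi> t else \<psi> t) + 1"
  shows "potential g E' s t (\<lambda>x. if x \<in> V then \<phi> x else \<psi> x)"
proof (rule potentialI)
  fix x y assume "E' x y" and ne: "{x, y} \<noteq> {s, t}"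
  then consider "E x y" | "avoid F a b x y" | "{x, y} = {v, a}" | "{x, y} = {w, b}"
    by (auto simp: bridge2_def)
  then show "(if x \<in> V then \<phi> x else \<psi> x) \<le> (if y \<in> V then \<phi> y else \<psi> y) + 1"
  proof cases
    case 1
    then show ?thesis using assms(1)[OF 1 ne] E_in by auto
  next
    case 2
    then show ?thesis using assms(2)[OF 2 ne] F_in[of x y] by (auto simp: avoid_def)
  next
    case 3
    then show ?thesis using assms(3) ne ab_in vw by (auto simp: doubleton_eq_iff)
  next
    case 4
    then show ?thesis using assms(4) ne ab_in vw by (auto simp: doubleton_eq_iff)
  qed
qed (use assms(5) in simp)

text \<open>A cycle that uses one connecting edge uses both, and crosses \<open>F\<close> from
  \<open>a\<close> to \<open>b\<close> without the edge \<open>a b\<close>, which takes at least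
  \<open>g - 1\<close> steps. The four cases express this by a potential for each kind of
  edge.\<close>

lemma girth_ge': "girth_ge g E'"
proof (rule girth_geI)
  show "E' y x" if "E' x y" for x y using ugraph' that by (rule graph_sym)
  obtain \<chi>0 where "potential g F a b \<chi>0" using girth_geF ab by (auto simp: girth_ge_def)
  then obtain \<chi> where \<chi>: "potential g F a b \<chi>" "\<chi> a = 0" "\<chi> b = int g - 1"
    "\<And>x. 0 \<le> \<chi> x" "\<And>x. \<chi> x \<le> int g - 1"
    using potential_clamp[of g] g by (metis gr0I not_numeral_le_zero)
  have \<chi>L: "\<chi> x \<le> \<chi> y + 1" if "avoid F a b x y" for x y
    using that potential_le[OF \<chi>(1)] by (auto simp: avoid_def)
  have \<chi>L': "\<chi> y \<le> \<chi> x + 1" if "avoid F a b x y" for x y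
    using that F_in[of x y] by (intro \<chi>L) (auto simp: avoid_def insert_commute)
  fix s t assume "E' s t"
  then consider "E s t" | "avoid F a b s t" | "{s, t} = {v, a}" | "{s, t} = {w, b}"
    by (auto simp: bridge2_def)
  then show "(\<exists>\<phi>. potential g E' s t \<phi>) \<or> (\<exists>\<phi>. potential g E' t s \<phi>)"
  proof cases
    case 1
    then obtain \<phi>0 where "potential g E s t \<phi>0" using girth_geE by (auto simp: girth_ge_def)
    then obtain \<phi> where \<phi>: "potential g E s t \<phi>" "\<phi> s = 0" "\<phi> t = int g - 1"
      "\<And>x. 0 \<le> \<phi> x" "\<And>x. \<phi> x \<le> int g - 1"
      using potential_clamp[of g] g by (metis gr0I not_numeral_le_zero)
    \<comment> \<open>A function on \<open>F\<close> interpolating between \<open>\<phi> v\<close> at \<open>a\<close> and \<open>\<phi> w\<close> at \<open>b\<close>: the two ends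
      are at distance at least \<open>g - 1\<close>.\<close>
    define \<psi> where "\<psi> x = (if \<phi> v \<le> \<phi> w then min (\<phi> v + \<chi> x) (\<phi> w)
      else max (\<phi> v - \<chi> x) (\<phi> w))" for x
    have "\<psi> a = \<phi> v" using \<chi>(2) by (auto simp: \<psi>_def)
    moreover have "\<psi> b = \<phi> w" using \<chi>(3) \<phi>(4,5)[of v] \<phi>(4,5)[of w] by (auto simp: \<psi>_def)
    moreover have "\<psi> x \<le> \<psi> y + 1" if "avoid F a b x y" for x y
      using \<chi>L[OF that] \<chi>L'[OF that] by (auto simp: \<psi>_def)
    ultimately have "potential g E' s t (\<lambda>x. if x \<in> V then \<phi> x else \<psi> x)"
      using potential_le[OF \<phi>(1)] \<phi>(2,3) E_in[OF 1] by (intro potential_split[where \<phi> = \<phi> and \<psi> = \<psi>]) auto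
    then show ?thesis by blast
  next
    case 2
    then obtain \<phi> where \<phi>: "potential g F s t \<phi>" using girth_geF by (auto simp: girth_ge_def avoid_def)
    have ne: "{a, b} \<noteq> {s, t}" using 2 by (auto simp: avoid_def)
    have st: "s \<notin> V" "t \<notin> V" using 2 F_in[of s t] by (auto simp: avoid_def)
    \<comment> \<open>As \<open>a b\<close> is an edge of \<open>F\<close> other than
      \<open>s t\<close>, its ends differ by at most 1, so all of \<open>V\<close> can take the
      value at \<open>a\<close>.\<close>
    have "\<phi> a \<le> \<phi> b + 1" "\<phi> b \<le> \<phi> a + 1"
      using potential_le[OF \<phi>, of a b] potential_le[OF \<phi>, of b a] ne ab ab_in by (auto simp: insert_commute)
    then have "potential g E' s t (\<lambda>x. if x \<in> V then \<phi> a else \<phi> x)"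
    proof (intro potential_split[where \<phi> = "\<lambda>_. \<phi> a" and \<psi> = \<phi>])
      show "\<phi> x \<le> \<phi> y + 1" if "avoid F a b x y" "{x, y} \<noteq> {s, t}" for x y
        using that by (auto simp: avoid_def intro: potential_le[OF \<phi>])
      show "(if s \<in> V then \<phi> a else \<phi> s) + int g \<le> (if t \<in> V then \<phi> a else \<phi> t) + 1"
        using \<phi> st by (simp add: potential_def)
    qed auto
    then show ?thesis by blast
  next
    case 3
    have "potential g E' v a (\<lambda>x. if x \<in> V then 0 else int g - 1 - \<chi> x)"
    proof (rule potential_split[where \<phi> = "\<lambda>_. 0" and \<psi> = "\<lambda>x. int g - 1 - \<chi> x"])
      show "int g - 1 - \<chi> x \<le> int g - 1 - \<chi> y + 1" if "avoid F a b x y" for x y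
        using \<chi>L'[OF that] by simp
    qed (use \<chi>(2,3) vw ab_in(5,6) in simp_all)
    moreover have "s = v \<and> t = a \<or> s = a \<and> t = v" using 3 by (simp add: doubleton_eq_iff)
    ultimately show ?thesis by blast
  next
    case 4
    have "potential g E' w b (\<lambda>x. if x \<in> V then 0 else \<chi> x)"
    proof (rule potential_split[where \<phi> = "\<lambda>_. 0" and \<psi> = \<chi>])
      show "\<chi> x \<le> \<chi> y + 1" if "avoid F a b x y" for x y
        using \<chi>L[OF that] by simp
    qed (use \<chi>(2,3) vw ab_in(5,6) in simp_all)
    moreover have "s = w \<and> t = b \<or> s = b \<and> t = w" using 4 by (simp add: doubleton_eq_iff)
    ultimately show ?thesis by blast
  qed
qed

end

text \<open>\<open>b\<close> prescribes how much the degree of each old vertex grows. The last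
  clause keeps new vertices away from old ones without demand; later it confines additions to the
  two ends of a long graph.\<close>

definition extension ::
  "nat \<Rightarrow> nat \<Rightarrow> ('a \<Rightarrow> nat) \<Rightarrow> 'a set \<Rightarrow> ('a \<Rightarrow> 'a \<Rightarrow> bool) \<Rightarrow> 'a set \<Rightarrow> ('a \<Rightarrow> 'a \<Rightarrow> bool) \<Rightarrow> bool" where
  "extension k g b V E V' E' \<longleftrightarrow> ugraph V' E' \<and> girth_ge g E' \<and> V \<subseteq> V' \<and>
     (\<forall>x\<in>V. \<forall>y\<in>V. E' x y \<longleftrightarrow> E x y) \<and>
     (\<forall>v\<in>V. deg E' v = deg E v + b v) \<and> (\<forall>v\<in>V' - V. deg E' v = k) \<and>
     (\<forall>x\<in>V' - V. \<forall>y\<in>V. E' x y \<longrightarrow> b y > 0)"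

lemma extensionD:
  assumes "extension k g b V E V' E'"
  shows "ugraph V' E'" "girth_ge g E'" "V \<subseteq> V'"
    "\<And>x y. x \<in> V \<Longrightarrow> y \<in> V \<Longrightarrow> E' x y \<longleftrightarrow> E x y"
    "\<And>v. v \<in> V \<Longrightarrow> deg E' v = deg E v + b v"
    "\<And>v. v \<in> V' \<Longrightarrow> v \<notin> V \<Longrightarrow> deg E' v = k"
    "\<And>x y. x \<in> V' \<Longrightarrow> x \<notin> V \<Longrightarrow> y \<in> V \<Longrightarrow> E' x y \<Longrightarrow> b y > 0"
  using assms by (simp_all add: extension_def)

lemma extension_refl:
  assumes "ugraph V E" "girth_ge g E" "\<And>v. v \<in> V \<Longrightarrow> b v = 0"
  shows "extension k g b V E V E"
  using assms by (simp add: extension_def)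

lemma extension_trans:
  assumes 1: "extension k g b V E V1 E1" and 2: "extension k g c V1 E1 V2 E2"
    and c: "\<And>v. v \<in> V1 - V \<Longrightarrow> c v = 0"
    and bc: "\<And>v. v \<in> V \<Longrightarrow> b v + c v = d v"
  shows "extension k g d V E V2 E2"
proof -
  have V: "V \<subseteq> V1" "V1 \<subseteq> V2" and g2: "ugraph V2 E2" using 1 2 by (auto simp: extension_def)
  have "d y > 0" if "x \<in> V2 - V" "y \<in> V" "E2 x y" for x y
  proof (cases "x \<in> V1")
    case True
    then have "E1 x y" using that V 2 by (auto simp: extension_def)
    then have "b y > 0" using that True 1 by (auto simp: extension_def)
    then show ?thesis using bc[of y] that by auto
  next
    case False
    then have "c y > 0" using that V 2 by (auto simp: extension_def)
    then show ?thesis using bc[of y] that by auto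
  qed
  moreover have "deg E2 v = deg E v + d v" if "v \<in> V" for v
    using that V 1 2 bc[OF that] unfolding extension_def by (metis add.assoc subsetD)
  moreover have "deg E2 v = k" if "v \<in> V2 - V" for v
  proof (cases "v \<in> V1")
    case True
    then have "deg E2 v = deg E1 v + c v" "deg E1 v = k" "c v = 0"
      using 1 2 c[of v] that by (auto simp: extension_def)
    then show ?thesis by simp
  qed (use 2 that in \<open>auto simp: extension_def\<close>)
  moreover have "E2 x y \<longleftrightarrow> E x y" if "x \<in> V" "y \<in> V" for x y
  proof -
    have "x \<in> V1" "y \<in> V1" using that V by auto
    then have "E2 x y \<longleftrightarrow> E1 x y" using 2 by (simp add: extension_def)
    then show ?thesis using that 1 by (auto simp: extension_def)
  qed
  moreover have "girth_ge g E2" using 2 unfolding extension_def by (elim conjE)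
  moreover have "V \<subseteq> V2" using V by (rule subset_trans)
  ultimately show ?thesis using g2 unfolding extension_def by (intro conjI ballI impI) simp_all
qed

section \<open>Graphs glued at a single vertex\<close>

definition wedge :: "('a \<Rightarrow> 'a \<Rightarrow> bool) \<Rightarrow> ('a \<Rightarrow> 'a \<Rightarrow> bool) \<Rightarrow> 'a \<Rightarrow> 'a \<Rightarrow> bool" where
  "wedge E F x y \<longleftrightarrow> E x y \<or> F x y"

lemma wedge_comm: "wedge E F = wedge F E"
  by (auto simp: wedge_def fun_eq_iff)

lemma wedge_graph: "ugraph V E \<Longrightarrow> ugraph L F \<Longrightarrow> ugraph (V \<union> L) (wedge E F)"
  by (auto simp: wedge_def ugraph_def)

text \<open>Every cycle lies in one of the two graphs; accordingly the potential extends over the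
  other one by its value at the common vertex.\<close>

lemma wedge_potential:
  assumes "ugraph V E" "ugraph L F" "V \<inter> L \<subseteq> {c}" "E s t" "potential g E s t \<phi>"
  shows "potential g (wedge E F) s t (\<lambda>x. if x \<in> V then \<phi> x else \<phi> c)"
proof (rule potentialI)
  have "s \<in> V" "t \<in> V" using assms(1,4) by (auto simp: ugraph_def)
  then show "(if s \<in> V then \<phi> s else \<phi> c) + int g \<le> (if t \<in> V then \<phi> t else \<phi> c) + 1"
    using assms(5) by (simp add: potential_def)
  fix x y assume "wedge E F x y" and ne: "{x, y} \<noteq> {s, t}"
  then consider "E x y" | "F x y" by (auto simp: wedge_def)
  then show "(if x \<in> V then \<phi> x else \<phi> c) \<le> (if y \<in> V then \<phi> y else \<phi> c) + 1"
  proof cases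
    case 1
    then have "x \<in> V" "y \<in> V" using assms(1) by (auto simp: ugraph_def)
    then show ?thesis using potential_le[OF assms(5) 1 ne] by simp
  next
    case 2
    then have "x \<in> L" "y \<in> L" using assms(2) by (auto simp: ugraph_def)
    then have "x \<in> V \<Longrightarrow> x = c" "y \<in> V \<Longrightarrow> y = c" using assms(3) by auto
    then show ?thesis by auto
  qed
qed

lemma wedge_girth_ge:
  assumes "ugraph V E" "ugraph L F" "V \<inter> L \<subseteq> {c}" "girth_ge g E" "girth_ge g F"
  shows "girth_ge g (wedge E F)"
  unfolding girth_ge_def
proof (intro allI impI)
  fix s t assume "wedge E F s t"
  then consider "E s t" | "F s t" by (auto simp: wedge_def)
  then show "\<exists>\<phi>. potential g (wedge E F) s t \<phi>"
  proof cases
    case 1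
    then obtain \<phi> where "potential g E s t \<phi>" using assms(4) by (auto simp: girth_ge_def)
    then show ?thesis using wedge_potential[OF assms(1-3) 1] by blast
  next
    case 2
    then obtain \<phi> where "potential g F s t \<phi>" using assms(5) by (auto simp: girth_ge_def)
    moreover have "L \<inter> V \<subseteq> {c}" using assms(3) by auto
    ultimately show ?thesis using wedge_potential[OF assms(2,1) _ 2] wedge_comm by metis
  qed
qed

lemma wedge_deg1:
  assumes "ugraph L F" "v \<notin> L"
  shows "deg (wedge E F) v = deg E v"
proof -
  have "{w. wedge E F v w} = {w. E v w}"
    using assms by (auto simp: wedge_def ugraph_def)
  then show ?thesis by (simp add: deg_def)
qed

lemma wedge_deg2:
  assumes "ugraph V E" "v \<notin> V"
  shows "deg (wedge E F) v = deg F v"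
  using wedge_deg1[OF assms, of F] by (simp add: wedge_comm)

lemma wedge_deg_root:
  assumes "ugraph V E" "ugraph L F" "V \<inter> L \<subseteq> {c}"
  shows "deg (wedge E F) c = deg E c + deg F c"
proof -
  have "{w. wedge E F c w} = {w. E c w} \<union> {w. F c w}" by (auto simp: wedge_def)
  moreover have "{w. E c w} \<inter> {w. F c w} = {}"
    using assms by (fastforce simp: ugraph_def)
  ultimately show ?thesis
    using assms by (simp add: deg_def card_Un_disjoint graph_nbrs)
qed

definition single_edge :: "'a \<Rightarrow> 'a \<Rightarrow> 'a \<Rightarrow> 'a \<Rightarrow> bool" where
  "single_edge a b x y \<longleftrightarrow> {x, y} = {a, b}"

lemma single_edge_graph: "a \<noteq> b \<Longrightarrow> ugraph {a, b} (single_edge a b)"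
  by (auto simp: ugraph_def single_edge_def doubleton_eq_iff)

lemma single_edge_girth_ge: "a \<noteq> b \<Longrightarrow> girth_ge g (single_edge a b)"
  unfolding girth_ge_def
proof (intro allI impI)
  fix u v assume "a \<noteq> b" "single_edge a b u v"
  then have "potential g (single_edge a b) u v (\<lambda>x. if x = u then - int g else 0)"
    by (auto simp: potential_def single_edge_def doubleton_eq_iff)
  then show "\<exists>\<phi>. potential g (single_edge a b) u v \<phi>" by blast
qed

lemma single_edge_deg: "a \<noteq> b \<Longrightarrow> deg (single_edge a b) a = 1" "a \<noteq> b \<Longrightarrow> deg (single_edge a b) b = 1"
proof -
  assume "a \<noteq> b"
  then have "{w. single_edge a b a w} = {b}" "{w. single_edge a b b w} = {a}"
    by (auto simp: single_edge_def doubleton_eq_iff)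
  then show "deg (single_edge a b) a = 1" "deg (single_edge a b) b = 1" by (simp_all add: deg_def)
qed

text \<open>Units of demand are served in pairs, each pair by one opened copy of the regular graph,
  so the number of added vertices is linear in the total demand.\<close>

lemma fill_even:
  fixes V :: "'a set"
  assumes inf: "infinite (UNIV :: 'a set)"
    and K: "ugraph (VK :: nat set) EK" "girth_ge g EK" "VK \<noteq> {}" "\<forall>v\<in>VK. deg EK v = k"
    and k: "k \<ge> 1" and g: "g \<ge> 3"
    and "ugraph V E" "girth_ge g E" "even (sum b V)"
  shows "\<exists>V' E'. extension k g b V E V' E' \<and> card V' \<le> card V + card VK * sum b V"
  using assms(8-10)
proof (induction "sum b V" arbitrary: V E b rule: less_induct)
  case less
  have finV: "finite V" using less.prems by (simp add: graph_finite)
  show ?case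
  proof (cases "sum b V = 0")
    case True
    then have "extension k g b V E V E"
      using less.prems finV by (intro extension_refl) auto
    then show ?thesis by auto
  next
    case False
    then obtain v where v: "v \<in> V" "b v > 0" by (metis gr0I sum.neutral)
    define b1 where "b1 = b(v := b v - 1)"
    have s1: "sum b V = Suc (sum b1 V)"
      using v finV by (simp add: b1_def sum.remove[of V v] sum.If_cases Diff_eq)
    then have "odd (sum b1 V)" using less.prems by simp
    then have "sum b1 V \<noteq> 0" by (metis even_zero)
    then obtain w where w: "w \<in> V" "b1 w > 0" by (metis gr0I sum.neutral)
    define b2 where "b2 = b1(w := b1 w - 1)"
    have s2: "sum b1 V = Suc (sum b2 V)"
      using w finV by (simp add: b2_def sum.remove[of V w] sum.If_cases Diff_eq)
    \<comment> \<open>The unit at \<open>w\<close> is chosen after \<open>v\<close> has been served,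
      so \<open>v = w\<close> is possible and \<open>b0\<close> then takes the value 2.\<close>
    define b0 where "b0 x = (of_bool (x = v) + of_bool (x = w) :: nat)" for x
    have b: "b0 x + b2 x = b x" for x
      using v w by (auto simp: b0_def b2_def b1_def split: if_splits)
    obtain f :: "nat \<Rightarrow> 'a" where f: "inj f" "range f \<inter> V = {}"
      using fresh_embedding[OF inf finV] .
    have fK: "inj_on f VK" using f(1) by (rule inj_on_subset) simp
    obtain a0 where "a0 \<in> VK" using K(3) by auto
    have "{c. EK a0 c} \<noteq> {}"
    proof
      assume "{c. EK a0 c} = {}"
      then have "deg EK a0 = 0" by (simp only: deg_def card.empty)
      then show False using K(4) \<open>a0 \<in> VK\<close> k by simp
    qed
    then obtain c0 where "EK a0 c0" by auto
    then have ab: "relabel f EK (f a0) (f c0)" by (auto simp: relabel_def)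
    interpret gadget V E "f ` VK" "relabel f EK" v w "f a0" "f c0" g
      using less.prems f v w ab g K fK
      by unfold_locales (auto intro: relabel_graph relabel_girth_ge)
    let ?V = "V \<union> f ` VK"
    have degK: "deg E' x = k" if "x \<in> f ` VK" for x
      using that K(4) by (auto simp: deg_new relabel_deg[OF K(1) fK])
    have ext: "extension k g b0 V E ?V E'"
      unfolding extension_def
    proof (intro conjI ballI impI)
      show "ugraph ?V E'" by (rule ugraph')
      show "girth_ge g E'" by (rule girth_ge')
      show "E' x y \<longleftrightarrow> E x y" if "x \<in> V" "y \<in> V" for x y using old_edges that .
      show "deg E' x = deg E x + b0 x" if "x \<in> V" for x using deg_old[OF that] by (simp add: b0_def)
      show "deg E' x = k" if "x \<in> ?V - V" for x using degK that by auto
      show "b0 y > 0" if "x \<in> ?V - V" "y \<in> V" "E' x y" for x y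
        using cross_edges[of x y] that by (auto simp: b0_def)
    qed auto
    define c where "c x = (if x \<in> V then b2 x else 0)" for x
    have "sum c ?V = sum c V"
      using finV K(1) by (intro sum.mono_neutral_right) (auto simp: c_def graph_finite)
    also have "\<dots> = sum b2 V" by (intro sum.cong) (auto simp: c_def)
    finally have sc: "sum c ?V = sum b2 V" .
    then have "sum c ?V < sum b V" "even (sum c ?V)" using s1 s2 less.prems by auto
    from less.hyps[OF this(1) ugraph' girth_ge' this(2)] obtain V2 E2 where
      2: "extension k g c ?V E' V2 E2" "card V2 \<le> card ?V + card VK * sum c ?V" by blast
    have "extension k g b V E V2 E2"
      by (rule extension_trans[OF ext 2(1)]) (use b in \<open>auto simp: c_def\<close>)
    moreover have "card ?V \<le> card V + card VK"
      by (metis K(1) card_Un_le card_image_le graph_finite nat_add_left_cancel_le order_trans)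
    then have "card V2 \<le> card V + card VK * sum b V"
      using 2(2) s1 s2 sc by (simp add: algebra_simps)
    ultimately show ?thesis by blast
  qed
qed

text \<open>By counting degrees, an even \<open>k\<close> forces an even demand. For odd
  \<open>k\<close>, an odd demand is made even by a pendant vertex that uses up one unit and itself
  asks for the even number \<open>k - 1\<close>. \<open>C\<close> is fixed before the graph, which
  later makes the overhead bounded.\<close>

lemma fill:
  assumes "k \<ge> 1" "g \<ge> 3"
  obtains C :: nat where "\<And>(V :: 'a set) E b. infinite (UNIV :: 'a set) \<Longrightarrow> ugraph V E \<Longrightarrow> girth_ge g E \<Longrightarrow>
    (even k \<Longrightarrow> even (sum b V)) \<Longrightarrow>
    \<exists>V' E'. extension k g b V E V' E' \<and> card V' \<le> card V + C * (sum b V + k)"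
proof -
  obtain VK :: "nat set" and EK where
    K: "ugraph VK EK" "girth_ge g EK" "VK \<noteq> {}" "\<forall>v\<in>VK. deg EK v = k"
    using exists_regular_graph by metis
  have "card VK \<ge> 1"
    using K graph_finite[OF K(1)] by (simp add: Suc_le_eq card_gt_0_iff)
  show thesis
  proof (rule that[of "card VK + 1"])
    fix V :: "'a set" and E and b :: "'a \<Rightarrow> nat"
    assume inf: "infinite (UNIV :: 'a set)" and VE: "ugraph V E" "girth_ge g E"
      and ev: "even k \<Longrightarrow> even (sum b V)"
    note fe = fill_even[OF inf K assms]
    have finV: "finite V" using VE by (simp add: graph_finite)
    show "\<exists>V' E'. extension k g b V E V' E' \<and> card V' \<le> card V + (card VK + 1) * (sum b V + k)"
    proof (cases "even (sum b V)")
      case True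
      from fe[OF VE this] obtain V' E' where
        "extension k g b V E V' E'" "card V' \<le> card V + card VK * sum b V" by blast
      moreover have "card VK * sum b V \<le> (card VK + 1) * (sum b V + k)"
        by (intro mult_mono) auto
      ultimately show ?thesis by fastforce
    next
      case False
      then have "odd k" using ev by blast
      have "sum b V \<noteq> 0" using False by (metis even_zero)
      then obtain v where v: "v \<in> V" "b v > 0" by (metis gr0I sum.neutral)
      obtain z where z: "z \<notin> V" using ex_new_if_finite[OF inf finV] ..
      have vz: "v \<noteq> z" "V \<inter> {v, z} \<subseteq> {v}" using v z by auto
      let ?E = "wedge E (single_edge v z)" and ?V = "V \<union> {v, z}"
      note se = single_edge_graph[OF vz(1)]
      have G: "ugraph ?V ?E" by (rule wedge_graph[OF VE(1) se])
      have girth_ge: "girth_ge g ?E" by (rule wedge_girth_ge[OF VE(1) se vz(2) VE(2) single_edge_girth_ge[OF vz(1)]])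
      define b0 where "b0 x = (of_bool (x = v) :: nat)" for x
      define c where "c x = (if x = z then k - 1 else if x = v then b v - 1 else b x)" for x
      have V: "?V = insert z V" using v by auto
      have "sum c ?V = (k - 1) + sum c V" unfolding V using z finV by (simp add: c_def)
      also have "sum c V = (b v - 1) + sum c (V - {v})"
        using v finV vz by (simp add: sum.remove c_def)
      also have "sum c (V - {v}) = sum b (V - {v})" using z by (intro sum.cong) (auto simp: c_def)
      finally have sc: "sum c ?V + 1 = (k - 1) + sum b V"
        using v finV by (simp add: sum.remove[of V v])
      then have "even (sum c ?V)" using False \<open>odd k\<close> assms(1)
        by (metis Suc_eq_plus1 even_Suc even_add odd_pos odd_two_times_div_two_nat dvd_triv_left)
      from fe[OF G girth_ge this] obtain V2 E2 where
        2: "extension k g c ?V ?E V2 E2" "card V2 \<le> card ?V + card VK * sum c ?V" by blast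
      have degv: "deg ?E v = deg E v + 1"
        using wedge_deg_root[OF VE(1) se vz(2)] single_edge_deg(1)[OF vz(1)] by simp
      have degz: "deg ?E z = 1"
        using wedge_deg2[OF VE(1) z] single_edge_deg(2)[OF vz(1)] by simp
      have degx: "deg ?E x = deg E x" if "x \<in> V" "x \<noteq> v" for x
        using that z by (intro wedge_deg1[OF se]) auto
      note D2 = extensionD[OF 2(1)]
      have E2: "V \<subseteq> V2" "ugraph V2 E2" "girth_ge g E2" using D2(1-3) by auto
      have "extension k g b V E V2 E2"
        unfolding extension_def
      proof (intro conjI ballI impI)
        fix x assume x: "x \<in> V"
        have "deg E2 x = deg ?E x + c x" using D2(5) x by simp
        then show "deg E2 x = deg E x + b x"
          using degv degx[OF x] x z v by (auto simp: c_def)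
      next
        fix x y assume xy: "x \<in> V" "y \<in> V"
        then have "E2 x y \<longleftrightarrow> ?E x y" using D2(4) by simp
        then show "E2 x y \<longleftrightarrow> E x y" using xy z by (auto simp: wedge_def single_edge_def doubleton_eq_iff)
      next
        fix x assume x: "x \<in> V2 - V"
        show "deg E2 x = k"
        proof (cases "x = z")
          case True
          have "deg E2 z = deg ?E z + c z" using D2(5) by simp
          then show ?thesis using True degz assms(1) by (simp add: c_def)
        next
          case False
          then show ?thesis using D2(6)[of x] x v by auto
        qed
      next
        fix x y assume xy: "x \<in> V2 - V" "y \<in> V" "E2 x y"
        show "b y > 0"
        proof (cases "x = z")
          case True
          then have "?E x y" using D2(4)[of x y] xy by simp
          then show ?thesis using True v z VE(1)
            by (auto simp: wedge_def single_edge_def doubleton_eq_iff ugraph_def)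
        next
          case False
          then have "x \<notin> ?V" using xy v by auto
          then have "c y > 0" using D2(7)[of x y] xy by simp
          then show ?thesis using xy z v by (auto simp: c_def split: if_splits)
        qed
      qed (use E2 in auto)
      moreover have "card ?V \<le> card V + 1" unfolding V using finV by (simp add: card_insert_if)
      then have "card V2 \<le> card V + (card VK + 1) * (sum b V + k)"
      proof -
        have "card VK * sum c ?V \<le> card VK * (sum b V + k)"
          using sc by (intro mult_le_mono2) simp
        then have "card V2 \<le> (card V + 1) + card VK * (sum b V + k)"
          using 2(2) \<open>card ?V \<le> card V + 1\<close> by linarith
        then show ?thesis using assms(1) by (simp add: algebra_simps)
      qed
      ultimately show ?thesis by blast
    qed
  qed
qed

section \<open>Computable functions of a register assignment\<close>

definition reaches :: "prog \<Rightarrow> (nat \<Rightarrow> nat) \<Rightarrow> (nat \<Rightarrow> nat) \<Rightarrow> bool" where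
  "reaches P s s' \<longleftrightarrow> (\<exists>t. runs P s t s')"

lemma reaches_Inc: "reaches (Inc r) s (s(r := s r + 1))"
  unfolding reaches_def by (blast intro: runs.Inc)

lemma reaches_Dec: "reaches (Dec r) s (s(r := s r - 1))"
  unfolding reaches_def by (blast intro: runs.Dec)

lemma reaches_Seq: "reaches P s s' \<Longrightarrow> reaches Q s' s'' \<Longrightarrow> reaches (Seq P Q) s s''"
  unfolding reaches_def by (blast intro: runs.Seq)

lemma reaches_stop: "s r = 0 \<Longrightarrow> reaches (While r P) s s"
  unfolding reaches_def by (blast intro: runs.While_stop)

lemma reaches_step:
  "s r \<noteq> 0 \<Longrightarrow> reaches P s s' \<Longrightarrow> reaches (While r P) s' s'' \<Longrightarrow> reaches (While r P) s s''"
  unfolding reaches_def by (blast intro: runs.While_step)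

lemma reaches_witness: "reaches P s s' \<Longrightarrow> Q s' \<Longrightarrow> \<exists>s'. reaches P s s' \<and> Q s'"
  by blast

lemma reaches_While:
  fixes \<mu> :: "(nat \<Rightarrow> nat) \<Rightarrow> nat"
  assumes step: "\<And>s. I s \<Longrightarrow> s r \<noteq> 0 \<Longrightarrow> \<exists>s'. reaches P s s' \<and> I s' \<and> \<mu> s' < \<mu> s"
    and "I s"
  shows "\<exists>s'. reaches (While r P) s s' \<and> I s' \<and> s' r = 0"
  using assms(2)
proof (induction "\<mu> s" arbitrary: s rule: less_induct)
  case less
  show ?case
  proof (cases "s r = 0")
    case True
    then show ?thesis using reaches_stop less.prems by blast
  next
    case False
    then obtain s' where s': "reaches P s s'" "I s'" "\<mu> s' < \<mu> s"
      using step less.prems by blast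
    from less.hyps[OF s'(3,2)] obtain s'' where
      "reaches (While r P) s' s''" "I s''" "s'' r = 0" by blast
    then show ?thesis using reaches_step[OF False s'(1)] by blast
  qed
qed

definition clear :: "nat \<Rightarrow> prog" where
  "clear r = While r (Dec r)"

lemma reaches_clear: "reaches (clear r) s (s(r := 0))"
proof -
  have "\<exists>s'. reaches (While r (Dec r)) s s' \<and> (\<forall>i. i \<noteq> r \<longrightarrow> s' i = s i) \<and> s' r = 0"
    by (rule reaches_While[where \<mu> = "\<lambda>s. s r" and I = "\<lambda>s'. \<forall>i. i \<noteq> r \<longrightarrow> s' i = s i"]) (rule reaches_witness[OF reaches_Dec], auto)
  then obtain s' where s': "reaches (While r (Dec r)) s s'" "\<forall>i. i \<noteq> r \<longrightarrow> s' i = s i" "s' r = 0"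
    by blast
  then have "s' = s(r := 0)" by auto
  then show ?thesis using s' by (simp add: clear_def)
qed

definition move :: "nat \<Rightarrow> nat \<Rightarrow> prog" where
  "move a b = Seq (clear b) (While a (Seq (Dec a) (Inc b)))"

lemma reaches_move:
  assumes "a \<noteq> b"
  shows "reaches (move a b) s (s(b := s a, a := 0))"
proof -
  let ?s = "s(b := 0)" and ?P = "Seq (Dec a) (Inc b)"
  have "\<exists>s'. reaches (While a ?P) ?s s' \<and>
      (s' a + s' b = s a \<and> (\<forall>i. i \<noteq> a \<longrightarrow> i \<noteq> b \<longrightarrow> s' i = s i)) \<and> s' a = 0"
  proof (rule reaches_While[where \<mu> = "\<lambda>s. s a" and
        I = "\<lambda>s'. s' a + s' b = s a \<and> (\<forall>i. i \<noteq> a \<longrightarrow> i \<noteq> b \<longrightarrow> s' i = s i)"])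
    fix s' :: "nat \<Rightarrow> nat"
    assume *: "s' a + s' b = s a \<and> (\<forall>i. i \<noteq> a \<longrightarrow> i \<noteq> b \<longrightarrow> s' i = s i)" "s' a \<noteq> 0"
    have r: "reaches ?P s' (s'(a := s' a - 1, b := s' b + 1))"
    proof -
      let ?t = "s'(a := s' a - 1)"
      have "reaches ?P s' (?t(b := ?t b + 1))"
        by (rule reaches_Seq[OF reaches_Dec reaches_Inc])
      then show ?thesis using assms by simp
    qed
    show "\<exists>s''. reaches ?P s' s'' \<and>
        (s'' a + s'' b = s a \<and> (\<forall>i. i \<noteq> a \<longrightarrow> i \<noteq> b \<longrightarrow> s'' i = s i)) \<and> s'' a < s' a"
      by (rule reaches_witness[OF r]) (use * assms in auto)
  qed (use assms in auto)
  then obtain s' where s': "reaches (While a ?P) ?s s'" "s' b = s a" "s' a = 0"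
    "\<forall>i. i \<noteq> a \<longrightarrow> i \<noteq> b \<longrightarrow> s' i = s i" by auto
  have eq: "s' = s(b := s a, a := 0)" using s' by (auto simp: fun_eq_iff)
  have "reaches (clear b) s ?s" by (rule reaches_clear)
  from reaches_Seq[OF this s'(1)] show ?thesis unfolding move_def eq .
qed

text \<open>\<open>c\<close> is scratch space: the value of \<open>a\<close> is consumed while it is
  written to \<open>b\<close> and \<open>c\<close>, then restored from \<open>c\<close>.\<close>

definition copy :: "nat \<Rightarrow> nat \<Rightarrow> nat \<Rightarrow> prog" where
  "copy a b c = Seq (clear b) (Seq (clear c)
     (Seq (While a (Seq (Dec a) (Seq (Inc b) (Inc c)))) (move c a)))"

lemma reaches_copy:
  assumes "a \<noteq> b" "a \<noteq> c" "b \<noteq> c"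
  shows "reaches (copy a b c) s (s(b := s a, c := 0))"
proof -
  let ?s = "s(b := 0, c := 0)" and ?P = "Seq (Dec a) (Seq (Inc b) (Inc c))"
  have "\<exists>s'. reaches (While a ?P) ?s s' \<and>
      (s' a + s' b = s a \<and> s' b = s' c \<and> (\<forall>i. i \<notin> {a, b, c} \<longrightarrow> s' i = s i)) \<and> s' a = 0"
  proof (rule reaches_While[where \<mu> = "\<lambda>s. s a" and
        I = "\<lambda>s'. s' a + s' b = s a \<and> s' b = s' c \<and> (\<forall>i. i \<notin> {a, b, c} \<longrightarrow> s' i = s i)"])
    fix s' :: "nat \<Rightarrow> nat"
    assume *: "s' a + s' b = s a \<and> s' b = s' c \<and> (\<forall>i. i \<notin> {a, b, c} \<longrightarrow> s' i = s i)" "s' a \<noteq> 0"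
    have r: "reaches ?P s' (s'(a := s' a - 1, b := s' b + 1, c := s' c + 1))"
    proof -
      let ?t = "s'(a := s' a - 1)"
      let ?u = "?t(b := ?t b + 1)"
      have "reaches ?P s' (?u(c := ?u c + 1))"
        by (rule reaches_Seq[OF reaches_Dec reaches_Seq[OF reaches_Inc reaches_Inc]])
      then show ?thesis using assms by simp
    qed
    show "\<exists>s''. reaches ?P s' s'' \<and>
        (s'' a + s'' b = s a \<and> s'' b = s'' c \<and> (\<forall>i. i \<notin> {a, b, c} \<longrightarrow> s'' i = s i)) \<and> s'' a < s' a"
      by (rule reaches_witness[OF r]) (use * assms in auto)
  qed (use assms in auto)
  then obtain s' where s': "reaches (While a ?P) ?s s'" "s' b = s a" "s' c = s a" "s' a = 0"
    "\<forall>i. i \<notin> {a, b, c} \<longrightarrow> s' i = s i" by auto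
  have m: "reaches (move c a) s' (s'(a := s' c, c := 0))"
    by (rule reaches_move) (use assms in simp)
  have eq: "s'(a := s' c, c := 0) = s(b := s a, c := 0)"
    using s' assms by (auto simp: fun_eq_iff)
  have c: "reaches (clear b) s (s(b := 0))" "reaches (clear c) (s(b := 0)) ?s"
    by (rule reaches_clear)+
  from reaches_Seq[OF c(1) reaches_Seq[OF c(2) reaches_Seq[OF s'(1) m]]]
  show ?thesis unfolding copy_def eq .
qed

text \<open>\<open>m\<close> acts as the number of variables in scope. A variable bound by a
  quantifier or a recursion lives in a register \<open>x\<close> with \<open>x \<ge> m\<close>,
  hence the form \<open>F (s x) s\<close> in the rules below.\<close>

definition dep :: "nat \<Rightarrow> ((nat \<Rightarrow> nat) \<Rightarrow> 'a) \<Rightarrow> bool" where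
  "dep m F \<longleftrightarrow> (\<forall>s s'. (\<forall>i<m. s i = s' i) \<longrightarrow> F s = F s')"

text \<open>The registers from \<open>N\<close> on are scratch space with arbitrary contents. As \<open>N\<close> is arbitrary in
  \<open>computable\<close>, programs can be nested without clashes between their registers.\<close>

definition computes :: "nat \<Rightarrow> prog \<Rightarrow> ((nat \<Rightarrow> nat) \<Rightarrow> nat) \<Rightarrow> bool" where
  "computes N P F \<longleftrightarrow> (\<forall>s. \<exists>s'. reaches P s s' \<and> s' N = F s \<and> (\<forall>i<N. s' i = s i))"

definition computable :: "nat \<Rightarrow> ((nat \<Rightarrow> nat) \<Rightarrow> nat) \<Rightarrow> bool" where
  "computable m F \<longleftrightarrow> dep m F \<and> (\<forall>N\<ge>m. \<exists>P. computes N P F)"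

lemma depI: "(\<And>s s'. (\<And>i. i < m \<Longrightarrow> s i = s' i) \<Longrightarrow> F s = F s') \<Longrightarrow> dep m F"
  unfolding dep_def by blast

lemma depD: "dep m F \<Longrightarrow> (\<And>i. i < m \<Longrightarrow> s i = s' i) \<Longrightarrow> F s = F s'"
  unfolding dep_def by blast

lemma computesI:
  "(\<And>s. \<exists>s'. reaches P s s' \<and> s' N = F s \<and> (\<forall>i<N. s' i = s i)) \<Longrightarrow> computes N P F"
  by (simp add: computes_def)

lemma computesD:
  "computes N P F \<Longrightarrow> \<exists>s'. reaches P s s' \<and> s' N = F s \<and> (\<forall>i<N. s' i = s i)"
  unfolding computes_def by blast

lemma compI:
  assumes "dep m F" "\<And>N. N \<ge> m \<Longrightarrow> \<exists>P. computes N P F"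
  shows "computable m F"
  unfolding computable_def using assms by blast

lemma comp_dep: "computable m F \<Longrightarrow> dep m F"
  by (simp add: computable_def)

lemma comp_prog: "computable m F \<Longrightarrow> N \<ge> m \<Longrightarrow> \<exists>P. computes N P F"
  by (simp add: computable_def)

lemma comp_var: "i < m \<Longrightarrow> computable m (\<lambda>s. s i)"
proof (rule compI)
  fix N assume "i < m" "m \<le> N"
  then have "i \<noteq> N" "i \<noteq> Suc N" by auto
  then have "computes N (copy i N (Suc N)) (\<lambda>s. s i)"
    by (intro computesI reaches_witness[OF reaches_copy]) auto
  then show "\<exists>P. computes N P (\<lambda>s. s i)" by blast
qed (rule depI)

lemma comp_zero: "computable m (\<lambda>s. 0)"
proof (rule compI)
  fix N
  have "computes N (clear N) (\<lambda>s. 0)"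
    by (intro computesI reaches_witness[OF reaches_clear]) auto
  then show "\<exists>P. computes N P (\<lambda>s. 0)" by blast
qed (rule depI, simp)

lemma comp_Suc: "computable m F \<Longrightarrow> computable m (\<lambda>s. Suc (F s))"
proof (rule compI)
  fix N assume F: "computable m F" and "m \<le> N"
  then obtain P where P: "computes N P F" using comp_prog by blast
  have "computes N (Seq P (Inc N)) (\<lambda>s. Suc (F s))"
  proof (rule computesI)
    fix s
    obtain s' where "reaches P s s'" "s' N = F s" "\<And>i. i < N \<Longrightarrow> s' i = s i"
      using computesD[OF P] by blast
    then show "\<exists>s'. reaches (Seq P (Inc N)) s s' \<and> s' N = Suc (F s) \<and> (\<forall>i<N. s' i = s i)"
      by (intro reaches_witness[OF reaches_Seq[OF _ reaches_Inc]]) auto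
  qed
  then show "\<exists>P. computes N P (\<lambda>s. Suc (F s))" by blast
next
  assume "computable m F"
  then show "dep m (\<lambda>s. Suc (F s))" unfolding computable_def dep_def by metis
qed

text \<open>The value of \<open>G\<close> stays in register \<open>N\<close> while \<open>F\<close>
  is evaluated one register higher, so \<open>N\<close> serves as the bound variable.\<close>

lemma comp_let:
  assumes G: "computable m G" and dF: "\<And>c. dep m (F c)"
    and F: "\<And>x. x \<ge> m \<Longrightarrow> computable (Suc x) (\<lambda>s. F (s x) s)"
  shows "computable m (\<lambda>s. F (G s) s)"
proof (rule compI)
  show "dep m (\<lambda>s. F (G s) s)"
  proof (rule depI)
    fix s s' :: "nat \<Rightarrow> nat" assume *: "\<And>i. i < m \<Longrightarrow> s i = s' i"
    show "F (G s) s = F (G s') s'"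
      using depD[OF comp_dep[OF G] *] depD[OF dF *] by simp
  qed
next
  fix N assume N: "m \<le> N"
  obtain P where P: "computes N P G" using comp_prog[OF G N] by blast
  obtain Q where Q: "computes (Suc N) Q (\<lambda>s. F (s N) s)"
    using comp_prog[OF F[OF N]] by blast
  have "computes N (Seq P (Seq Q (move (Suc N) N))) (\<lambda>s. F (G s) s)"
  proof (rule computesI)
    fix s
    obtain s1 where 1: "reaches P s s1" "s1 N = G s" "\<And>i. i < N \<Longrightarrow> s1 i = s i"
      using computesD[OF P] by blast
    obtain s2 where 2: "reaches Q s1 s2" "s2 (Suc N) = F (s1 N) s1" "\<And>i. i < Suc N \<Longrightarrow> s2 i = s1 i"
      using computesD[OF Q] by blast
    have 3: "reaches (move (Suc N) N) s2 (s2(N := s2 (Suc N), Suc N := 0))"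
      by (rule reaches_move) simp
    have "F (s1 N) s1 = F (G s) s"
      unfolding 1(2) using depD[OF dF, where s = s1 and s' = s] 1(3) N by simp
    then show "\<exists>s'. reaches (Seq P (Seq Q (move (Suc N) N))) s s' \<and> s' N = F (G s) s \<and>
        (\<forall>i<N. s' i = s i)"
      by (intro reaches_witness[OF reaches_Seq[OF 1(1) reaches_Seq[OF 2(1) 3]]]) (use 1 2 in auto)
  qed
  then show "\<exists>P. computes N P (\<lambda>s. F (G s) s)" by blast
qed

text \<open>Primitive recursion as a loop: \<open>N\<close> counts down, \<open>?x\<close> holds the
  recursion index, \<open>?y\<close> accumulates and \<open>?z\<close> receives the result of one
  round. Arithmetic, bounded sums and bounded quantifiers all reduce to this rule.\<close>

lemma comp_rec:
  assumes A: "computable m A" and B: "computable m B" and dF: "\<And>i c. dep m (F i c)"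
    and F: "\<And>x. x \<ge> m \<Longrightarrow> computable (Suc (Suc x)) (\<lambda>s. F (s x) (s (Suc x)) s)"
  shows "computable m (\<lambda>s. rec_nat (A s) (\<lambda>i c. F i c s) (B s))"
proof (rule compI)
  show "dep m (\<lambda>s. rec_nat (A s) (\<lambda>i c. F i c s) (B s))"
  proof (rule depI)
    fix s s' :: "nat \<Rightarrow> nat" assume *: "\<And>i. i < m \<Longrightarrow> s i = s' i"
    have "(\<lambda>i c. F i c s) = (\<lambda>i c. F i c s')"
      using depD[OF dF *] by (simp add: fun_eq_iff)
    then show "rec_nat (A s) (\<lambda>i c. F i c s) (B s) = rec_nat (A s') (\<lambda>i c. F i c s') (B s')"
      using depD[OF comp_dep[OF A] *] depD[OF comp_dep[OF B] *] by simp
  qed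
next
  fix N assume N: "m \<le> N"
  let ?x = "Suc N" and ?y = "Suc (Suc N)" and ?z = "Suc (Suc (Suc N))"
  obtain P where P: "computes N P B" using comp_prog[OF B N] by blast
  have "m \<le> ?y" "m \<le> ?x" using N by auto
  then obtain P' where P': "computes ?y P' A" using comp_prog[OF A] by blast
  obtain Q where Q: "computes ?z Q (\<lambda>s. F (s ?x) (s ?y) s)"
    using comp_prog[OF F[OF \<open>m \<le> ?x\<close>]] by blast
  define body where "body = Seq (Seq Q (move ?z ?y)) (Seq (Inc ?x) (Dec N))"
  let ?rec = "\<lambda>s i. rec_nat (A s) (\<lambda>i c. F i c s) i"
  have "computes N (Seq P (Seq (clear ?x) (Seq P' (Seq (While N body) (move ?y N)))))
      (\<lambda>s. ?rec s (B s))"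
  proof (rule computesI)
    fix s
    obtain s1 where 1: "reaches P s s1" "s1 N = B s" "\<And>i. i < N \<Longrightarrow> s1 i = s i"
      using computesD[OF P] by blast
    let ?s2 = "s1(?x := 0)"
    obtain s3 where 3: "reaches P' ?s2 s3" "s3 ?y = A ?s2" "\<And>i. i < ?y \<Longrightarrow> s3 i = ?s2 i"
      using computesD[OF P'] by blast
    have "A ?s2 = A s" by (rule depD[OF comp_dep[OF A]]) (use 1 N in simp)
    define I where "I s' \<longleftrightarrow> s' N + s' ?x = B s \<and> s' ?y = ?rec s (s' ?x) \<and> (\<forall>i<N. s' i = s i)" for s'
    have I3: "I s3" using 1 3 \<open>A ?s2 = A s\<close> by (simp add: I_def)
    have "\<exists>s'. reaches (While N body) s3 s' \<and> I s' \<and> s' N = 0"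
    proof (rule reaches_While[where \<mu> = "\<lambda>s. s N" and I = I, OF _ I3])
      fix t assume I: "I t" and "t N \<noteq> 0"
      obtain t1 where t1: "reaches Q t t1" "t1 ?z = F (t ?x) (t ?y) t" "\<And>i. i < ?z \<Longrightarrow> t1 i = t i"
        using computesD[OF Q] by blast
      let ?t2 = "t1(?y := t1 ?z, ?z := 0)"
      have "reaches (move ?z ?y) t1 ?t2" by (rule reaches_move) simp
      then have r: "reaches body t (?t2(?x := ?t2 ?x + 1, N := (?t2(?x := ?t2 ?x + 1)) N - 1))"
        unfolding body_def
        by (rule reaches_Seq[OF reaches_Seq[OF t1(1)] reaches_Seq[OF reaches_Inc reaches_Dec]])
      have Ft: "F (t ?x) (t ?y) t = F (t ?x) (t ?y) s"
        by (rule depD[OF dF]) (use I N in \<open>simp add: I_def\<close>)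
      show "\<exists>t'. reaches body t t' \<and> I t' \<and> t' N < t N"
        by (rule reaches_witness[OF r]) (use Ft t1 I \<open>t N \<noteq> 0\<close> in \<open>auto simp: I_def\<close>)
    qed
    then obtain s4 where 4: "reaches (While N body) s3 s4" "I s4" "s4 N = 0" by blast
    have 5: "reaches (move ?y N) s4 (s4(N := s4 ?y, ?y := 0))"
      by (rule reaches_move) simp
    show "\<exists>s'. reaches (Seq P (Seq (clear ?x) (Seq P' (Seq (While N body) (move ?y N))))) s s' \<and>
        s' N = ?rec s (B s) \<and> (\<forall>i<N. s' i = s i)"
      by (rule reaches_witness[OF reaches_Seq[OF 1(1) reaches_Seq[OF reaches_clear
          reaches_Seq[OF 3(1) reaches_Seq[OF 4(1) 5]]]]]) (use 4(2,3) in \<open>auto simp: I_def\<close>)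
  qed
  then show "\<exists>P. computes N P (\<lambda>s. ?rec s (B s))" by blast
qed

section \<open>Arithmetic and decidable predicates\<close>

definition decidable :: "nat \<Rightarrow> ((nat \<Rightarrow> nat) \<Rightarrow> bool) \<Rightarrow> bool" where
  "decidable m P \<longleftrightarrow> computable m (\<lambda>s. of_bool (P s))"

lemma dep_mono: "dep m F \<Longrightarrow> m \<le> n \<Longrightarrow> dep n F"
  unfolding dep_def by (meson less_le_trans)

lemma dep_const: "dep m (\<lambda>s. c)"
  by (simp add: dep_def)

lemma dep_comp1: "dep m F \<Longrightarrow> dep m (\<lambda>s. f (F s))"
  unfolding dep_def by metis

lemma dep_comp2: "dep m F \<Longrightarrow> dep m G \<Longrightarrow> dep m (\<lambda>s. f (F s) (G s))"
  unfolding dep_def by metis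

lemma comp_mono: "computable m F \<Longrightarrow> m \<le> n \<Longrightarrow> computable n F"
  unfolding computable_def by (meson dep_mono order_trans)

lemma comp_const: "computable m (\<lambda>s. c)"
  by (induction c) (auto intro: comp_zero comp_Suc)

lemma comp_add:
  assumes "computable m A" "computable m B"
  shows "computable m (\<lambda>s. A s + B s)"
proof -
  have "rec_nat a (\<lambda>i c. Suc c) b = a + b" for a b by (induction b) auto
  then show ?thesis
    using comp_rec[where F = "\<lambda>i c s. Suc c", OF assms] by (simp add: dep_const comp_Suc comp_var)
qed

lemma comp_pred: "computable m A \<Longrightarrow> computable m (\<lambda>s. A s - 1)"
proof -
  assume A: "computable m A"
  have "rec_nat 0 (\<lambda>i c. i) b = b - 1" for b :: nat by (induction b) auto
  then show ?thesis
    using comp_rec[where F = "\<lambda>i c s. i", OF comp_zero A] by (simp add: dep_const comp_var)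
qed

lemma comp_diff:
  assumes "computable m A" "computable m B"
  shows "computable m (\<lambda>s. A s - B s)"
proof -
  have "rec_nat a (\<lambda>i c. c - 1) b = a - b" for a b :: nat by (induction b) auto
  moreover have "computable (Suc (Suc x)) (\<lambda>s. s (Suc x) - 1)" for x
    by (intro comp_pred comp_var) simp
  ultimately show ?thesis
    using comp_rec[where F = "\<lambda>i c s. c - 1", OF assms] by (simp add: dep_const)
qed

lemma comp_sum:
  assumes B: "computable m B" and d: "\<And>i. dep m (F i)"
    and F: "\<And>x. x \<ge> m \<Longrightarrow> computable (Suc x) (\<lambda>s. F (s x) s)"
  shows "computable m (\<lambda>s. \<Sum>i<B s. F i s)"
proof -
  have "rec_nat 0 (\<lambda>i c. c + f i) b = (\<Sum>i<b. f i)" for f :: "nat \<Rightarrow> nat" and b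
    by (induction b) auto
  moreover have "computable (Suc (Suc x)) (\<lambda>s. s (Suc x) + F (s x) s)" if "x \<ge> m" for x
    by (intro comp_add comp_var comp_mono[OF F[OF that]]) auto
  ultimately show ?thesis
    using comp_rec[where F = "\<lambda>i c s. c + F i s", OF comp_zero B] d by (simp add: dep_comp1)
qed

lemma comp_mult:
  assumes "computable m A" "computable m B"
  shows "computable m (\<lambda>s. A s * B s)"
proof -
  have "computable m (\<lambda>s. \<Sum>i<B s. A s)"
    by (intro comp_sum assms comp_dep comp_mono[OF assms(1)]) auto
  then show ?thesis by (simp add: mult.commute)
qed

lemma comp_power:
  assumes "computable m A" "computable m B"
  shows "computable m (\<lambda>s. A s ^ B s)"
proof -
  have "rec_nat 1 (\<lambda>i c. c * a) b = a ^ b" for a b :: nat by (induction b) auto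
  moreover have "computable (Suc (Suc x)) (\<lambda>s. s (Suc x) * A s)" if "x \<ge> m" for x
    by (intro comp_mult comp_var comp_mono[OF assms(1)]) (use that in auto)
  ultimately show ?thesis
    using comp_rec[where F = "\<lambda>i c s. c * A s" and A = "\<lambda>s. 1", OF comp_const assms(2)] comp_dep[OF assms(1)]
    by (simp add: dep_comp1[where f = "\<lambda>a. c * a" for c])
qed

lemma dec_not: "decidable m P \<Longrightarrow> decidable m (\<lambda>s. \<not> P s)"
proof -
  assume "decidable m P"
  then have "computable m (\<lambda>s. 1 - of_bool (P s))"
    unfolding decidable_def by (rule comp_diff[OF comp_const])
  moreover have "1 - of_bool p = (of_bool (\<not> p) :: nat)" for p by simp
  ultimately show ?thesis unfolding decidable_def by (simp only:)
qed

lemma dec_conj: "decidable m P \<Longrightarrow> decidable m Q \<Longrightarrow> decidable m (\<lambda>s. P s \<and> Q s)"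
  unfolding decidable_def of_bool_conj by (rule comp_mult)

lemma dec_disj: "decidable m P \<Longrightarrow> decidable m Q \<Longrightarrow> decidable m (\<lambda>s. P s \<or> Q s)"
  using dec_not[OF dec_conj[OF dec_not[of m P] dec_not[of m Q]]] by simp

lemma dec_imp: "decidable m P \<Longrightarrow> decidable m Q \<Longrightarrow> decidable m (\<lambda>s. P s \<longrightarrow> Q s)"
  unfolding imp_conv_disj by (intro dec_disj dec_not)

lemma dec_le: "computable m A \<Longrightarrow> computable m B \<Longrightarrow> decidable m (\<lambda>s. A s \<le> B s)"
proof -
  assume "computable m A" "computable m B"
  then have "computable m (\<lambda>s. 1 - (A s - B s))"
    by (intro comp_diff comp_const)
  moreover have "1 - (a - b) = of_bool (a \<le> b)" for a b :: nat by auto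
  ultimately show ?thesis unfolding decidable_def by simp
qed

lemma dec_less: "computable m A \<Longrightarrow> computable m B \<Longrightarrow> decidable m (\<lambda>s. A s < B s)"
  unfolding Suc_le_eq[symmetric] by (intro dec_le comp_Suc)

lemma dec_eq: "computable m A \<Longrightarrow> computable m B \<Longrightarrow> decidable m (\<lambda>s. A s = B s)"
  unfolding order.eq_iff by (intro dec_conj dec_le)

text \<open>A bounded quantifier amounts to comparing a bounded sum of truth values with 0.\<close>

lemma dec_ex:
  assumes B: "computable m B" and d: "\<And>i. dep m (P i)"
    and P: "\<And>x. x \<ge> m \<Longrightarrow> decidable (Suc x) (\<lambda>s. P (s x) s)"
  shows "decidable m (\<lambda>s. \<exists>i<B s. P i s)"
proof -
  have "computable m (\<lambda>s. \<Sum>i<B s. of_bool (P i s))"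
  proof (rule comp_sum[OF B])
    show "dep m (\<lambda>s. of_bool (P i s))" for i by (rule dep_comp1[OF d])
    show "computable (Suc x) (\<lambda>s. of_bool (P (s x) s))" if "x \<ge> m" for x
      using P[OF that] unfolding decidable_def .
  qed
  then have "decidable m (\<lambda>s. 0 < (\<Sum>i<B s. of_bool (P i s) :: nat))"
    by (intro dec_less comp_zero)
  moreover have "(0 < (\<Sum>i<b. of_bool (Q i) :: nat)) \<longleftrightarrow> (\<exists>i<b. Q i)"
    for b :: nat and Q by (subst zero_less_iff_neq_zero, subst sum_eq_0_iff) auto
  ultimately show ?thesis by simp
qed

lemma dec_all:
  assumes B: "computable m B" and d: "\<And>i. dep m (P i)"
    and P: "\<And>x. x \<ge> m \<Longrightarrow> decidable (Suc x) (\<lambda>s. P (s x) s)"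
  shows "decidable m (\<lambda>s. \<forall>i<B s. P i s)"
proof -
  have "decidable m (\<lambda>s. \<not> (\<exists>i<B s. \<not> P i s))"
    by (intro dec_not dec_ex B dep_comp1[where f = Not, OF d] P)
  then show ?thesis by simp
qed

lemma comp_of_bool: "decidable m P \<Longrightarrow> computable m (\<lambda>s. of_bool (P s))"
  by (simp add: decidable_def)

text \<open>Division counts the positive multiples of the divisor up to the dividend; the guard
  \<open>0 < b\<close> gives the convention \<open>a div 0 = 0\<close>.\<close>

lemma comp_div:
  assumes "computable m A" "computable m B"
  shows "computable m (\<lambda>s. A s div B s)"
proof -
  have eq: "(\<Sum>i<a. of_bool (0 < b \<and> Suc i * b \<le> a)) = a div b" for a b :: nat
  proof (cases "b = 0")
    case False
    have "Suc i * b \<le> a \<longleftrightarrow> i < a div b" for i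
      using False less_eq_div_iff_mult_less_eq[of b "Suc i" a] by (simp add: Suc_le_eq)
    then have "(\<Sum>i<a. of_bool (0 < b \<and> Suc i * b \<le> a) :: nat) = card ({..<a} \<inter> {i. i < a div b})"
      using False by (simp only: sum_of_bool_eq finite_lessThan) simp
    also have "{..<a} \<inter> {i. i < a div b} = {..<a div b}"
      by (auto intro: less_le_trans[OF _ div_le_dividend])
    finally show ?thesis by simp
  qed simp
  note dA = comp_dep[OF assms(1)] and dB = comp_dep[OF assms(2)]
  have "computable m (\<lambda>s. \<Sum>i<A s. of_bool (0 < B s \<and> Suc i * B s \<le> A s))"
  proof (rule comp_sum[OF assms(1)])
    show "dep m (\<lambda>s. of_bool (0 < B s \<and> Suc i * B s \<le> A s))" for i
      by (rule dep_comp2[OF dA dB, of "\<lambda>a b. of_bool (0 < b \<and> Suc i * b \<le> a)"])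
    show "computable (Suc x) (\<lambda>s. of_bool (0 < B s \<and> Suc (s x) * B s \<le> A s))" if "x \<ge> m" for x
      using that
      by (intro comp_of_bool dec_conj dec_less dec_le comp_mult comp_Suc comp_var comp_const
          comp_mono[OF assms(1)] comp_mono[OF assms(2)]) auto
  qed
  then show ?thesis unfolding eq .
qed

lemma comp_mod: "computable m A \<Longrightarrow> computable m B \<Longrightarrow> computable m (\<lambda>s. A s mod B s)"
  unfolding minus_div_mult_eq_mod[symmetric] by (intro comp_diff comp_mult comp_div)

lemma dec_even: "computable m A \<Longrightarrow> decidable m (\<lambda>s. even (A s))"
  unfolding even_iff_mod_2_eq_zero by (intro dec_eq comp_mod comp_const)

text \<open>The only loop without an a priori bound. Register 2 holds the candidate and register 3
  the flag that it fails. The results are first put into registers 3 and 4, because the program for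
  \<open>q\<close> still reads the inputs.\<close>

lemma search_program:
  assumes R: "decidable 3 (\<lambda>s. R (s 0) (s 1) (s 2))"
    and p: "computable 3 (\<lambda>s. p (s 0) (s 1) (s 2))"
    and q: "computable 3 (\<lambda>s. q (s 0) (s 1) (s 2))"
  shows "\<exists>P. \<forall>a b. (\<exists>n. R a b n) \<longrightarrow>
    (\<exists>t s n. runs P (input a b) t s \<and> R a b n \<and> s 0 = p a b n \<and> s 1 = q a b n)"
proof -
  obtain P0 where P0: "computes 3 P0 (\<lambda>s. of_bool (\<not> R (s 0) (s 1) (s 2)))"
    using comp_prog[OF comp_of_bool[OF dec_not[OF R]], of 3] by blast
  obtain P1 where P1: "computes 3 P1 (\<lambda>s. p (s 0) (s 1) (s 2))"
    using comp_prog[OF p, of 3] by auto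
  obtain P2 where P2: "computes 4 P2 (\<lambda>s. q (s 0) (s 1) (s 2))"
    using comp_prog[OF q, of 4] by auto
  let ?loop = "While 3 (Seq (Inc 2) P0)"
  define P where "P = Seq P0 (Seq ?loop (Seq P1 (Seq P2 (Seq (move 3 0) (move 4 1)))))"
  show ?thesis
  proof (intro exI[of _ P] allI impI)
    fix a b assume ex: "\<exists>n. R a b n"
    from ex obtain N where RN: "R a b N" ..
    \<comment> \<open>\<open>N\<close> is some witness, not necessarily the least; the invariant
      says that the search does not run past it.\<close>
    define I where "I s \<longleftrightarrow> s 0 = a \<and> s 1 = b \<and> s 2 \<le> N \<and> s 3 = of_bool (\<not> R a b (s 2))" for s :: "nat \<Rightarrow> nat"
    obtain s1 where s1: "reaches P0 (input a b) s1"
      "s1 3 = of_bool (\<not> R (input a b 0) (input a b 1) (input a b 2))"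
      "\<forall>i<3. s1 i = input a b i" using computesD[OF P0] by blast
    then have I1: "I s1" by (simp add: I_def input_def)
    have "\<exists>s'. reaches ?loop s1 s' \<and> I s' \<and> s' 3 = 0"
    proof (rule reaches_While[where I = I and \<mu> = "\<lambda>s. N - s 2", OF _ I1])
      fix s assume I: "I s" and "s 3 \<noteq> 0"
      then have "\<not> R a b (s 2)" "s 2 < N" using RN by (auto simp: I_def le_less)
      let ?t = "s(2 := s 2 + 1)"
      obtain t where t: "reaches P0 ?t t" "t 3 = of_bool (\<not> R (?t 0) (?t 1) (?t 2))"
        "\<forall>i<3. t i = ?t i" using computesD[OF P0] by blast
      show "\<exists>s'. reaches (Seq (Inc 2) P0) s s' \<and> I s' \<and> N - s' 2 < N - s 2"
        by (rule reaches_witness[OF reaches_Seq[OF reaches_Inc t(1)]])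
          (use t I \<open>s 2 < N\<close> in \<open>auto simp: I_def\<close>)
    qed
    then obtain s2 where s2: "reaches ?loop s1 s2" "I s2" "s2 3 = 0" by blast
    obtain s3 where s3: "reaches P1 s2 s3" "s3 3 = p (s2 0) (s2 1) (s2 2)" "\<forall>i<3. s3 i = s2 i"
      using computesD[OF P1] by blast
    obtain s4 where s4: "reaches P2 s3 s4" "s4 4 = q (s3 0) (s3 1) (s3 2)" "\<forall>i<4. s4 i = s3 i"
      using computesD[OF P2] by blast
    let ?s5 = "s4(0 := s4 3, 3 := 0)"
    let ?s6 = "?s5(1 := ?s5 4, 4 := 0)"
    have m: "reaches (move 3 0) s4 ?s5" "reaches (move 4 1) ?s5 ?s6"
      by (rule reaches_move, simp)+
    have "reaches P (input a b) ?s6"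
      unfolding P_def
      by (rule reaches_Seq[OF s1(1) reaches_Seq[OF s2(1) reaches_Seq[OF s3(1)
          reaches_Seq[OF s4(1) reaches_Seq[OF m]]]]])
    moreover have "R a b (s2 2)" using s2 by (simp add: I_def)
    moreover have "?s6 0 = p a b (s2 2)" "?s6 1 = q a b (s2 2)"
      using s2 s3 s4 by (simp_all add: I_def)
    ultimately show "\<exists>t s n. runs P (input a b) t s \<and> R a b n \<and> s 0 = p a b n \<and> s 1 = q a b n"
      unfolding reaches_def by blast
  qed
qed

section \<open>Layered graphs\<close>

text \<open>A layered graph is a sequence of numbers: the bits of \<open>F t\<close> encode the edges inside layer \<open>t\<close>
  and between the layers \<open>t\<close> and \<open>t + 1\<close>. A loop at \<open>a\<close> in layer \<open>t\<close> means that the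
  vertex \<open>(t, a)\<close> is present.\<close>

definition intra :: "(nat \<Rightarrow> nat) \<Rightarrow> nat \<Rightarrow> nat \<Rightarrow> nat \<Rightarrow> bool" where
  "intra F t a b \<longleftrightarrow> bit (F t) (2 * prod_encode (a, b))"

definition inter :: "(nat \<Rightarrow> nat) \<Rightarrow> nat \<Rightarrow> nat \<Rightarrow> nat \<Rightarrow> bool" where
  "inter F t a b \<longleftrightarrow> bit (F t) (2 * prod_encode (a, b) + 1)"

definition adj :: "(nat \<Rightarrow> nat) \<Rightarrow> nat \<times> nat \<Rightarrow> nat \<times> nat \<Rightarrow> bool" where
  "adj F x y \<longleftrightarrow> (fst x = fst y \<and> snd x \<noteq> snd y \<and> intra F (fst x) (snd x) (snd y)) \<or>
     (fst y = Suc (fst x) \<and> inter F (fst x) (snd x) (snd y)) \<or>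
     (fst x = Suc (fst y) \<and> inter F (fst y) (snd y) (snd x))"

text \<open>Filled up with 0, a window is again a sequence and thus a layered graph. Its last letter
  still carries edges into one more layer.\<close>

definition window :: "nat \<Rightarrow> (nat \<Rightarrow> nat) \<Rightarrow> nat \<Rightarrow> nat \<Rightarrow> nat" where
  "window n F t s = (if s < n then F (t + s) else 0)"

definition layer_size :: "(nat \<Rightarrow> nat) \<Rightarrow> nat \<Rightarrow> nat" where
  "layer_size F t = card {a. intra F t a a}"

text \<open>The spine through the vertices \<open>0\<close> of all layers makes the distance between layers equal to the
  difference of their indices. The last condition reflects that for even \<open>k\<close> every cut in a
  \<open>k\<close>-regular graph consists of an even number of edges; it is what allows cutting and completing
  the graph.\<close>

definition admissible :: "nat \<Rightarrow> nat \<Rightarrow> (nat \<Rightarrow> nat) \<Rightarrow> nat \<Rightarrow> bool" where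
  "admissible k g F t \<longleftrightarrow> intra F t 0 0 \<and> inter F t 0 0 \<and>
     (\<forall>a b. intra F t a b \<longrightarrow> intra F t b a \<and> intra F t a a) \<and>
     (\<forall>a b. intra F t a a \<longrightarrow> b \<le> a \<longrightarrow> intra F t b b) \<and>
     (\<forall>a b. inter F t a b \<longrightarrow> intra F t a a \<and> intra F (Suc t) b b) \<and>
     (\<forall>a. intra F (Suc t) a a \<longrightarrow> card {b. inter F t b a} +
        card {b. b \<noteq> a \<and> intra F (Suc t) a b} + card {b. inter F (Suc t) a b} = k) \<and>
     (even k \<longrightarrow> even (card {(a, b). inter F t a b}))"

text \<open>Formulated through windows alone, because a period is split by exchanging sequences with
  equal windows. A walk of fewer than \<open>g\<close> steps stays within \<open>g\<close> layers of
  its start, that is in \<open>2 * g + 1\<close> layers, and the local conditions need two layers;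
  \<open>2 * g + 3\<close> covers both.\<close>

definition valid :: "nat \<Rightarrow> nat \<Rightarrow> (nat \<Rightarrow> nat) \<Rightarrow> bool" where
  "valid k g F \<longleftrightarrow> (\<forall>t. admissible k g (window (2 * g + 3) F t) 0 \<and>
     girth_ge g (adj (window (2 * g + 3) F t)))"

text \<open>The sequence is one-sided, so layer 0 lacks its lower neighbours and degrees are
  prescribed from layer 1 on. By periodicity nothing is lost: layer \<open>m\<close> is a complete
  copy of layer 0.\<close>

definition cyclic :: "nat \<Rightarrow> nat \<Rightarrow> nat \<Rightarrow> nat \<Rightarrow> bool" where
  "cyclic k g m w \<longleftrightarrow> (\<exists>F. m > 0 \<and> (\<forall>t. F (t + m) = F t) \<and> valid k g F \<and>
     (\<Sum>t<m. layer_size F t) = w)"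

lemma finite_bits: "finite {i. bit (n :: nat) i}"
proof (rule finite_subset)
  show "{i. bit n i} \<subseteq> {..<n}"
  proof
    fix i assume "i \<in> {i. bit n i}"
    then have "bit n i" by simp
    then have "n div 2 ^ i \<noteq> 0" by (metis bit_iff_odd even_zero)
    then have "2 ^ i \<le> n" by (simp add: div_eq_0_iff)
    then show "i \<in> {..<n}" by (simp add: less_le_trans[OF less_exp])
  qed
qed simp

lemma finite_inter: "finite {(a, b). inter F t a b}"
proof -
  have "{(a, b). inter F t a b} = (\<lambda>x. 2 * prod_encode x + 1) -` {i. bit (F t) i}"
    by (auto simp: inter_def)
  then show ?thesis
    by (simp only:) (rule finite_vimageI[OF finite_bits], simp add: inj_on_def)
qed

lemma finite_intra: "finite {(a, b). intra F t a b}"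
proof -
  have "{(a, b). intra F t a b} = (\<lambda>x. 2 * prod_encode x) -` {i. bit (F t) i}"
    by (auto simp: intra_def)
  then show ?thesis
    by (simp only:) (rule finite_vimageI[OF finite_bits], simp add: inj_on_def)
qed

lemma finite_layer: "finite {a. intra F t a a}"
  by (rule finite_subset[OF _ finite_imageI[OF finite_intra[of F t], of fst]]) force

lemma adj_sym: "(\<And>t a b. intra F t a b \<Longrightarrow> intra F t b a) \<Longrightarrow> adj F x y \<Longrightarrow> adj F y x"
  unfolding adj_def by metis

lemma adj_layers: "adj F x y \<Longrightarrow> fst x \<le> Suc (fst y) \<and> fst y \<le> Suc (fst x)"
  by (auto simp: adj_def)

lemma intra_window: "intra (window n F t) s a b \<longleftrightarrow> s < n \<and> intra F (t + s) a b"
  by (simp add: intra_def window_def)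

lemma inter_window: "inter (window n F t) s a b \<longleftrightarrow> s < n \<and> inter F (t + s) a b"
  by (simp add: inter_def window_def)

text \<open>A short closed walk through an edge cannot leave the layers within \<open>g\<close> of
  it, so the window starting \<open>g\<close> layers below already contains it.\<close>

lemma girth_ge_window:
  "girth_ge g (adj F) \<longleftrightarrow> (\<forall>t. girth_ge g (adj (window (2 * g + 3) F t)))"
proof (intro iffI allI)
  fix t assume "girth_ge g (adj F)"
  then show "girth_ge g (adj (window (2 * g + 3) F t))"
  proof (rule girth_ge_hom[where E = "adj F" and f = "\<lambda>x. (t + fst x, snd x)"])
    show "inj_on (\<lambda>x. (t + fst x, snd x)) {x. \<exists>y. adj (window (2 * g + 3) F t) x y \<or>
        adj (window (2 * g + 3) F t) y x}"
      by (rule inj_onI) (simp add: prod_eq_iff)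
    show "adj F (t + fst x, snd x) (t + fst y, snd y)" if "adj (window (2 * g + 3) F t) x y" for x y
      using that unfolding adj_def intra_window inter_window by simp blast
  qed
next
  assume *: "\<forall>t. girth_ge g (adj (window (2 * g + 3) F t))"
  show "girth_ge g (adj F)"
    unfolding girth_ge_def
  proof (intro allI impI)
    fix u v assume uv: "adj F u v"
    \<comment> \<open>The subtraction is truncated: near layer 0 the window starts at 0 and still
      reaches \<open>g\<close> layers above \<open>u\<close>.\<close>
    define t where "t = fst u - g"
    let ?F = "window (2 * g + 3) F t"
    define f where "f x = (fst x - t, snd x)" for x :: "nat \<times> nat"
    define near where "near x \<longleftrightarrow> fst u \<le> fst x + g \<and> fst x \<le> fst u + g" for x :: "nat \<times> nat"
    have f: "adj ?F (f x) (f y)" if "adj F x y" "near x" "near y" for x y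
    proof -
      have off: "\<exists>s. fst z = t + s \<and> s \<le> 2 * g" if "near z" for z
        using that unfolding near_def t_def by presburger
      obtain r s where "fst x = t + r" "r \<le> 2 * g" "fst y = t + s" "s \<le> 2 * g"
        using off[OF \<open>near x\<close>] off[OF \<open>near y\<close>] by blast
      then show ?thesis
        using \<open>adj F x y\<close> by (simp add: adj_def f_def intra_window inter_window)
    qed
    have inj: "f x = f y \<Longrightarrow> x = y" if "near x" "near y" for x y
    proof -
      have "t \<le> fst x" "t \<le> fst y" using that by (simp_all add: near_def t_def le_diff_conv)
      then show "f x = f y \<Longrightarrow> x = y" by (simp add: f_def prod_eq_iff eq_diff_iff)
    qed
    show "\<exists>\<phi>. potential g (adj F) u v \<phi>"
      unfolding potential_walk_iff
    proof (intro allI impI notI)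
      fix n assume n: "Suc n < g" "(avoid (adj F) u v ^^ n) v u"
      have nuv: "near u" "near v" using adj_layers[OF uv] n by (auto simp: near_def)
      have "Suc i < g \<Longrightarrow> (avoid (adj F) u v ^^ i) v x \<Longrightarrow>
          fst u \<le> fst x + Suc i \<and> fst x \<le> fst u + Suc i \<and> (avoid (adj ?F) (f u) (f v) ^^ i) (f v) (f x)"
        for i x
      proof (induction i arbitrary: x)
        case 0
        then show ?case using adj_layers[OF uv] by auto
      next
        case (Suc i)
        then obtain y where y: "(avoid (adj F) u v ^^ i) v y" "avoid (adj F) u v y x" by auto
        with Suc have IH: "fst u \<le> fst y + Suc i" "fst y \<le> fst u + Suc i"
          "(avoid (adj ?F) (f u) (f v) ^^ i) (f v) (f y)" by auto
        have yx: "adj F y x" "{y, x} \<noteq> {u, v}" using y(2) by (auto simp: avoid_def)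
        have x: "fst u \<le> fst x + Suc (Suc i)" "fst x \<le> fst u + Suc (Suc i)"
          using IH adj_layers[OF yx(1)] by auto
        have nyx: "near y" "near x" using IH x Suc.prems by (auto simp: near_def)
        have "{f y, f x} \<noteq> {f u, f v}"
          using yx(2) inj nyx nuv by (metis doubleton_eq_iff)
        then have "avoid (adj ?F) (f u) (f v) (f y) (f x)"
          using f[OF yx(1) nyx] by (simp add: avoid_def)
        then show ?case using IH x by auto
      qed
      from this[OF n] have "(avoid (adj ?F) (f u) (f v) ^^ n) (f v) (f u)" by blast
      moreover have "\<exists>\<phi>. potential g (adj ?F) (f u) (f v) \<phi>"
        using * f[OF uv nuv] unfolding girth_ge_def by blast
      ultimately show False using n(1) unfolding potential_walk_iff by blast
    qed
  qed
qed

lemma admissible_window: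
  "n \<ge> 2 \<Longrightarrow> admissible k g (window n F t) 0 \<longleftrightarrow> admissible k g F t"
  unfolding admissible_def intra_window inter_window by simp

lemma valid_iff: "valid k g F \<longleftrightarrow> (\<forall>t. admissible k g F t) \<and> girth_ge g (adj F)"
  using girth_ge_window[of g F] by (simp add: valid_def admissible_window all_conj_distrib)

lemma admissibleD:
  assumes "admissible k g F t"
  shows "intra F t 0 0" "inter F t 0 0"
    "\<And>a b. intra F t a b \<Longrightarrow> intra F t b a" "\<And>a b. intra F t a b \<Longrightarrow> intra F t a a"
    "\<And>a b. intra F t a a \<Longrightarrow> b \<le> a \<Longrightarrow> intra F t b b"
    "\<And>a b. inter F t a b \<Longrightarrow> intra F t a a" "\<And>a b. inter F t a b \<Longrightarrow> intra F (Suc t) b b"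
    "\<And>a. intra F (Suc t) a a \<Longrightarrow> card {b. inter F t b a} +
        card {b. b \<noteq> a \<and> intra F (Suc t) a b} + card {b. inter F (Suc t) a b} = k"
    "even k \<Longrightarrow> even (card {(a, b). inter F t a b})"
  using assms unfolding admissible_def by (elim conjE; blast)+

text \<open>Downward closure of the labels lets the size of a layer bound its labels, and with them
  the bits of a letter.\<close>

lemma layer_eq:
  assumes "admissible k g F t"
  shows "intra F t a a \<longleftrightarrow> a < layer_size F t"
proof -
  let ?A = "{a. intra F t a a}"
  have "?A = {..<card ?A}"
  proof -
    have fin: "finite ?A" by (rule finite_layer)
    have "?A \<noteq> {}" using admissibleD(1)[OF assms] by blast
    have "?A = {..Max ?A}"
    proof (intro equalityI subsetI)
      fix a assume "a \<in> {..Max ?A}"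
      then show "a \<in> ?A" using admissibleD(5)[OF assms, of "Max ?A" a] Max_in[OF fin \<open>?A \<noteq> {}\<close>] by simp
    qed (use fin in auto)
    then show ?thesis by (metis card_atMost lessThan_Suc_atMost)
  qed
  then show ?thesis unfolding layer_size_def by blast
qed

subsection \<open>Splitting a periodic layered graph at two equal windows\<close>

text \<open>Every window of the repeated block is a window of \<open>F\<close>: past the end of the
  block, \<open>F\<close> goes on as it did at the start of the block.\<close>

lemma valid_split:
  assumes "valid k g F" "i < j" "\<And>s. s < 2 * g + 3 \<Longrightarrow> F (i + s) = F (j + s)"
  shows "valid k g (\<lambda>t. F (i + t mod (j - i)))"
proof -
  let ?p = "j - i" and ?W = "2 * g + 3"
  \<comment> \<open>An induction, because a window may be longer than the new period
    \<open>?p\<close>.\<close>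
  have per: "x < ?p + ?W \<Longrightarrow> F (i + x) = F (i + x mod ?p)" for x
  proof (induction x rule: less_induct)
    case (less x)
    show ?case
    proof (cases "x < ?p")
      case False
      then have "F (i + (x - ?p)) = F (j + (x - ?p))" using less.prems assms(3)[of "x - ?p"] by simp
      also have "j + (x - ?p) = i + x" using False assms(2) by simp
      finally have "F (i + x) = F (i + (x - ?p))" by simp
      also have "\<dots> = F (i + (x - ?p) mod ?p)"
        using False assms(2) less.prems by (intro less.IH) auto
      finally show ?thesis using False by (simp add: le_mod_geq)
    qed simp
  qed
  have "window ?W (\<lambda>t. F (i + t mod ?p)) t = window ?W F (i + t mod ?p)" for t
  proof
    fix s
    have "t mod ?p < ?p" using assms(2) by simp
    then have "s < ?W \<Longrightarrow> F (i + (t mod ?p + s)) = F (i + (t + s) mod ?p)"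
      using per[of "t mod ?p + s"] by (simp add: mod_add_left_eq)
    then show "window ?W (\<lambda>t. F (i + t mod ?p)) t s = window ?W F (i + t mod ?p) s"
      by (simp add: window_def add.assoc)
  qed
  then show ?thesis using assms(1) unfolding valid_def by simp
qed

lemma layer_size_cong: "F t = F' t' \<Longrightarrow> layer_size F t = layer_size F' t'"
  by (simp add: layer_size_def intra_def)

lemma cyclic_split:
  assumes "valid k g F" "i < j" "\<And>s. s < 2 * g + 3 \<Longrightarrow> F (i + s) = F (j + s)"
  shows "cyclic k g (j - i) (\<Sum>t=i..<j. layer_size F t)"
proof -
  let ?F = "\<lambda>t. F (i + t mod (j - i))"
  have "(\<Sum>t<j - i. layer_size ?F t) = (\<Sum>t<j - i. layer_size F (i + t))"
    by (intro sum.cong layer_size_cong) auto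
  also have "\<dots> = (\<Sum>t=i..<j. layer_size F t)"
    using assms(2) by (intro sum.reindex_bij_witness[of _ "\<lambda>t. t - i" "\<lambda>t. i + t"]) auto
  finally have "(\<Sum>t<j - i. layer_size ?F t) = (\<Sum>t=i..<j. layer_size F t)" .
  moreover have "?F (t + (j - i)) = ?F t" for t by (simp only: mod_add_self2)
  ultimately show ?thesis
    unfolding cyclic_def using valid_split[OF assms] assms(2) by (intro exI[of _ ?F]) simp
qed

lemma periodic_sum:
  fixes f :: "nat \<Rightarrow> nat"
  assumes "\<And>t. f (t + m) = f t"
  shows "(\<Sum>t=i..<i + m. f t) = (\<Sum>t<m. f t)"
proof (induction i)
  case 0
  then show ?case by (simp add: atLeast0LessThan)
next
  case (Suc i)
  have "(\<Sum>t=Suc i..<Suc i + m. f t) + f i = (\<Sum>t=i..<Suc (i + m). f t)"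
    by (simp add: sum.atLeast_Suc_lessThan[of i])
  also have "\<dots> = (\<Sum>t=i..<i + m. f t) + f (i + m)" by simp
  finally show ?case using assms[of i] Suc by simp
qed

section \<open>Bounding the period\<close>

text \<open>For \<open>a, b < S\<close> the number \<open>2 * prod_encode (a, b) + 1\<close> is
  below \<open>2 * (4 * S * S + S) + 2\<close>. So this many bits hold a letter if its layer and the
  next one have at most \<open>S\<close> vertices.\<close>

definition code_length :: "nat \<Rightarrow> nat" where
  "code_length S = 8 * S * S + 2 * S + 2"

lemma prod_encode_le: "prod_encode (a, b) \<le> (a + b) * (a + b) + a"
proof -
  have "triangle n \<le> n * n" for n
    by (induction n) (auto simp: triangle_Suc)
  then show ?thesis by (simp add: prod_encode_def)
qed

lemma prod_encode_bound:
  assumes "a < S" "b < S"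
  shows "2 * prod_encode (a, b) + 1 < code_length S"
proof -
  have "(a + b) * (a + b) \<le> (2 * S) * (2 * S)" using assms by (intro mult_mono) auto
  then show ?thesis using prod_encode_le[of a b] assms by (simp add: code_length_def)
qed

lemma letter_bound:
  assumes "admissible k g F t" "admissible k g F (Suc t)" "layer_size F t \<le> S" "layer_size F (Suc t) \<le> S"
  shows "F t < 2 ^ code_length S"
proof -
  have "i < code_length S" if i: "bit (F t) i" for i
  proof -
    obtain a b where ab: "prod_decode (i div 2) = (a, b)" by (cases "prod_decode (i div 2)")
    then have enc: "prod_encode (a, b) = i div 2" by (metis prod_decode_inverse)
    show ?thesis
    proof (cases "even i")
      case True
      then have "intra F t a b" using i enc by (simp add: intra_def)
      then have "a < S" "b < S"
        using admissibleD(3,4)[OF assms(1)] layer_eq[OF assms(1)] assms(3) less_le_trans by blast+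
      then show ?thesis using prod_encode_bound[of a S b] enc True by simp
    next
      case False
      then have "inter F t a b" using i enc by (simp add: inter_def)
      then have "a < S" "b < S"
        using admissibleD(6,7)[OF assms(1)] layer_eq[OF assms(1)] layer_eq[OF assms(2)]
          assms(3,4) less_le_trans by blast+
      then show ?thesis using prod_encode_bound[of a S b] enc False by simp
    qed
  qed
  then have "take_bit (code_length S) (F t) = F t"
    by (intro bit_eqI) (auto simp: bit_take_bit_iff)
  then show ?thesis by (simp add: take_bit_nat_eq_self_iff)
qed

text \<open>Bounds the number of windows with at most twice the average number of vertices, as long as the
  average layer size is at most \<open>p\<close>.\<close>

definition num_windows :: "nat \<Rightarrow> nat \<Rightarrow> nat" where
  "num_windows g p = (2 ^ code_length (2 * (2 * g + 4) * p)) ^ (2 * g + 3)"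

text \<open>Transitivity of \<open>a / b \<le> c / d \<le> e / f\<close>, multiplied out.\<close>

lemma ratio_trans:
  fixes a b c d e f :: nat
  assumes "a * d \<le> c * b" "c * f \<le> e * d" "d > 0"
  shows "a * f \<le> e * b"
proof -
  have "a * d * f \<le> c * b * f" by (rule mult_le_mono1[OF assms(1)])
  also have "c * b * f = c * f * b" by (simp only: ac_simps)
  also have "\<dots> \<le> e * d * b" by (rule mult_le_mono1[OF assms(2)])
  finally have "d * (a * f) \<le> d * (e * b)" by (simp only: ac_simps)
  then show ?thesis using assms(3) by simp
qed

text \<open>Induction on the period. If two light windows coincide, the cheaper part of the split
  has at most the ratio of the whole. Otherwise light windows are few, and the heavy ones force
  \<open>w \<ge> p * m\<close> unless \<open>m\<close> and \<open>w\<close> are both small.\<close>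

lemma cyclic_reduce:
  assumes qp: "q > 0"
  shows "cyclic k g m w \<Longrightarrow> p * m \<le> w * q \<or>
    (\<exists>m' w'. cyclic k g m' w' \<and> m' < 2 * num_windows g p \<and> w' < 2 * num_windows g p * p \<and>
      w' * m \<le> w * m')"
proof (induction m arbitrary: w rule: less_induct)
  case (less m)
  let ?W = "2 * g + 3" and ?Q = "num_windows g p" and ?S = "2 * (2 * g + 4) * p"
  from less.prems obtain F where m: "m > 0" and per: "\<And>t. F (t + m) = F t" and val: "valid k g F"
    and w: "(\<Sum>t<m. layer_size F t) = w" by (auto simp: cyclic_def)
  have adm: "admissible k g F t" for t using val by (simp add: valid_iff)
  \<comment> \<open>\<open>Suc ?W\<close> layers, as the last letter of a window involves the layer
    after it. A window is light if it has at most \<open>2 * p\<close> vertices per layer on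
    average.\<close>
  define ws where "ws t = (\<Sum>s<Suc ?W. layer_size F (t + s))" for t
  define G where "G = {t. t < m \<and> ws t \<le> ?S}"
  define win where "win t = map (\<lambda>s. F (t + s)) [0..<?W]" for t
  show ?case
  proof (cases "inj_on win G")
    case False
    then obtain i j where ij: "i \<in> G" "j \<in> G" "i < j" "win i = win j"
      unfolding inj_on_def by (metis nat_neq_iff)
    have eq: "F (i + s) = F (j + s)" if "s < ?W" for s
      using that ij(4) unfolding win_def by (simp add: map_eq_conv)
    have lt: "j < i + m" using ij by (simp add: G_def)
    have eq2: "F (j + s) = F (i + m + s)" if "s < ?W" for s
      using eq[OF that] per[of "i + s"] by (simp add: add.commute add.left_commute)
    define m1 m2 w1 w2 where "m1 = j - i" "m2 = i + m - j"
      "w1 = (\<Sum>t=i..<j. layer_size F t)" "w2 = (\<Sum>t=j..<i + m. layer_size F t)"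
    note defs = this
    have c1: "cyclic k g m1 w1" unfolding defs by (rule cyclic_split[OF val ij(3) eq])
    have c2: "cyclic k g m2 w2" unfolding defs by (rule cyclic_split[OF val lt eq2])
    have mm: "m1 + m2 = m" "m1 > 0" "m2 > 0" "m1 < m" "m2 < m"
      using ij lt by (auto simp: defs G_def)
    have "w1 + w2 = (\<Sum>t=i..<i + m. layer_size F t)"
      unfolding defs using ij lt by (intro sum.atLeastLessThan_concat) auto
    also have "\<dots> = w"
      unfolding w[symmetric] by (rule periodic_sum) (rule layer_size_cong, rule per)
    finally have ww: "w1 + w2 = w" .
    \<comment> \<open>The ratio of the whole is the mediant of the two ratios, so one of them is not
      larger.\<close>
    obtain m' w' where c: "cyclic k g m' w'" "m' < m" "m' > 0" "w' * m \<le> w * m'"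
    proof (cases "w1 * m2 \<le> w2 * m1")
      case True
      then have "w1 * m \<le> w * m1" by (simp add: mm(1)[symmetric] ww[symmetric] algebra_simps)
      then show thesis using that[OF c1] mm by blast
    next
      case False
      then have "w2 * m \<le> w * m2" by (simp add: mm(1)[symmetric] ww[symmetric] algebra_simps)
      then show thesis using that[OF c2] mm by blast
    qed
    from less.IH[OF c(2,1)] show ?thesis
    proof (elim disjE exE conjE)
      assume "p * m' \<le> w' * q"
      then show ?thesis using ratio_trans[of p m' w' q m w] c(3,4) by (simp add: mult.commute)
    next
      fix m'' w'' assume "cyclic k g m'' w''" "m'' < 2 * ?Q" "w'' < 2 * ?Q * p" "w'' * m' \<le> w' * m''"
      then show ?thesis using ratio_trans[of w'' m' w' m'' m w] c(3,4) by blast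
    qed
  next
    case True
    have "win ` G \<subseteq> {xs. set xs \<subseteq> {..<2 ^ code_length ?S} \<and> length xs = ?W}"
    proof (safe)
      fix t x assume t: "t \<in> G" "x \<in> set (win t)"
      then obtain s where s: "s < ?W" "x = F (t + s)" by (auto simp: win_def)
      have "layer_size F (t + r) \<le> ?S" if "r < Suc ?W" for r
      proof -
        have "layer_size F (t + r) \<le> ws t"
          unfolding ws_def using that by (intro member_le_sum) auto
        then show ?thesis using t(1) by (simp add: G_def)
      qed
      from this[of s] this[of "Suc s"] show "x < 2 ^ code_length ?S"
        using letter_bound[OF adm adm, of "t + s" ?S] s by simp
    qed (simp add: win_def)
    then have "card (win ` G) \<le> card {xs. set xs \<subseteq> {..<(2 :: nat) ^ code_length ?S} \<and> length xs = ?W}"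
      by (intro card_mono finite_lists_length_eq) auto
    then have cG: "card G \<le> ?Q"
      using True by (simp add: card_image card_lists_length_eq num_windows_def)
    have "(\<Sum>t<m. ws t) = (\<Sum>s<Suc ?W. \<Sum>t<m. layer_size F (t + s))"
      unfolding ws_def by (rule sum.swap)
    also have "\<dots> = (\<Sum>s<Suc ?W. w)"
    proof (rule sum.cong[OF refl])
      fix s
      have "(\<Sum>t<m. layer_size F (t + s)) = (\<Sum>t=s..<s + m. layer_size F t)"
        by (intro sum.reindex_bij_witness[of _ "\<lambda>t. t - s" "\<lambda>t. t + s"]) auto
      also have "\<dots> = w"
        unfolding w[symmetric] by (rule periodic_sum) (rule layer_size_cong, rule per)
      finally show "(\<Sum>t<m. layer_size F (t + s)) = w" .
    qed
    finally have tot: "(\<Sum>t<m. ws t) = Suc ?W * w" by simp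
    have "card ({..<m} - G) = m - card G"
      by (subst card_Diff_subset) (auto simp: G_def)
    \<comment> \<open>Each vertex is counted in \<open>Suc ?W\<close> windows, and at least
      \<open>m - ?Q\<close> windows are heavy.\<close>
    then have "(m - ?Q) * ?S \<le> card ({..<m} - G) * ?S" using cG by (intro mult_le_mono1) simp
    also have "\<dots> = (\<Sum>t\<in>{..<m} - G. ?S)" by simp
    also have "\<dots> \<le> (\<Sum>t\<in>{..<m} - G. ws t)" by (intro sum_mono) (auto simp: G_def)
    also have "\<dots> \<le> (\<Sum>t<m. ws t)" by (intro sum_mono2) auto
    finally have "(m - ?Q) * (2 * p) * Suc ?W \<le> w * Suc ?W"
      unfolding tot by (simp add: algebra_simps)
    then have main: "(m - ?Q) * (2 * p) \<le> w" by (simp only: mult_le_cancel2)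
    \<comment> \<open>For \<open>m \<ge> 2 * ?Q\<close> at least half of the windows are heavy,
      whence \<open>p * m \<le> w\<close>; for smaller \<open>m\<close> a large \<open>w\<close> has
      the same effect. As \<open>q \<ge> 1\<close>, the first alternative follows.\<close>
    show ?thesis
    proof (cases "m < 2 * ?Q")
      case True
      show ?thesis
      proof (cases "w < 2 * ?Q * p")
        case False
        then have "p * m \<le> w" using True
          by (metis (no_types, lifting) le_trans less_imp_le_nat mult.commute mult_le_mono1 not_less)
        then have "p * m \<le> w * q" using qp by (metis le_trans le_add1 mult_le_mono2 mult.right_neutral Suc_leI One_nat_def)
        then show ?thesis ..
      qed (use True less.prems in blast)
    next
      case False
      then have "m * p \<le> (m - ?Q) * 2 * p" by (intro mult_le_mono1) simp
      then have "p * m \<le> w" using main by (simp add: algebra_simps)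
      then have "p * m \<le> w * q" using qp by (metis le_trans mult_le_mono2 mult.right_neutral Suc_leI One_nat_def)
      then show ?thesis ..
    qed
  qed
qed

section \<open>Deciding the existence of periodic layered graphs\<close>

definition digit :: "nat \<Rightarrow> nat \<Rightarrow> nat \<Rightarrow> nat" where
  "digit B y i = y div B ^ i mod B"

lemma digits_exist:
  assumes "\<And>i. i < n \<Longrightarrow> f i < B"
  shows "\<exists>y<B ^ n. \<forall>i<n. digit B y i = f i"
  using assms
proof (induction n)
  case (Suc n)
  then obtain y where y: "y < B ^ n" "\<And>i. i < n \<Longrightarrow> digit B y i = f i" by (metis less_Suc_eq)
  have fn: "f n < B" "B > 0" using Suc.prems[of n] by auto
  let ?y = "y + f n * B ^ n"
  have "?y < B ^ n + f n * B ^ n" using y(1) by simp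
  also have "\<dots> = Suc (f n) * B ^ n" by simp
  also have "\<dots> \<le> B * B ^ n" using fn by (intro mult_le_mono1) simp
  finally have "?y < B ^ Suc n" by simp
  moreover have "digit B ?y i = f i" if i: "i < Suc n" for i
  proof (cases "i = n")
    case True
    then show ?thesis using y(1) fn by (simp add: digit_def)
  next
    case False
    then have "i < n" using i by simp
    then obtain d where d: "n = i + Suc d" using less_iff_Suc_add by (metis add_Suc_right)
    have "?y = y + B ^ i * (f n * B ^ Suc d)" unfolding d by (simp add: power_add)
    then have "?y div B ^ i = f n * B ^ Suc d + y div B ^ i"
      using fn by (metis div_mult_self2 power_not_zero not_gr_zero)
    also have "\<dots> = y div B ^ i + B * (f n * B ^ d)" by simp
    also have "\<dots> mod B = y div B ^ i mod B" by (rule mod_mult_self2)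
    finally show ?thesis using y(2)[OF \<open>i < n\<close>] by (simp add: digit_def)
  qed
  ultimately show ?case by blast
qed simp

text \<open>A whole period packed into one number: the letters are its digits to the base
  \<open>2 ^ Z\<close>. By \<open>bits_below\<close>, \<open>Z\<close> bounds the labels as
  well.\<close>

definition coded :: "nat \<Rightarrow> nat \<Rightarrow> nat \<Rightarrow> nat \<Rightarrow> nat" where
  "coded X Z m t = digit (2 ^ Z) X (t mod m)"

definition check_local :: "nat \<Rightarrow> nat \<Rightarrow> (nat \<Rightarrow> nat) \<Rightarrow> nat \<Rightarrow> bool" where
  "check_local k Z F t \<longleftrightarrow> intra F t 0 0 \<and> inter F t 0 0 \<and>
     (\<forall>a<Z. \<forall>b<Z. intra F t a b \<longrightarrow> intra F t b a \<and> intra F t a a) \<and>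
     (\<forall>a<Z. \<forall>b<Suc a. intra F t a a \<longrightarrow> intra F t b b) \<and>
     (\<forall>a<Z. \<forall>b<Z. inter F t a b \<longrightarrow> intra F t a a \<and> intra F (Suc t) b b) \<and>
     (\<forall>a<Z. intra F (Suc t) a a \<longrightarrow> (\<Sum>b<Z. of_bool (inter F t b a)) +
        (\<Sum>b<Z. of_bool (b \<noteq> a \<and> intra F (Suc t) a b)) + (\<Sum>b<Z. of_bool (inter F (Suc t) a b)) = k) \<and>
     (even k \<longrightarrow> even (\<Sum>a<Z. \<Sum>b<Z. of_bool (inter F t a b) :: nat))"

definition adj_code :: "nat \<Rightarrow> nat \<Rightarrow> (nat \<Rightarrow> nat) \<Rightarrow> nat \<Rightarrow> nat \<Rightarrow> nat \<Rightarrow> bool" where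
  "adj_code n Z F t x y \<longleftrightarrow> adj (window n F t) (x div Z, x mod Z) (y div Z, y mod Z)"

text \<open>A walk is one number \<open>p\<close> whose base-\<open>N\<close> digits are its
  vertices, so the existence of a walk becomes a bounded quantifier. The bound
  \<open>n < g - 1\<close> is the condition \<open>Suc n < g\<close> of
  \<open>potential_walk_iff\<close>.\<close>

definition check_girth :: "nat \<Rightarrow> nat \<Rightarrow> nat \<Rightarrow> (nat \<Rightarrow> nat) \<Rightarrow> nat \<Rightarrow> bool" where
  "check_girth g N Z F t \<longleftrightarrow> (\<forall>x<N. \<forall>y<N. adj_code (2 * g + 3) Z F t x y \<longrightarrow>
     (\<forall>n<g - 1. \<not> (\<exists>p<N ^ Suc n. digit N p 0 = y \<and> digit N p n = x \<and>
        (\<forall>i<n. adj_code (2 * g + 3) Z F t (digit N p i) (digit N p (Suc i)) \<and>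
          \<not> (digit N p i = x \<and> digit N p (Suc i) = y \<or> digit N p i = y \<and> digit N p (Suc i) = x)))))"

text \<open>A number below \<open>2 ^ Z\<close> has its bits at positions below \<open>Z\<close>,
  and \<open>prod_encode\<close> dominates both components.\<close>

lemma bits_below:
  assumes "F t < 2 ^ Z"
  shows "intra F t a b \<Longrightarrow> a < Z \<and> b < Z" "inter F t a b \<Longrightarrow> a < Z \<and> b < Z"
proof -
  have "i < Z" if "bit (F t) i" for i
    using that assms by (metis bit_take_bit_iff take_bit_nat_eq_self_iff)
  moreover have "a \<le> prod_encode (a, b)" "b \<le> prod_encode (a, b)"
    by (rule le_prod_encode_1 le_prod_encode_2)+
  ultimately show "intra F t a b \<Longrightarrow> a < Z \<and> b < Z" "inter F t a b \<Longrightarrow> a < Z \<and> b < Z"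
    unfolding intra_def inter_def by fastforce+
qed

lemma sum_of_bool_card:
  fixes Z :: nat
  assumes "\<And>b. P b \<Longrightarrow> b < Z"
  shows "(\<Sum>b<Z. of_bool (P b) :: nat) = card {b. P b}"
proof -
  have "{..<Z} \<inter> {b. P b} = {b. P b}" using assms by auto
  then show ?thesis by (subst sum_of_bool_eq) simp_all
qed

lemma check_local_iff:
  assumes "\<And>t. F t < 2 ^ Z"
  shows "check_local k Z F t \<longleftrightarrow> admissible k g F t"
proof -
  note bb = bits_below[where F = F and Z = Z, OF assms]
  have "(\<Sum>a<Z. \<Sum>b<Z. of_bool (inter F t a b) :: nat) = card {(a, b). inter F t a b}"
  proof -
    have "(\<Sum>b<Z. of_bool (inter F t a b) :: nat) = card {b. inter F t a b}" for a
      by (rule sum_of_bool_card) (simp add: bb(2))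
    moreover have "{(a, b). inter F t a b} = (SIGMA a:{..<Z}. {b. inter F t a b})"
      by (auto dest: bb(2))
    moreover have "finite {b. inter F t a b}" for a
      by (rule finite_subset[of _ "{..<Z}"]) (auto dest: bb(2))
    ultimately show ?thesis by simp
  qed
  moreover have "(\<Sum>b<Z. of_bool (inter F t b a)) = card {b. inter F t b a}"
    "(\<Sum>b<Z. of_bool (b \<noteq> a \<and> intra F (Suc t) a b)) = card {b. b \<noteq> a \<and> intra F (Suc t) a b}"
    "(\<Sum>b<Z. of_bool (inter F (Suc t) a b)) = card {b. inter F (Suc t) a b}" for a
    by (rule sum_of_bool_card, use bb in blast)+
  moreover have
    "(\<forall>a<Z. \<forall>b<Z. intra F t a b \<longrightarrow> intra F t b a \<and> intra F t a a) \<longleftrightarrow>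
      (\<forall>a b. intra F t a b \<longrightarrow> intra F t b a \<and> intra F t a a)"
    "(\<forall>a<Z. \<forall>b<Suc a. intra F t a a \<longrightarrow> intra F t b b) \<longleftrightarrow>
      (\<forall>a b. intra F t a a \<longrightarrow> b \<le> a \<longrightarrow> intra F t b b)"
    "(\<forall>a<Z. \<forall>b<Z. inter F t a b \<longrightarrow> intra F t a a \<and> intra F (Suc t) b b) \<longleftrightarrow>
      (\<forall>a b. inter F t a b \<longrightarrow> intra F t a a \<and> intra F (Suc t) b b)"
    using bb by (meson less_Suc_eq_le)+
  moreover have "(\<forall>a<Z. intra F (Suc t) a a \<longrightarrow> Q a) \<longleftrightarrow> (\<forall>a. intra F (Suc t) a a \<longrightarrow> Q a)" for Q
    using bb by blast
  ultimately show ?thesis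
    unfolding check_local_def admissible_def by (simp only:)
qed

lemma check_girth_iff:
  assumes F: "\<And>t. F t < 2 ^ Z" and N: "N = (2 * g + 4) * Z" and Z: "Z > 0"
  shows "check_girth g N Z F t \<longleftrightarrow> girth_ge g (adj (window (2 * g + 3) F t))"
proof -
  let ?E = "adj (window (2 * g + 3) F t)"
  define dec where "dec x = (x div Z, x mod Z)" for x
  define enc where "enc x = fst x * Z + snd x" for x :: "nat \<times> nat"
  have code: "adj_code (2 * g + 3) Z F t x y \<longleftrightarrow> ?E (dec x) (dec y)" for x y
    by (simp add: adj_code_def dec_def)
  have enc_dec: "enc (dec x) = x" for x by (simp add: enc_def dec_def)
  have dec_inj: "dec x = dec y \<longleftrightarrow> x = y" for x y by (metis enc_dec)
  have win: "window (2 * g + 3) F t s < 2 ^ Z" for s using F by (simp add: window_def)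
  \<comment> \<open>One layer more than the window has letters, since its last letter has edges
    upwards; this is the origin of \<open>2 * g + 4\<close>.\<close>
  have E: "snd x < Z \<and> snd y < Z \<and> fst x < 2 * g + 4 \<and> fst y < 2 * g + 4" if "?E x y" for x y
    using that bits_below[where F = "window (2 * g + 3) F t" and Z = Z, OF win]
    unfolding adj_def by (auto simp: intra_window inter_window)
  have dec_enc: "dec (enc x) = x" "enc x < N" if "snd x < Z" "fst x < 2 * g + 4" for x
  proof -
    show "dec (enc x) = x" using that Z by (simp add: dec_def enc_def)
    have "enc x < Suc (fst x) * Z" using that by (simp add: enc_def)
    also have "\<dots> \<le> N" unfolding N using that by (intro mult_le_mono1) simp
    finally show "enc x < N" .
  qed
  have walk: "(avoid ?E (dec x) (dec y) ^^ n) (dec y) (dec x) \<longleftrightarrow>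
      (\<exists>p<N ^ Suc n. digit N p 0 = y \<and> digit N p n = x \<and>
        (\<forall>i<n. adj_code (2 * g + 3) Z F t (digit N p i) (digit N p (Suc i)) \<and>
          \<not> (digit N p i = x \<and> digit N p (Suc i) = y \<or> digit N p i = y \<and> digit N p (Suc i) = x)))"
    if xy: "x < N" "y < N" for x y n
  proof
    assume "(avoid ?E (dec x) (dec y) ^^ n) (dec y) (dec x)"
    then obtain f where f: "f 0 = dec y" "f n = dec x"
      "\<And>i. i < n \<Longrightarrow> avoid ?E (dec x) (dec y) (f i) (f (Suc i))"
      unfolding relpowp_fun_conv by blast
    \<comment> \<open>The end of the walk has no outgoing step, so its bounds come from
      \<open>x < N\<close>.\<close>
    have fi: "snd (f i) < Z \<and> fst (f i) < 2 * g + 4" if "i < Suc n" for i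
    proof (cases "i = n")
      case True
      have "fst (dec x) < 2 * g + 4" using xy(1) Z
        unfolding N dec_def by (simp add: less_mult_imp_div_less)
      then show ?thesis using True f(2) Z by (simp add: dec_def)
    next
      case False
      then show ?thesis using f(3)[of i] E[of "f i" "f (Suc i)"] that by (simp add: avoid_def)
    qed
    then have "\<And>i. i < Suc n \<Longrightarrow> enc (f i) < N" using dec_enc by blast
    then obtain p where p: "p < N ^ Suc n" "\<And>i. i < Suc n \<Longrightarrow> digit N p i = enc (f i)"
      using digits_exist[of "Suc n" "\<lambda>i. enc (f i)" N] by blast
    have dp: "dec (digit N p i) = f i" if "i < Suc n" for i
      using p(2)[OF that] dec_enc(1) fi[OF that] by simp
    show "\<exists>p<N ^ Suc n. digit N p 0 = y \<and> digit N p n = x \<and>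
        (\<forall>i<n. adj_code (2 * g + 3) Z F t (digit N p i) (digit N p (Suc i)) \<and>
          \<not> (digit N p i = x \<and> digit N p (Suc i) = y \<or> digit N p i = y \<and> digit N p (Suc i) = x))"
    proof (intro exI[of _ p] conjI allI impI)
      show "p < N ^ Suc n" by fact
      show "digit N p 0 = y" "digit N p n = x"
        using p(2)[of 0] p(2)[of n] f(1,2) enc_dec by auto
      fix i assume i: "i < n"
      then have a: "avoid ?E (dec x) (dec y) (dec (digit N p i)) (dec (digit N p (Suc i)))"
        using f(3)[OF i] dp[of i] dp[of "Suc i"] by simp
      then show "adj_code (2 * g + 3) Z F t (digit N p i) (digit N p (Suc i))"
        unfolding code avoid_def by blast
      show "\<not> (digit N p i = x \<and> digit N p (Suc i) = y \<or> digit N p i = y \<and> digit N p (Suc i) = x)"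
        using a by (auto simp: avoid_def)
    qed
  next
    assume "\<exists>p<N ^ Suc n. digit N p 0 = y \<and> digit N p n = x \<and>
        (\<forall>i<n. adj_code (2 * g + 3) Z F t (digit N p i) (digit N p (Suc i)) \<and>
          \<not> (digit N p i = x \<and> digit N p (Suc i) = y \<or> digit N p i = y \<and> digit N p (Suc i) = x))"
    then obtain p where p: "digit N p 0 = y" "digit N p n = x"
      "\<And>i. i < n \<Longrightarrow> adj_code (2 * g + 3) Z F t (digit N p i) (digit N p (Suc i))"
      "\<And>i. i < n \<Longrightarrow> \<not> (digit N p i = x \<and> digit N p (Suc i) = y \<or> digit N p i = y \<and> digit N p (Suc i) = x)"
      by blast
    show "(avoid ?E (dec x) (dec y) ^^ n) (dec y) (dec x)"
      unfolding relpowp_fun_conv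
    proof (intro exI[of _ "\<lambda>i. dec (digit N p i)"] conjI allI impI)
      fix i assume i: "i < n"
      show "avoid ?E (dec x) (dec y) (dec (digit N p i)) (dec (digit N p (Suc i)))"
        using p(3,4)[OF i] unfolding code avoid_def doubleton_eq_iff dec_inj by blast
    qed (use p in auto)
  qed
  show ?thesis
  proof
    assume L: "check_girth g N Z F t"
    show "girth_ge g ?E"
      unfolding girth_ge_def potential_walk_iff
    proof (intro allI impI)
      fix u v n assume uv: "?E u v" and n: "Suc n < g"
      have d: "dec (enc u) = u" "dec (enc v) = v" "enc u < N" "enc v < N"
        using E[OF uv] dec_enc by blast+
      have "n < g - 1" using n by simp
      then show "\<not> (avoid ?E u v ^^ n) v u"
        using L d(3,4) walk[OF d(3,4), of n] code[of "enc u" "enc v"] uv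
        unfolding check_girth_def d(1,2) by blast
    qed
  next
    assume R: "girth_ge g ?E"
    show "check_girth g N Z F t"
      unfolding check_girth_def
    proof (intro allI impI)
      fix x y n assume xy: "x < N" "y < N" "adj_code (2 * g + 3) Z F t x y" and n: "n < g - 1"
      then have "\<not> (avoid ?E (dec x) (dec y) ^^ n) (dec y) (dec x)"
        using R unfolding girth_ge_def potential_walk_iff code by (metis less_diff_conv Suc_eq_plus1)
      then show "\<not> (\<exists>p<N ^ Suc n. digit N p 0 = y \<and> digit N p n = x \<and>
        (\<forall>i<n. adj_code (2 * g + 3) Z F t (digit N p i) (digit N p (Suc i)) \<and>
          \<not> (digit N p i = x \<and> digit N p (Suc i) = y \<or> digit N p i = y \<and> digit N p (Suc i) = x)))"
        unfolding walk[OF xy(1,2)] .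
    qed
  qed
qed

definition check :: "nat \<Rightarrow> nat \<Rightarrow> nat \<Rightarrow> nat \<Rightarrow> nat \<Rightarrow> nat \<Rightarrow> bool" where
  "check k g m w Z X \<longleftrightarrow> (\<forall>t<m. check_local k Z (coded X Z m) t \<and>
       check_girth g ((2 * g + 4) * Z) Z (coded X Z m) t) \<and>
     (\<Sum>t<m. \<Sum>a<Z. of_bool (intra (coded X Z m) t a a)) = w"

lemma coded_less: "coded X Z m t < 2 ^ Z"
  by (simp add: coded_def digit_def)

lemma code_length_pos: "code_length w > 0"
  by (simp add: code_length_def)

lemma check_iff:
  assumes "m > 0"
  shows "check k g m w (code_length w) X \<longleftrightarrow> valid k g (coded X (code_length w) m) \<and>
    (\<Sum>t<m. layer_size (coded X (code_length w) m) t) = w"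
proof -
  let ?Z = "code_length w"
  let ?F = "coded X ?Z m"
  have "(\<Sum>a<?Z. of_bool (intra ?F t a a)) = layer_size ?F t" for t
    unfolding layer_size_def by (rule sum_of_bool_card) (use bits_below[where F = ?F and Z = ?Z, OF coded_less] in blast)
  moreover have "valid k g ?F \<longleftrightarrow> (\<forall>t<m. admissible k g ?F t \<and> girth_ge g (adj (window (2 * g + 3) ?F t)))"
  proof -
    have win: "window n ?F (t mod m) = window n ?F t" for n t
      by (simp add: window_def coded_def fun_eq_iff mod_add_left_eq)
    have "valid k g ?F \<longleftrightarrow> (\<forall>t<m. admissible k g (window (2 * g + 3) ?F t) 0 \<and>
        girth_ge g (adj (window (2 * g + 3) ?F t)))"
      unfolding valid_def using assms win by (metis mod_less_divisor)
    then show ?thesis by (simp add: admissible_window)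
  qed
  ultimately show ?thesis
    unfolding check_def
    using check_local_iff[of ?F ?Z k _ g, OF coded_less]
      check_girth_iff[of ?F ?Z "(2 * g + 4) * ?Z" g, OF coded_less refl code_length_pos]
    by simp
qed

text \<open>No layer exceeds the \<open>w\<close> vertices of a whole period, so letters of
  \<open>code_length w\<close> bits suffice.\<close>

lemma cyclic_iff:
  "cyclic k g m w \<longleftrightarrow> m > 0 \<and>
    (\<exists>X<(2 ^ code_length w) ^ m. check k g m w (code_length w) X)"
proof
  assume "cyclic k g m w"
  then obtain F where F: "m > 0" "\<And>t. F (t + m) = F t" "valid k g F" "(\<Sum>t<m. layer_size F t) = w"
    by (auto simp: cyclic_def)
  have Fmod: "F (t mod m) = F t" for t
  proof -
    have "F (t + i * m) = F t" for t i
    proof (induction i)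
      case (Suc i)
      have "F (t + Suc i * m) = F ((t + i * m) + m)" by (simp add: ac_simps)
      then show ?case using F(2) Suc by simp
    qed simp
    from this[of "t mod m" "t div m"] show ?thesis by simp
  qed
  have "layer_size F t \<le> w" for t
  proof -
    have "layer_size F t = layer_size F (t mod m)" by (rule layer_size_cong) (simp add: Fmod)
    also have "\<dots> \<le> w" unfolding F(4)[symmetric] using F(1) by (intro member_le_sum) auto
    finally show ?thesis .
  qed
  then have "F t < 2 ^ code_length w" for t
    using F(3) by (intro letter_bound) (auto simp: valid_iff)
  then obtain X where X: "X < (2 ^ code_length w) ^ m" "\<And>t. t < m \<Longrightarrow> digit (2 ^ code_length w) X t = F t"
    using digits_exist[of m F "2 ^ code_length w"] by blast
  then have "coded X (code_length w) m = F"
    using F(1) by (simp add: coded_def fun_eq_iff Fmod)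
  then show "m > 0 \<and> (\<exists>X<(2 ^ code_length w) ^ m. check k g m w (code_length w) X)"
    using X(1) F check_iff[OF F(1)] by auto
next
  assume "m > 0 \<and> (\<exists>X<(2 ^ code_length w) ^ m. check k g m w (code_length w) X)"
  then obtain X where "m > 0" "check k g m w (code_length w) X" by blast
  then show "cyclic k g m w"
    unfolding cyclic_def check_iff[OF \<open>m > 0\<close>]
    by (intro exI[of _ "coded X (code_length w) m"]) (simp add: coded_def)
qed

section \<open>Computability of the checks\<close>

lemma dec_let:
  assumes "computable m G" "\<And>c. dep m (P c)" "\<And>x. x \<ge> m \<Longrightarrow> decidable (Suc x) (\<lambda>s. P (s x) s)"
  shows "decidable m (\<lambda>s. P (G s) s)"
  using assms comp_let[OF assms(1), of "\<lambda>c s. of_bool (P c s)"] dep_comp1[of m _ of_bool]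
  unfolding decidable_def by blast

lemma dec_bit: "computable m A \<Longrightarrow> computable m I \<Longrightarrow> decidable m (\<lambda>s. bit (A s) (I s))"
  unfolding bit_iff_odd by (intro dec_not dec_even comp_div comp_power comp_const)

lemma comp_prod_encode:
  "computable m A \<Longrightarrow> computable m B \<Longrightarrow> computable m (\<lambda>s. prod_encode (A s, B s))"
  unfolding prod_encode_def triangle_def prod.case
  by (intro comp_add comp_div comp_mult comp_Suc comp_const)

lemma comp_digit:
  "computable m B \<Longrightarrow> computable m Y \<Longrightarrow> computable m I \<Longrightarrow> computable m (\<lambda>s. digit (B s) (Y s) (I s))"
  unfolding digit_def by (intro comp_mod comp_div comp_power)

lemma comp_coded:
  "computable m X \<Longrightarrow> computable m Z \<Longrightarrow> computable m M \<Longrightarrow> computable m T \<Longrightarrow>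
    computable m (\<lambda>s. coded (X s) (Z s) (M s) (T s))"
  unfolding coded_def by (intro comp_digit comp_mod comp_power comp_const)

lemma dec_intra:
  "computable m X \<Longrightarrow> computable m Z \<Longrightarrow> computable m M \<Longrightarrow> computable m T \<Longrightarrow>
    computable m A \<Longrightarrow> computable m B \<Longrightarrow>
    decidable m (\<lambda>s. intra (coded (X s) (Z s) (M s)) (T s) (A s) (B s))"
  unfolding intra_def by (intro dec_bit comp_coded comp_mult comp_const comp_prod_encode)

lemma dec_inter:
  "computable m X \<Longrightarrow> computable m Z \<Longrightarrow> computable m M \<Longrightarrow> computable m T \<Longrightarrow>
    computable m A \<Longrightarrow> computable m B \<Longrightarrow>
    decidable m (\<lambda>s. inter (coded (X s) (Z s) (M s)) (T s) (A s) (B s))"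
  unfolding inter_def by (intro dec_bit comp_coded comp_add comp_mult comp_const comp_prod_encode)

lemma dec_adj_code:
  "computable m X \<Longrightarrow> computable m Z \<Longrightarrow> computable m M \<Longrightarrow> computable m T \<Longrightarrow> computable m N \<Longrightarrow>
    computable m A \<Longrightarrow> computable m B \<Longrightarrow>
    decidable m (\<lambda>s. adj_code (N s) (Z s) (coded (X s) (Z s) (M s)) (T s) (A s) (B s))"
  unfolding adj_code_def adj_def fst_conv snd_conv intra_window inter_window
  by (intro dec_disj dec_conj dec_not dec_eq dec_less dec_intra dec_inter comp_add comp_Suc
      comp_div comp_mod)

lemmas comp_intros = comp_const comp_var comp_Suc comp_add comp_mult comp_diff comp_power comp_digit
  comp_of_bool
lemmas dec_intros = dec_conj dec_disj dec_imp dec_not dec_eq dec_less dec_le dec_even dec_all dec_ex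
  comp_sum dec_intra dec_inter dec_adj_code

lemma dec_check_local:
  assumes "k < M" "Z < M" "X < M" "m < M" "t < M"
  shows "decidable M (\<lambda>s. check_local (s k) (s Z) (coded (s X) (s Z) (s m)) (s t))"
  unfolding check_local_def by (insert assms, (intro dec_intros comp_intros; (rule depI, simp)?; simp?))

lemma dec_check_girth:
  assumes "g < M" "N < M" "Z < M" "X < M" "m < M" "t < M"
  shows "decidable M (\<lambda>s. check_girth (s g) (s N) (s Z) (coded (s X) (s Z) (s m)) (s t))"
  unfolding check_girth_def by (insert assms, (intro dec_intros comp_intros; (rule depI, simp)?; simp?))

lemma dec_check:
  assumes "k < M" "g < M" "m < M" "w < M" "Z < M" "X < M"
  shows "decidable M (\<lambda>s. check (s k) (s g) (s m) (s w) (s Z) (s X))"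
proof -
  have "decidable x (\<lambda>s. check_girth (s g) ((2 * s g + 4) * s Z) (s Z) (coded (s X) (s Z) (s m)) (s t))"
    if "M \<le> x" "t < x" for x t
  proof (rule dec_let[where P = "\<lambda>N s. check_girth (s g) N (s Z) (coded (s X) (s Z) (s m)) (s t)"])
    show "computable x (\<lambda>s. (2 * s g + 4) * s Z)"
      by (insert assms that, (intro comp_intros; simp?))
    show "dep x (\<lambda>s. check_girth (s g) c (s Z) (coded (s X) (s Z) (s m)) (s t))" for c
      using assms that by (intro depI) simp
    show "decidable (Suc y) (\<lambda>s. check_girth (s g) (s y) (s Z) (coded (s X) (s Z) (s m)) (s t))"
      if "y \<ge> x" for y
      using assms that \<open>M \<le> x\<close> \<open>t < x\<close> by (intro dec_check_girth) auto
  qed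
  note girth = this
  show ?thesis
    unfolding check_def
    by (insert assms, (intro dec_intros comp_intros dec_check_local girth; (rule depI, simp)?; simp?))
qed

lemma dec_cyclic:
  assumes "k < M" "g < M" "m < M" "w < M"
  shows "decidable M (\<lambda>s. cyclic (s k) (s g) (s m) (s w))"
  unfolding cyclic_iff
proof (rule dec_conj)
  show "decidable M (\<lambda>s. 0 < s m)" using assms by (intro dec_less comp_intros)
  show "decidable M (\<lambda>s. \<exists>X<(2 ^ code_length (s w)) ^ s m. check (s k) (s g) (s m) (s w) (code_length (s w)) X)"
  proof (rule dec_let[where P = "\<lambda>Z s. \<exists>X<(2 ^ Z) ^ s m. check (s k) (s g) (s m) (s w) Z X"])
    show "computable M (\<lambda>s. code_length (s w))"
      unfolding code_length_def by (insert assms, (intro comp_intros; simp?))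
    show "dep M (\<lambda>s. \<exists>X<(2 ^ Z) ^ s m. check (s k) (s g) (s m) (s w) Z X)" for Z
      using assms by (intro depI) simp
    show "decidable (Suc x) (\<lambda>s. \<exists>X<(2 ^ s x) ^ s m. check (s k) (s g) (s m) (s w) (s x) X)"
      if "x \<ge> M" for x
      by (insert assms that, (intro dec_ex comp_intros dec_check; (rule depI, simp)?; simp?))
  qed
qed

section \<open>Minimal ratios\<close>

text \<open>Period \<open>q\<close> and \<open>p\<close> vertices realise the least ratio. Only
  competitors of bounded size are inspected, which makes this decidable;
  \<open>cyclic_reduce\<close> extends the inequality to all competitors.\<close>

definition minimal :: "nat \<Rightarrow> nat \<Rightarrow> nat \<Rightarrow> nat \<Rightarrow> bool" where
  "minimal k g q p \<longleftrightarrow> cyclic k g q p \<and>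
     (\<forall>m<2 * num_windows g p. \<forall>w<2 * num_windows g p * p. cyclic k g m w \<longrightarrow> p * m \<le> w * q)"

lemma dec_minimal:
  assumes "k < M" "g < M" "q < M" "p < M"
  shows "decidable M (\<lambda>s. minimal (s k) (s g) (s q) (s p))"
proof -
  have "computable x (\<lambda>s. num_windows (s g) (s p))" if "x \<ge> M" for x
    unfolding num_windows_def code_length_def by (insert assms that, (intro comp_intros; simp?))
  note nw = this
  show ?thesis
    unfolding minimal_def
    by (insert assms, (intro dec_conj dec_all dec_imp dec_le dec_cyclic comp_const comp_mult comp_var nw;
        (rule depI, simp)?; simp?))
qed

lemma minimalD:
  assumes "minimal k g q p" "cyclic k g m w"
  shows "p * m \<le> w * q"
proof -
  have q: "q > 0" using assms(1) by (auto simp: minimal_def cyclic_def)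
  show ?thesis
    using cyclic_reduce[OF q assms(2), of p]
  proof (elim disjE exE conjE)
    fix m' w' assume "cyclic k g m' w'" "m' < 2 * num_windows g p" "w' < 2 * num_windows g p * p"
      and le: "w' * m \<le> w * m'"
    then have "p * m' \<le> w' * q" using assms(1) by (auto simp: minimal_def)
    moreover have "m' > 0" using \<open>cyclic k g m' w'\<close> by (auto simp: cyclic_def)
    ultimately show ?thesis using ratio_trans[of p m' w' q m w] le by (simp add: mult.commute)
  qed
qed

text \<open>The given graph \<open>(m, w)\<close> serves as the threshold in
  \<open>cyclic_reduce\<close>: a competitor is either no better than it or no better than some
  small one. So a best element of the finite set \<open>S\<close> is best overall.\<close>

lemma minimal_exists:
  assumes "cyclic k g m w"
  shows "\<exists>q p. minimal k g q p"
proof -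
  have pos: "q > 0" if "cyclic k g q p" for q p using that by (auto simp: cyclic_def)
  let ?Q = "num_windows g w"
  define S where "S = {(q, p). cyclic k g q p \<and> (q < 2 * ?Q \<and> p < 2 * ?Q * w \<or> (q, p) = (m, w))}"
  have "finite S"
    by (rule finite_subset[of _ "insert (m, w) ({..<2 * ?Q} \<times> {..<2 * ?Q * w})"]) (auto simp: S_def)
  moreover have "(m, w) \<in> S" using assms by (simp add: S_def)
  ultimately have "\<exists>x\<in>S. \<forall>y\<in>S. real (snd x) / real (fst x) \<le> real (snd y) / real (fst y)"
    using ex_is_arg_min_if_finite[of S "\<lambda>x. real (snd x) / real (fst x)"]
    unfolding is_arg_min_linorder by blast
  then obtain q p where qp: "(q, p) \<in> S"
    "\<And>q' p'. (q', p') \<in> S \<Longrightarrow> real p / real q \<le> real p' / real q'" by force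
  have le: "p * q' \<le> p' * q" if "(q', p') \<in> S" for q' p'
  proof -
    have "q > 0" "q' > 0" using qp(1) that pos by (auto simp: S_def)
    then have "real p * real q' \<le> real p' * real q"
      using qp(2)[OF that] by (simp add: field_simps)
    then show ?thesis by (simp only: of_nat_mult[symmetric] of_nat_le_iff)
  qed
  have "p * q' \<le> p' * q" if "cyclic k g q' p'" for q' p'
    using cyclic_reduce[OF pos[OF assms] that, of w]
  proof (elim disjE exE conjE)
    assume *: "w * q' \<le> p' * m"
    have "p * m \<le> w * q" using le[OF \<open>(m, w) \<in> S\<close>] .
    then show ?thesis using ratio_trans[of p m w q q' p'] * pos[OF assms] by (simp add: mult.commute)
  next
    fix m' w' assume *: "cyclic k g m' w'" "m' < 2 * ?Q" "w' < 2 * ?Q * w" "w' * q' \<le> p' * m'"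
    then have "p * m' \<le> w' * q" by (intro le) (simp add: S_def)
    then show ?thesis using ratio_trans[of p m' w' q q' p'] * pos by (simp add: mult.commute)
  qed
  then have "minimal k g q p" using qp(1) by (auto simp: minimal_def S_def)
  then show ?thesis by blast
qed

text \<open>A bounded least number operator in a form that is a sum, hence computable.\<close>

definition bounded_least :: "nat \<Rightarrow> (nat \<Rightarrow> bool) \<Rightarrow> nat" where
  "bounded_least n P = (\<Sum>i<n. of_bool (\<forall>j<Suc i. \<not> P j))"

lemma bounded_least:
  assumes "i < n" "P i"
  shows "P (bounded_least n P)"
proof -
  define l where "l = (LEAST i. P i)"
  have l: "P l" "l \<le> i" "\<And>j. P j \<Longrightarrow> l \<le> j"
    unfolding l_def using assms by (auto intro: LeastI Least_le)
  have "(\<forall>j<Suc i. \<not> P j) \<longleftrightarrow> i < l" for i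
    using l(1,3) by (metis less_Suc_eq_le not_le order_trans)
  then have "bounded_least n P = (\<Sum>i<n. of_bool (i < l))" by (simp add: bounded_least_def)
  also have "\<dots> = card ({..<n} \<inter> {i. i < l})" by (subst sum_of_bool_eq) simp_all
  also have "{..<n} \<inter> {i. i < l} = {..<l}" using l(2) assms(1) by auto
  finally show ?thesis using l(1) by simp
qed

text \<open>The search runs over a common bound \<open>n\<close> for \<open>q\<close> and
  \<open>p\<close>; once a minimal pair lies below it, \<open>bounded_least\<close> recovers first
  \<open>q\<close> and then \<open>p\<close>.\<close>

theorem minimal_program:
  "\<exists>P. \<forall>k g. (\<exists>q p. minimal k g q p) \<longrightarrow>
    (\<exists>t s. runs P (input k g) t s \<and> minimal k g (s 1) (s 0))"
proof -
  define R where "R k g n \<longleftrightarrow> (\<exists>q<n. \<exists>p<n. minimal k g q p)" for k g n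
  define q where "q k g n = bounded_least n (\<lambda>q. \<exists>p<n. minimal k g q p)" for k g n
  define p where "p k g n = bounded_least n (\<lambda>p. minimal k g (q k g n) p)" for k g n
  have dq: "decidable M (\<lambda>s. \<exists>p<s 2. minimal (s 0) (s 1) (s x) p)" if "x < M" "M \<ge> 3" for x M
    by (insert that, (intro dec_ex comp_var dec_minimal; (rule depI, simp)?; simp?))
  have cq: "computable M (\<lambda>s. q (s 0) (s 1) (s 2))" if "M \<ge> 3" for M
    unfolding q_def bounded_least_def
    by (insert that, (intro comp_sum comp_of_bool dec_all dec_not comp_var comp_Suc dq; (rule depI, simp)?; simp?))
  have dp: "decidable M (\<lambda>s. minimal (s 0) (s 1) (q (s 0) (s 1) (s 2)) (s x))" if "x < M" "M \<ge> 3" for x M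
    by (rule dec_let[where P = "\<lambda>c s. minimal (s 0) (s 1) c (s x)", OF cq])
      (use that in \<open>auto intro!: depI dec_minimal\<close>)
  have "computable 3 (\<lambda>s. p (s 0) (s 1) (s 2))"
    unfolding p_def bounded_least_def
    by (intro comp_sum comp_of_bool dec_all dec_not comp_var comp_Suc dp; (rule depI, simp)?; simp?)
  moreover have "decidable 3 (\<lambda>s. R (s 0) (s 1) (s 2))"
    unfolding R_def
    by (intro dec_ex comp_var dec_minimal; (rule depI, simp)?; simp?)
  ultimately obtain P where P: "\<And>a b. \<exists>n. R a b n \<Longrightarrow>
      \<exists>t s n. runs P (input a b) t s \<and> R a b n \<and> s 0 = p a b n \<and> s 1 = q a b n"
    using search_program[of R p q] cq[of 3] by auto
  show ?thesis
  proof (intro exI[of _ P] allI impI)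
    fix k g assume "\<exists>q p. minimal k g q p"
    then obtain q0 p0 where "minimal k g q0 p0" by blast
    then have "R k g (Suc (max q0 p0))" unfolding R_def by (metis le_imp_less_Suc max.cobounded1 max.cobounded2)
    then obtain t s n where *: "runs P (input k g) t s" "R k g n" "s 0 = p k g n" "s 1 = q k g n"
      using P by blast
    from *(2) obtain q1 where "q1 < n" "\<exists>p<n. minimal k g q1 p" unfolding R_def by blast
    from bounded_least[of _ _ "\<lambda>q. \<exists>p<n. minimal k g q p", OF this]
    have "\<exists>p<n. minimal k g (q k g n) p" by (simp add: q_def)
    then obtain p1 where "p1 < n" "minimal k g (q k g n) p1" by blast
    from bounded_least[of _ _ "minimal k g (q k g n)", OF this] have "minimal k g (q k g n) (p k g n)" by (simp add: p_def)
    then show "\<exists>t s. runs P (input k g) t s \<and> minimal k g (s 1) (s 0)" by (intro exI[of _ t] exI[of _ s]) (simp only: *)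
  qed
qed

section \<open>Closing up a graph along a geodesic\<close>

lemma nat_of_bits:
  assumes "finite S"
  shows "\<exists>n :: nat. \<forall>i. bit n i \<longleftrightarrow> i \<in> S"
  using assms
proof (induction S)
  case (insert j S)
  then obtain n :: nat where "\<forall>i. bit n i \<longleftrightarrow> i \<in> S" by blast
  then have "\<forall>i. bit (set_bit j n) i \<longleftrightarrow> i \<in> insert j S"
    by (auto simp: bit_set_bit_iff)
  then show ?case by blast
qed (auto intro: exI[of _ 0])

lemma numbering:
  assumes "finite A" "a \<in> A"
  shows "\<exists>f :: 'a \<Rightarrow> nat. bij_betw f A {..<card A} \<and> f a = 0"
proof -
  obtain f :: "'a \<Rightarrow> nat" where f: "bij_betw f (A - {a}) {0..<card (A - {a})}"
    using ex_bij_betw_finite_nat[of "A - {a}"] assms by auto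
  let ?f = "\<lambda>x. if x = a then 0 else Suc (f x)"
  have "bij_betw ?f A {..<card A}"
    unfolding bij_betw_def
  proof
    show "inj_on ?f A" using f by (auto simp: bij_betw_def inj_on_def)
    have "?f ` A = insert 0 (Suc ` f ` (A - {a}))" using assms(2) by auto
    also have "\<dots> = insert 0 (Suc ` {0..<card (A - {a})})" using f by (simp add: bij_betw_def)
    also have "\<dots> = {..<Suc (card (A - {a}))}" by (auto simp: image_iff Suc_less_eq2 less_Suc_eq_0_disj)
    also have "Suc (card (A - {a})) = card A" using assms by (rule card_Suc_Diff1)
    finally show "?f ` A = {..<card A}" .
  qed
  then show ?thesis by (intro exI[of _ ?f]) simp
qed

lemma even_card_symmetric:
  assumes "finite S" "\<And>x y. R x y \<Longrightarrow> R y x" "\<And>x. \<not> R x x"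
  shows "even (card {(x, y). x \<in> S \<and> y \<in> S \<and> R x y})"
  using assms(1)
proof (induction S)
  case (insert a S)
  let ?X = "{(x, y). x \<in> S \<and> y \<in> S \<and> R x y}" and ?N = "{y \<in> S. R a y}"
  have fin: "finite ?X" by (rule finite_subset[of _ "S \<times> S"]) (use insert in auto)
  have "{(x, y). x \<in> insert a S \<and> y \<in> insert a S \<and> R x y} =
      ?X \<union> (Pair a ` ?N \<union> (\<lambda>y. (y, a)) ` ?N)"
    using assms(2,3) by auto
  moreover have "card (?X \<union> (Pair a ` ?N \<union> (\<lambda>y. (y, a)) ` ?N)) =
      card ?X + (card ?N + card ?N)"
    using insert fin by (subst card_Un_disjoint; auto simp: card_image inj_on_def)+
  ultimately show ?case using insert by simp
qed simp

text \<open>The degrees in \<open>S\<close> sum to \<open>card S * k\<close>, and each edge inside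
  \<open>S\<close> is counted twice.\<close>

lemma even_cut:
  assumes "ugraph V E" "\<And>v. v \<in> V \<Longrightarrow> deg E v = k" "even k" "S \<subseteq> V"
  shows "even (card {(x, y). E x y \<and> x \<in> S \<and> y \<notin> S})"
proof -
  let ?I = "{(x, y). x \<in> S \<and> y \<in> S \<and> E x y}" and ?C = "{(x, y). E x y \<and> x \<in> S \<and> y \<notin> S}"
  have finV: "finite V" "finite S" using assms(1,4) by (auto simp: ugraph_def finite_subset)
  have fin: "finite ?I" "finite ?C"
    by (rule finite_subset[of _ "V \<times> V"]; use assms(1) finV in \<open>auto simp: ugraph_def\<close>)+
  have "card ?I + card ?C = card (?I \<union> ?C)"
    using fin by (subst card_Un_disjoint) auto
  also have "?I \<union> ?C = (SIGMA x:S. {y. E x y})" by auto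
  also have "card \<dots> = (\<Sum>x\<in>S. deg E x)"
    using finV graph_nbrs[OF assms(1)] by (simp add: deg_def)
  also have "\<dots> = (\<Sum>x\<in>S. k)" using assms(2,4) by (intro sum.cong) auto
  finally have "card ?I + card ?C = card S * k" by simp
  then have "even (card ?I + card ?C)" using assms(3) by (simp only:) simp
  moreover have "even (card ?I)"
    using assms(1) finV by (intro even_card_symmetric) (auto simp: ugraph_def)
  ultimately show ?thesis by (simp only: even_add)
qed

text \<open>Any level function that changes by at most 1 along edges and increases along the path
  may take the place of the distance from \<open>p 0\<close>; this is convenient for graphs glued
  from pieces.\<close>

locale surgery =
  fixes V :: "'a set" and E k g and h :: "'a \<Rightarrow> nat" and p :: "nat \<Rightarrow> 'a" and d
  assumes G: "ugraph V E" and reg: "\<And>v. v \<in> V \<Longrightarrow> deg E v = k" and girth_geE: "girth_ge g E"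
    and g: "g \<ge> 3" and d: "d \<ge> 3"
    and lip: "\<And>x y. E x y \<Longrightarrow> h x \<le> Suc (h y)"
    and path: "\<And>i. i < d \<Longrightarrow> E (p i) (p (Suc i))" and hp: "\<And>i. i \<le> d \<Longrightarrow> h (p i) = i"
begin

definition m where "m = d - 1"
text \<open>Levels 0 and 1 are merged into layer 0, and all levels from \<open>m\<close> on into
  layer \<open>m - 1\<close>. Then both removed edges lie inside a layer and \<open>p 1\<close>,
  ..., \<open>p m\<close> become the spine, which is why the period is \<open>d - 1\<close>.\<close>

definition l where "l x = max 1 (min m (h x)) - 1"
definition E' where "E' x y \<longleftrightarrow> E x y \<and> {x, y} \<noteq> {p 0, p 1} \<and> {x, y} \<noteq> {p m, p d}"
text \<open>Read as leading upwards into the next copy. Each of the four ends loses one edge and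
  gains one link, and two links form an even cut.\<close>

definition link where "link x y \<longleftrightarrow> x = p m \<and> y = p 1 \<or> x = p d \<and> y = p 0"

lemma md: "m \<ge> 2" "d = Suc m" using d by (auto simp: m_def)

lemma E_in: "E x y \<Longrightarrow> x \<in> V \<and> y \<in> V \<and> x \<noteq> y \<and> E y x"
  using G by (auto simp: ugraph_def)

lemma p_in: "i \<le> d \<Longrightarrow> p i \<in> V"
  using path[of i] path[of "i - 1"] E_in d by (cases "i < d") force+

lemma p_inj: "i \<le> d \<Longrightarrow> j \<le> d \<Longrightarrow> p i = p j \<longleftrightarrow> i = j"
  using hp by metis

lemma p_ne: "p 0 \<noteq> p 1" "p 0 \<noteq> p m" "p 0 \<noteq> p d" "p 1 \<noteq> p m" "p 1 \<noteq> p d" "p m \<noteq> p d"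
  using p_inj md by auto

lemma E01: "E (p 0) (p 1)" "E (p 1) (p 0)" "E (p m) (p d)" "E (p d) (p m)"
  using path[of 0] path[of m] E_in md by auto

lemma E'_sym: "E' x y \<Longrightarrow> E' y x"
  unfolding E'_def using E_in by (metis insert_commute)

lemma E'_E: "E' x y \<Longrightarrow> E x y" by (simp add: E'_def)

lemma E'_in: "E' x y \<Longrightarrow> x \<in> V \<and> y \<in> V \<and> x \<noteq> y"
  using E_in by (auto simp: E'_def)

lemma l_lt: "l x < m" using md by (auto simp: l_def)

lemma l_lip: "E x y \<Longrightarrow> l x \<le> Suc (l y)"
  using lip[of x y] by (auto simp: l_def)

lemma l_p: "l (p 0) = 0" "l (p 1) = 0" "l (p m) = m - 1" "l (p d) = m - 1"
  using hp[of 0] hp[of 1] hp[of m] hp[of d] md by (auto simp: l_def)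

lemma l_p_mid: "i < m \<Longrightarrow> l (p (Suc i)) = i"
  using hp[of "Suc i"] md by (auto simp: l_def)

lemma link_in: "link x y \<Longrightarrow> x \<in> V \<and> y \<in> V \<and> l x = m - 1 \<and> l y = 0"
  unfolding link_def using p_in md l_p by (metis One_nat_def Suc_leD le_SucI le_refl numeral_2_eq_2 zero_le)

text \<open>Each layer is numbered so that its spine vertex gets the label 0, as
  \<open>admissible\<close> demands.\<close>

lemma labelling:
  "\<exists>lab :: 'a \<Rightarrow> nat. \<forall>i<m. bij_betw lab {x \<in> V. l x = i} {..<card {x \<in> V. l x = i}} \<and>
    lab (p (Suc i)) = 0"
proof -
  have "\<exists>f :: 'a \<Rightarrow> nat. bij_betw f {x \<in> V. l x = i} {..<card {x \<in> V. l x = i}} \<and> f (p (Suc i)) = 0"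
    if "i < m" for i
    using that p_in[of "Suc i"] md graph_finite[OF G] by (intro numbering) (auto simp: l_p_mid)
  then obtain f :: "nat \<Rightarrow> 'a \<Rightarrow> nat" where
    f: "\<And>i. i < m \<Longrightarrow> bij_betw (f i) {x \<in> V. l x = i} {..<card {x \<in> V. l x = i}} \<and> f i (p (Suc i)) = 0"
    by metis
  show ?thesis
  proof (intro exI[of _ "\<lambda>x. f (l x) x"] allI impI conjI)
    fix i assume i: "i < m"
    have "bij_betw (\<lambda>x. f (l x) x) {x \<in> V. l x = i} {..<card {x \<in> V. l x = i}} \<longleftrightarrow>
        bij_betw (f i) {x \<in> V. l x = i} {..<card {x \<in> V. l x = i}}"
      by (rule bij_betw_cong) auto
    then show "bij_betw (\<lambda>x. f (l x) x) {x \<in> V. l x = i} {..<card {x \<in> V. l x = i}}"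
      using f[OF i] by blast
    show "f (l (p (Suc i))) (p (Suc i)) = 0" using f[OF i] l_p_mid[OF i] by simp
  qed
qed

definition up where "up i x y \<longleftrightarrow> x \<in> V \<and> y \<in> V \<and> l x = i \<and>
  (if Suc i = m then link x y else E' x y \<and> l y = Suc i)"

text \<open>The first component is the number of the copy. This is the layered graph before its
  vertices are sorted into layers and labelled.\<close>

definition chain :: "nat \<times> 'a \<Rightarrow> nat \<times> 'a \<Rightarrow> bool" where
  "chain x y \<longleftrightarrow> (fst x = fst y \<and> E' (snd x) (snd y)) \<or>
     (fst y = Suc (fst x) \<and> link (snd x) (snd y)) \<or> (fst x = Suc (fst y) \<and> link (snd y) (snd x))"

lemma chain_sym: "chain x y \<Longrightarrow> chain y x"
  using E'_sym by (auto simp: chain_def)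

lemma potential_chain:
  assumes "\<And>c x y. E' x y \<Longrightarrow> {(c, x), (c, y)} \<noteq> {s, t} \<Longrightarrow> \<Phi> (c, x) \<le> \<Phi> (c, y) + 1"
    and "\<And>c x y. link x y \<Longrightarrow> {(c, x), (Suc c, y)} \<noteq> {s, t} \<Longrightarrow> \<bar>\<Phi> (c, x) - \<Phi> (Suc c, y)\<bar> \<le> 1"
    and "\<Phi> s + int g \<le> \<Phi> t + 1"
  shows "potential g chain s t \<Phi>"
proof (rule potentialI)
  show "\<Phi> s + int g \<le> \<Phi> t + 1" by fact
  fix x y assume "chain x y" and ne: "{x, y} \<noteq> {s, t}"
  then consider "fst x = fst y" "E' (snd x) (snd y)" | "fst y = Suc (fst x)" "link (snd x) (snd y)"
    | "fst x = Suc (fst y)" "link (snd y) (snd x)" by (auto simp: chain_def)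
  then show "\<Phi> x \<le> \<Phi> y + 1"
  proof cases
    case 1
    then show ?thesis using assms(1)[of "snd x" "snd y" "fst x"] ne by (cases x; cases y) auto
  next
    case 2
    then show ?thesis using assms(2)[of "snd x" "snd y" "fst x"] ne by (cases x; cases y) auto
  next
    case 3
    then show ?thesis using assms(2)[of "snd y" "snd x" "fst y"] ne
      by (cases x; cases y) (auto simp: insert_commute)
  qed
qed

text \<open>Leaving a copy at one end of a removed edge means returning at the other end, so an
  excursion can be traded for that edge. A cycle through a link comes back through the parallel link
  and so contains a detour from \<open>p 0\<close> to \<open>p 1\<close>.\<close>

lemma chain_girth_ge: "girth_ge g chain"
proof (rule girth_geI[OF chain_sym])
  have E'_ne: "E' x y \<Longrightarrow> {x, y} \<noteq> {p 0, p 1}" "E' x y \<Longrightarrow> {x, y} \<noteq> {p m, p d}" for x y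
    by (auto simp: E'_def)
  have ne: "{p m, p d} \<noteq> {p 0, p 1}" using p_ne by (auto simp: doubleton_eq_iff)
  fix s t assume "chain s t"
  then consider c x y where "s = (c, x)" "t = (c, y)" "E' x y"
    | c x y where "{s, t} = {(c, x), (Suc c, y)}" "link x y"
    by (cases s; cases t) (auto simp: chain_def insert_commute)
  then show "(\<exists>\<Phi>. potential g chain s t \<Phi>) \<or> (\<exists>\<Phi>. potential g chain t s \<Phi>)"
  proof cases
    case 1
    then obtain \<phi> where \<phi>: "potential g E x y \<phi>" using girth_geE E'_E[OF 1(3)] unfolding girth_ge_def by blast
    have ne1: "{p m, p d} \<noteq> {x, y}" "{p d, p m} \<noteq> {x, y}" "{p 0, p 1} \<noteq> {x, y}" "{p 1, p 0} \<noteq> {x, y}"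
      using E'_ne[OF 1(3)] by (metis insert_commute)+
    have b: "\<bar>\<phi> (p m) - \<phi> (p d)\<bar> \<le> 1" "\<bar>\<phi> (p 0) - \<phi> (p 1)\<bar> \<le> 1"
      using potential_le[OF \<phi> E01(1) ne1(3)] potential_le[OF \<phi> E01(2) ne1(4)]
        potential_le[OF \<phi> E01(3) ne1(1)] potential_le[OF \<phi> E01(4) ne1(2)] by linarith+
    \<comment> \<open>Later copies take the value at \<open>p d\<close>, earlier ones the value at
      \<open>p 0\<close>. The ends of a removed edge differ by at most 1, so the links are
      respected.\<close>
    let ?\<Phi> = "\<lambda>z. if fst z = c then \<phi> (snd z) else if fst z > c then \<phi> (p d) else \<phi> (p 0)"
    have "potential g chain s t ?\<Phi>"
    proof (rule potential_chain[where \<Phi> = ?\<Phi>])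
      fix c' x' y' assume "E' x' y'" "{(c', x'), (c', y')} \<noteq> {s, t}"
      then show "?\<Phi> (c', x') \<le> ?\<Phi> (c', y') + 1"
        using potential_le[OF \<phi> E'_E, of x' y'] 1 by (auto simp: doubleton_eq_iff)
    next
      fix c' x' y' assume "link x' y'"
      then show "\<bar>?\<Phi> (c', x') - ?\<Phi> (Suc c', y')\<bar> \<le> 1"
        using b by (auto simp: link_def)
    next
      show "?\<Phi> s + int g \<le> ?\<Phi> t + 1" using \<phi> 1 by (simp add: potential_def)
    qed
    then show ?thesis by blast
  next
    case 2
    \<comment> \<open>\<open>z\<close> is the upper end of the parallel link; all copies up to
      \<open>c\<close> get the value 0, which is also the value at \<open>z\<close>.\<close>
    define z where "z = (if y = p 1 then p 0 else p 1)"
    have yz: "E y z" "{y, z} = {p 0, p 1}"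
      using 2(2) E01 p_ne by (auto simp: link_def z_def)
    then obtain \<chi>0 where "potential g E z y \<chi>0" using girth_geE E_in by (meson girth_ge_def)
    then obtain \<chi> where \<chi>: "potential g E z y \<chi>" "\<chi> z = 0" "\<chi> y = int g - 1"
      using potential_clamp[of g] g by (metis gr0I not_numeral_le_zero)
    have lip: "\<chi> u \<le> \<chi> v + 1" if "E u v" "{u, v} \<noteq> {p 0, p 1}" for u v
      using potential_le[OF \<chi>(1) that(1)] that(2) yz(2) by (simp add: insert_commute)
    have b: "\<bar>\<chi> (p m) - \<chi> (p d)\<bar> \<le> 1"
      using lip[OF E01(3) ne] lip[OF E01(4)] ne by (simp add: insert_commute)
    let ?\<Phi> = "\<lambda>w. if fst w = Suc c then \<chi> (snd w) else if fst w > Suc c then \<chi> (p d) else 0"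
    have "potential g chain (c, x) (Suc c, y) ?\<Phi>"
    proof (rule potential_chain[where \<Phi> = ?\<Phi>])
      fix c' x' y' assume "E' x' y'"
      then show "?\<Phi> (c', x') \<le> ?\<Phi> (c', y') + 1" using lip[OF E'_E E'_ne(1)] by auto
    next
      fix c' x' y' assume "link x' y'" and ne': "{(c', x'), (Suc c', y')} \<noteq> {(c, x), (Suc c, y)}"
      have "\<chi> y' = 0" if "c' = c"
      proof -
        have "(x', y') \<noteq> (x, y)" using ne' that by auto
        then have "y' = z" using \<open>link x' y'\<close> 2(2) p_ne by (auto simp: link_def z_def)
        then show ?thesis using \<chi>(2) by simp
      qed
      then show "\<bar>?\<Phi> (c', x') - ?\<Phi> (Suc c', y')\<bar> \<le> 1"
        using b \<open>link x' y'\<close> by (auto simp: link_def)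
    next
      show "?\<Phi> (c, x) + int g \<le> ?\<Phi> (Suc c, y) + 1" using \<chi> by simp
    qed
    then show ?thesis using 2(1) by (auto simp: doubleton_eq_iff)
  qed
qed

end

context surgery
begin

text \<open>At the four ends of the removed edges a link replaces the lost edge; elsewhere the
  neighbours are unchanged. They can be sorted by layer because layers change by at most 1 along
  edges.\<close>

lemma card_up_down:
  assumes "x \<in> V"
  shows "card {y. l y + 1 = l x \<and> E' x y} + card {y. E' x y \<and> l y = l x} +
      card {y. E' x y \<and> l y = Suc (l x)} + card {y. link y x} + card {y. link x y} = k"
proof -
  let ?N' = "{y. E' x y}" and ?N = "{y. E x y}"
  have finN: "finite ?N" using G by (rule graph_nbrs)
  have fin: "finite ?N'" by (rule finite_subset[OF _ finN]) (auto dest: E'_E)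
  have "?N' = {y. l y + 1 = l x \<and> E' x y} \<union> ({y. E' x y \<and> l y = l x} \<union> {y. E' x y \<and> l y = Suc (l x)})"
  proof -
    have "l y + 1 = l x \<or> l y = l x \<or> l y = Suc (l x)" if "E' x y" for y
    proof -
      have "E x y" "E y x" using E'_E[OF that] E_in by blast+
      then have "l x \<le> Suc (l y)" "l y \<le> Suc (l x)" by (auto intro: l_lip)
      then show ?thesis by linarith
    qed
    then show ?thesis by blast
  qed
  then have "card ?N' = card ({y. l y + 1 = l x \<and> E' x y} \<union>
      ({y. E' x y \<and> l y = l x} \<union> {y. E' x y \<and> l y = Suc (l x)}))" by (rule arg_cong)
  also have "\<dots> = card {y. l y + 1 = l x \<and> E' x y} + card ({y. E' x y \<and> l y = l x} \<union>
      {y. E' x y \<and> l y = Suc (l x)})"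
    by (rule card_Un_disjoint) (auto intro: finite_subset[OF _ fin])
  also have "card ({y. E' x y \<and> l y = l x} \<union> {y. E' x y \<and> l y = Suc (l x)}) =
      card {y. E' x y \<and> l y = l x} + card {y. E' x y \<and> l y = Suc (l x)}"
    by (rule card_Un_disjoint) (auto intro: finite_subset[OF _ fin])
  finally have N': "card ?N' = card {y. l y + 1 = l x \<and> E' x y} + card {y. E' x y \<and> l y = l x} +
      card {y. E' x y \<and> l y = Suc (l x)}" by simp
  have k: "card ?N = k" using reg[OF assms] by (simp add: deg_def)
  have rem: "card (?N - {z}) + 1 = k" if "E x z" for z
    using that finN k card_Suc_Diff1[of ?N z] by simp
  note ne = p_ne
  consider "x = p 0" | "x = p 1" | "x = p m" | "x = p d" | "x \<notin> {p 0, p 1, p m, p d}" by blast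
  then have "card ?N' + card {y. link y x} + card {y. link x y} = k"
  proof cases
    case 1
    have "?N' = ?N - {p 1}" "{y. link y x} = {p d}" "{y. link x y} = {}"
      using 1 ne by (auto simp: E'_def link_def doubleton_eq_iff)
    then show ?thesis using rem[of "p 1"] E01 1 by simp
  next
    case 2
    have "?N' = ?N - {p 0}" "{y. link y x} = {p m}" "{y. link x y} = {}"
      using 2 ne by (auto simp: E'_def link_def doubleton_eq_iff)
    then show ?thesis using rem[of "p 0"] E01 2 by simp
  next
    case 3
    have "?N' = ?N - {p d}" "{y. link y x} = {}" "{y. link x y} = {p 1}"
      using 3 ne by (auto simp: E'_def link_def doubleton_eq_iff)
    then show ?thesis using rem[of "p d"] E01 3 by simp
  next
    case 4
    have "?N' = ?N - {p m}" "{y. link y x} = {}" "{y. link x y} = {p 0}"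
      using 4 ne by (auto simp: E'_def link_def doubleton_eq_iff)
    then show ?thesis using rem[of "p m"] E01 4 by simp
  next
    case 5
    have "?N' = ?N" "{y. link y x} = {}" "{y. link x y} = {}"
      using 5 by (auto simp: E'_def link_def doubleton_eq_iff)
    then show ?thesis using k by simp
  qed
  then show ?thesis using N' by simp
qed

text \<open>Inside a copy, the edges between consecutive layers are a cut of the original regular
  graph; between two copies there are just the two links.\<close>

lemma even_up:
  assumes "even k" "i < m"
  shows "even (card {(x, y). up i x y})"
proof (cases "Suc i = m")
  case True
  have "m - 1 = i" using True by simp
  then have "up i x y \<longleftrightarrow> link x y" for x y using True link_in[of x y] unfolding up_def by auto
  then have "{(x, y). up i x y} = {(p m, p 1), (p d, p 0)}" by (auto simp: link_def)
  then show ?thesis using p_ne by simp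
next
  case False
  have "up i x y \<longleftrightarrow> E x y \<and> x \<in> {x \<in> V. l x \<le> i} \<and> y \<notin> {x \<in> V. l x \<le> i}" for x y
  proof
    assume "up i x y"
    then show "E x y \<and> x \<in> {x \<in> V. l x \<le> i} \<and> y \<notin> {x \<in> V. l x \<le> i}"
      using False E'_E by (auto simp: up_def)
  next
    assume *: "E x y \<and> x \<in> {x \<in> V. l x \<le> i} \<and> y \<notin> {x \<in> V. l x \<le> i}"
    then have xy: "E x y" "x \<in> V" "y \<in> V" "l x \<le> i" "i < l y" using E_in by auto
    then have l: "l x = i" "l y = Suc i" using l_lip[of y x] E_in by auto
    have "{x, y} \<noteq> {p 0, p 1}" "{x, y} \<noteq> {p m, p d}"
      using l l_p by (auto simp: doubleton_eq_iff)
    then show "up i x y" using xy l False by (auto simp: up_def E'_def)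
  qed
  then show ?thesis using even_cut[OF G reg assms(1), of "{x \<in> V. l x \<le> i}"] by simp
qed

theorem cyclic_closure: "cyclic k g m (card V)"
proof -
  obtain lab :: "'a \<Rightarrow> nat" where
    bij: "\<And>i. i < m \<Longrightarrow> bij_betw lab {x \<in> V. l x = i} {..<card {x \<in> V. l x = i}}"
    and lab0: "\<And>i. i < m \<Longrightarrow> lab (p (Suc i)) = 0"
    using labelling by blast
  have finV: "finite V" using G by (rule graph_finite)
  have inj: "x = y" if "x \<in> V" "y \<in> V" "l x = l y" "lab x = lab y" for x y
    using bij[OF l_lt[of x]] that by (auto simp: bij_betw_def dest: inj_onD)
  \<comment> \<open>The bits of letter \<open>i\<close>; the alternative \<open>x = y\<close>
    produces the loops that mark present vertices.\<close>
  define S where "S i = {2 * prod_encode (lab x, lab y) |x y. x \<in> V \<and> y \<in> V \<and> l x = i \<and> l y = i \<and> (x = y \<or> E' x y)} \<union>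
      {2 * prod_encode (lab x, lab y) + 1 |x y. up i x y}" for i
  have "finite (S i)" for i
  proof -
    have "S i \<subseteq> (\<lambda>(x, y). 2 * prod_encode (lab x, lab y)) ` (V \<times> V) \<union>
        (\<lambda>(x, y). 2 * prod_encode (lab x, lab y) + 1) ` (V \<times> V)"
      by (auto simp: S_def up_def)
    then show ?thesis by (rule finite_subset) (use finV in simp)
  qed
  then have "\<forall>i. \<exists>n :: nat. \<forall>b. bit n b \<longleftrightarrow> b \<in> S i" using nat_of_bits by blast
  then obtain c :: "nat \<Rightarrow> nat" where c: "\<And>i b. bit (c i) b \<longleftrightarrow> b \<in> S i" by metis
  define F where "F t = c (t mod m)" for t
  have intra: "intra F t a b \<longleftrightarrow> (\<exists>x y. x \<in> V \<and> y \<in> V \<and> l x = t mod m \<and> l y = t mod m \<and>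
      (x = y \<or> E' x y) \<and> lab x = a \<and> lab y = b)" for t a b
    unfolding intra_def F_def c S_def by (auto; presburger)
  have inter: "inter F t a b \<longleftrightarrow> (\<exists>x y. up (t mod m) x y \<and> lab x = a \<and> lab y = b)" for t a b
    unfolding inter_def F_def c S_def by (auto; presburger)
  have mpos: "0 < m" using md by simp
  have tm: "t mod m < m" for t using mpos by simp
  have up_l: "l x = t mod m \<and> l y = Suc t mod m" if "up (t mod m) x y" for t x y
    using that link_in[of x y] by (auto simp: up_def mod_Suc split: if_splits)
  have up_V: "x \<in> V \<and> y \<in> V" if "up i x y" for i x y using that by (simp add: up_def)
  have card_lab: "card (lab ` Y) = card Y" if "Y \<subseteq> {x \<in> V. l x = i}" for Y i
    by (rule card_image) (use that inj in \<open>auto simp: inj_on_def subset_iff\<close>)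
  have adm: "admissible k g F t" for t
    unfolding admissible_def
  proof (intro conjI allI impI)
    have ps: "p (Suc (t mod m)) \<in> V" "l (p (Suc (t mod m))) = t mod m"
      using p_in[of "Suc (t mod m)"] l_p_mid[OF tm] tm[of t] md by simp_all
    then show "intra F t 0 0" unfolding intra using lab0[OF tm] by blast
    show "inter F t 0 0"
    proof (cases "Suc (t mod m) = m")
      case True
      then have "up (t mod m) (p m) (p 1)"
        using p_in md l_p link_def by (auto simp: up_def)
      moreover have "lab (p m) = 0" "lab (p 1) = 0" using lab0[of "m - 1"] lab0[of 0] md by auto
      ultimately show ?thesis unfolding inter by blast
    next
      case False
      let ?i = "t mod m"
      have i: "Suc ?i < m" using tm[of t] False by simp
      have "{p (Suc ?i), p (Suc (Suc ?i))} \<noteq> {p 0, p 1}" "{p (Suc ?i), p (Suc (Suc ?i))} \<noteq> {p m, p d}"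
        using i md p_inj[of "Suc ?i"] p_inj[of "Suc (Suc ?i)"] by (auto simp: doubleton_eq_iff)
      then have "E' (p (Suc ?i)) (p (Suc (Suc ?i)))"
        using path[of "Suc ?i"] i md by (simp add: E'_def)
      then have "up ?i (p (Suc ?i)) (p (Suc (Suc ?i)))"
        using E'_in i l_p_mid by (auto simp: up_def)
      then show ?thesis unfolding inter using lab0[OF tm] lab0[OF i] by blast
    qed
    fix a b
    show "intra F t b a" "intra F t a a" if "intra F t a b"
      using that unfolding intra by (metis E'_sym)+
    show "intra F t b b" if "intra F t a a" "b \<le> a"
    proof -
      let ?L = "{x \<in> V. l x = t mod m}"
      from that(1) obtain x where "x \<in> ?L" "lab x = a" unfolding intra by blast
      then have "a < card ?L" using bij[OF tm[of t]] by (auto simp: bij_betw_def)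
      then have "b \<in> lab ` ?L" using bij[OF tm[of t]] that(2) by (simp add: bij_betw_def)
      then show ?thesis unfolding intra by blast
    qed
    show "intra F t a a" "intra F (Suc t) b b" if "inter F t a b"
      using that up_l up_V unfolding inter intra by blast+
  next
    fix a assume "intra F (Suc t) a a"
    then obtain x where x: "x \<in> V" "l x = Suc t mod m" "lab x = a" unfolding intra by blast
    have vert: "y = x" if "y \<in> V" "l y = Suc t mod m" "lab y = a" for y
      using inj[of y x] that x by simp
    have "{b. inter F t b a} = lab ` {y. up (t mod m) y x}"
    proof -
      have "inter F t b a \<longleftrightarrow> (\<exists>y. up (t mod m) y x \<and> lab y = b)" for b
        unfolding inter using vert up_l up_V x(3) by metis
      then show ?thesis by auto
    qed
    also have "card \<dots> = card {y. up (t mod m) y x}"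
      by (rule card_lab[of _ "t mod m"]) (auto simp: up_def)
    also have "{y. up (t mod m) y x} = (if l x = 0 then {y. link y x} else {y. l y + 1 = l x \<and> E' x y})"
      using x link_in E'_in E'_sym tm[of t] by (auto simp: up_def mod_Suc split: if_splits)
    finally have 1: "card {b. inter F t b a} =
        card {y. l y + 1 = l x \<and> E' x y} + card {y. link y x}"
      using link_in by (cases "l x = 0") (auto simp: card_eq_0_iff)
    have "{b. b \<noteq> a \<and> intra F (Suc t) a b} = lab ` {y. E' x y \<and> l y = l x}"
    proof -
      have "b \<noteq> a \<and> intra F (Suc t) a b \<longleftrightarrow> (\<exists>y. E' x y \<and> l y = l x \<and> lab y = b)" for b
      proof
        assume "b \<noteq> a \<and> intra F (Suc t) a b"
        then show "\<exists>y. E' x y \<and> l y = l x \<and> lab y = b"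
          unfolding intra using vert x by metis
      next
        assume "\<exists>y. E' x y \<and> l y = l x \<and> lab y = b"
        then obtain y where y: "E' x y" "l y = l x" "lab y = b" by blast
        then have "b \<noteq> a" using inj[of x y] E'_in[OF y(1)] x by auto
        then show "b \<noteq> a \<and> intra F (Suc t) a b"
          unfolding intra using y x E'_in[OF y(1)] by metis
      qed
      then show ?thesis by auto
    qed
    also have "card \<dots> = card {y. E' x y \<and> l y = l x}"
      by (rule card_lab[of _ "l x"]) (auto dest: E'_in)
    finally have 2: "card {b. b \<noteq> a \<and> intra F (Suc t) a b} = card {y. E' x y \<and> l y = l x}" .
    have "{b. inter F (Suc t) a b} = lab ` {y. up (Suc t mod m) x y}"
    proof -
      have "inter F (Suc t) a b \<longleftrightarrow> (\<exists>y. up (Suc t mod m) x y \<and> lab y = b)" for b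
        unfolding inter using vert up_l up_V x(3) by metis
      then show ?thesis by auto
    qed
    also have "card \<dots> = card {y. up (Suc t mod m) x y}"
      by (rule card_lab[of _ "Suc (Suc t) mod m"]) (use up_l[of "Suc t"] up_V in blast)
    also have "{y. up (Suc t mod m) x y} =
        (if Suc (l x) = m then {y. link x y} else {y. E' x y \<and> l y = Suc (l x)})"
      using x link_in E'_in by (auto simp: up_def split: if_splits)
    finally have c3: "card {b. inter F (Suc t) a b} =
        card (if Suc (l x) = m then {y. link x y} else {y. E' x y \<and> l y = Suc (l x)})" .
    have 3: "card {b. inter F (Suc t) a b} = card {y. E' x y \<and> l y = Suc (l x)} + card {y. link x y}"
    proof (cases "Suc (l x) = m")
      case True
      have "l y \<noteq> m" for y using l_lt[of y] by simp
      then have "{y. E' x y \<and> l y = Suc (l x)} = {}" using True by simp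
      then have z: "card {y. E' x y \<and> l y = Suc (l x)} = 0" by (simp only: card.empty)
      show ?thesis unfolding z c3 using True by simp
    next
      case False
      have "\<not> link x y" for y using link_in[of x y] False md by auto
      then have "{y. link x y} = {}" by simp
      then have z: "card {y. link x y} = 0" by (simp only: card.empty)
      show ?thesis unfolding z c3 using False by simp
    qed
    show "card {b. inter F t b a} + card {b. b \<noteq> a \<and> intra F (Suc t) a b} +
        card {b. inter F (Suc t) a b} = k"
      unfolding 1 2 3 using card_up_down[OF x(1)] by simp
  next
    assume "even k"
    have "{(a, b). inter F t a b} = (\<lambda>(x, y). (lab x, lab y)) ` {(x, y). up (t mod m) x y}"
      by (auto simp: inter image_iff)
    moreover have "inj_on (\<lambda>(x, y). (lab x, lab y)) {(x, y). up (t mod m) x y}"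
      using up_l up_V inj by (fastforce simp: inj_on_def)
    ultimately show "even (card {(a, b). inter F t a b})"
      using even_up[OF \<open>even k\<close> tm] by (simp add: card_image)
  qed
  have girth_geF: "girth_ge g (adj F)"
  proof -
    \<comment> \<open>The inverse of the labelling maps the layered graph back into
      \<open>chain\<close>, whose girth is known.\<close>
    define vert where "vert i a = (THE x. x \<in> V \<and> l x = i \<and> lab x = a)" for i a
    have vert: "vert (l x) (lab x) = x" if "x \<in> V" for x
      unfolding vert_def by (rule the_equality) (use that inj in auto)
    let ?f = "\<lambda>z. (fst z div m, vert (fst z mod m) (snd z))"
    show ?thesis
    proof (rule girth_ge_hom[OF chain_girth_ge, where f = ?f])
      have present: "\<exists>x\<in>V. l x = t mod m \<and> lab x = a" if "adj F (t, a) z \<or> adj F z (t, a)" for t a z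
        using that up_l up_V unfolding adj_def inter intra by (cases z) (auto; metis)
      show "inj_on ?f {x. \<exists>y. adj F x y \<or> adj F y x}"
      proof (rule inj_onI)
        fix z w assume z: "z \<in> {x. \<exists>y. adj F x y \<or> adj F y x}" and w: "w \<in> {x. \<exists>y. adj F x y \<or> adj F y x}"
          and eq: "?f z = ?f w"
        obtain x where x: "x \<in> V" "l x = fst z mod m" "lab x = snd z"
          using z present[of "fst z" "snd z"] by auto
        obtain y where y: "y \<in> V" "l y = fst w mod m" "lab y = snd w"
          using w present[of "fst w" "snd w"] by auto
        have "x = y" "fst z div m = fst w div m"
          using eq vert[OF x(1)] vert[OF y(1)] x y by auto
        then show "z = w" using x y by (metis div_mod_decomp prod_eqI)
      qed
      have step: "chain (t div m, x) (Suc t div m, y)" if "up (t mod m) x y" for t x y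
        using that by (auto simp: up_def chain_def div_Suc mod_Suc)
      fix z w assume "adj F z w"
      then consider "fst z = fst w" "snd z \<noteq> snd w" "intra F (fst z) (snd z) (snd w)"
        | "fst w = Suc (fst z)" "inter F (fst z) (snd z) (snd w)"
        | "fst z = Suc (fst w)" "inter F (fst w) (snd w) (snd z)" by (auto simp: adj_def)
      then show "chain (?f z) (?f w)"
      proof cases
        case 1
        then obtain x y where "x \<in> V" "y \<in> V" "l x = fst z mod m" "l y = fst z mod m" "E' x y"
          "lab x = snd z" "lab y = snd w" unfolding intra by metis
        then show ?thesis using vert[of x] vert[of y] 1(1) by (simp add: chain_def)
      next
        case 2
        then obtain x y where xy: "up (fst z mod m) x y" "lab x = snd z" "lab y = snd w"
          unfolding inter by metis
        then show ?thesis
          using vert[of x] vert[of y] up_l[OF xy(1)] up_V[OF xy(1)] step[OF xy(1)] 2(1) by simp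
      next
        case 3
        then obtain x y where xy: "up (fst w mod m) x y" "lab x = snd w" "lab y = snd z"
          unfolding inter by metis
        then show ?thesis
          using vert[of x] vert[of y] up_l[OF xy(1)] up_V[OF xy(1)] chain_sym[OF step[OF xy(1)]] 3(1)
          by simp
      qed
    qed
  qed
  have "layer_size F t = card {x \<in> V. l x = t}" if "t < m" for t
  proof -
    have "{a. intra F t a a} = lab ` {x \<in> V. l x = t}"
      using that unfolding intra by auto
    then show ?thesis unfolding layer_size_def using card_lab[of "{x \<in> V. l x = t}" t] by simp
  qed
  then have "(\<Sum>t<m. layer_size F t) = (\<Sum>t<m. card {x \<in> V. l x = t})" by simp
  also have "\<dots> = card V"
    using sum.group[of V "{..<m}" l "\<lambda>_. 1 :: nat"] finV l_lt by (simp add: image_subset_iff)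
  finally have "(\<Sum>t<m. layer_size F t) = card V" .
  moreover have "valid k g F" unfolding valid_iff using adm girth_geF by blast
  ultimately show ?thesis
    unfolding cyclic_def using mpos by (intro exI[of _ F]) (simp add: F_def)
qed

end

section \<open>Rooted graphs\<close>

definition gdist :: "('a \<Rightarrow> 'a \<Rightarrow> bool) \<Rightarrow> 'a \<Rightarrow> 'a \<Rightarrow> nat" where
  "gdist E x y = (LEAST n. (E ^^ n) x y)"

lemma gdist_walk: "E\<^sup>*\<^sup>* x y \<Longrightarrow> (E ^^ gdist E x y) x y"
  unfolding gdist_def rtranclp_power by (rule LeastI_ex)

lemma gdist_le: "(E ^^ n) x y \<Longrightarrow> gdist E x y \<le> n"
  unfolding gdist_def by (rule Least_le)

lemma gdist_refl: "gdist E x x = 0"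
  using gdist_le[of 0 E x x] by simp

lemma gdist_triangle: "E\<^sup>*\<^sup>* x y \<Longrightarrow> (E ^^ n) y z \<Longrightarrow> gdist E x z \<le> gdist E x y + n"
  by (rule gdist_le) (auto simp: relpowp_add intro: gdist_walk)

lemma gdist_step: "E\<^sup>*\<^sup>* x y \<Longrightarrow> E y z \<Longrightarrow> gdist E x z \<le> Suc (gdist E x y)"
  using gdist_triangle[of E x y 1 z] by (simp add: eq_OO)

lemma geodesic:
  assumes "E\<^sup>*\<^sup>* x y"
  shows "\<exists>p. p 0 = x \<and> p (gdist E x y) = y \<and> (\<forall>i<gdist E x y. E (p i) (p (Suc i))) \<and>
    (\<forall>i\<le>gdist E x y. gdist E x (p i) = i)"
proof -
  let ?n = "gdist E x y"
  obtain p where p: "p 0 = x" "p ?n = y" "\<And>i. i < ?n \<Longrightarrow> E (p i) (p (Suc i))"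
    using gdist_walk[OF assms] unfolding relpowp_fun_conv by blast
  have walk: "(E ^^ (j - i)) (p i) (p j)" if "i \<le> j" "j \<le> ?n" for i j
    unfolding relpowp_fun_conv
    by (rule exI[of _ "\<lambda>l. p (i + l)"]) (use p(3) that in auto)
  have "gdist E x (p i) = i" if "i \<le> ?n" for i
  proof (rule antisym)
    show "gdist E x (p i) \<le> i" using walk[of 0 i] that p(1) by (intro gdist_le) simp
    have "E\<^sup>*\<^sup>* x (p i)" using walk[of 0 i] that p(1) by (auto simp: rtranclp_power)
    from gdist_triangle[OF this walk[of i ?n]] show "i \<le> gdist E x (p i)" using that p(2) by simp
  qed
  then show ?thesis using p by blast
qed

text \<open>For a symmetric \<open>E\<close> this says that \<open>\<delta>\<close> is the distance from \<open>c\<close> and that \<open>V\<close> is connected.\<close>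

definition levels :: "'a set \<Rightarrow> ('a \<Rightarrow> 'a \<Rightarrow> bool) \<Rightarrow> 'a \<Rightarrow> ('a \<Rightarrow> nat) \<Rightarrow> bool" where
  "levels V E c \<delta> \<longleftrightarrow> \<delta> c = 0 \<and> (\<forall>x y. E x y \<longrightarrow> \<delta> x \<le> Suc (\<delta> y)) \<and>
     (\<forall>v\<in>V. v \<noteq> c \<longrightarrow> (\<exists>u\<in>V. E u v \<and> \<delta> v = Suc (\<delta> u)))"

lemma levels_gdist:
  assumes "ugraph V E" "\<And>v. v \<in> V \<Longrightarrow> E\<^sup>*\<^sup>* c v"
  shows "levels V E c (gdist E c)"
  unfolding levels_def
proof (intro conjI allI impI ballI)
  show "gdist E c c = 0" by (rule gdist_refl)
  show "gdist E c x \<le> Suc (gdist E c y)" if "E x y" for x y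
    using that assms by (intro gdist_step) (auto simp: ugraph_def)
  fix v assume v: "v \<in> V" "v \<noteq> c"
  obtain p where p: "p 0 = c" "p (gdist E c v) = v" "\<forall>i<gdist E c v. E (p i) (p (Suc i))"
    "\<forall>i\<le>gdist E c v. gdist E c (p i) = i" using geodesic[OF assms(2)[OF v(1)]] by blast
  then obtain n where n: "gdist E c v = Suc n" using v(2) by (metis not0_implies_Suc)
  then have "E (p n) v" "gdist E c (p n) = n" using p by auto
  then show "\<exists>u\<in>V. E u v \<and> gdist E c v = Suc (gdist E c u)"
    using n assms(1) by (auto simp: ugraph_def)
qed

lemma levels_walk:
  assumes "levels V E c \<delta>" "v \<in> V"
  shows "(E ^^ \<delta> v) c v"
  using assms(2)
proof (induction "\<delta> v" arbitrary: v)
  case 0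
  then have "v = c" using assms(1) unfolding levels_def by (metis old.nat.distinct(2))
  then show ?case using assms(1) by (simp add: levels_def)
next
  case (Suc n)
  then have "v \<noteq> c" using assms(1) by (auto simp: levels_def)
  then obtain u where u: "u \<in> V" "E u v" "\<delta> v = Suc (\<delta> u)"
    using assms(1) Suc.prems unfolding levels_def by blast
  then have "(E ^^ \<delta> u) c u" using Suc.hyps by simp
  then show ?case using u by auto
qed

text \<open>The degree of the root is left open, to be completed to \<open>k\<close> by gluing
  another rooted graph at the same vertex.\<close>

definition rooted :: "nat \<Rightarrow> nat \<Rightarrow> nat \<Rightarrow> 'a set \<Rightarrow> ('a \<Rightarrow> 'a \<Rightarrow> bool) \<Rightarrow> 'a \<Rightarrow> ('a \<Rightarrow> nat) \<Rightarrow> bool" where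
  "rooted k g s V E c \<delta> \<longleftrightarrow> ugraph V E \<and> girth_ge g E \<and> c \<in> V \<and> deg E c = s \<and>
     (\<forall>v\<in>V. v \<noteq> c \<longrightarrow> deg E v = k) \<and> levels V E c \<delta>"

lemma rootedD:
  assumes "rooted k g s V E c \<delta>"
  shows "ugraph V E" "girth_ge g E" "c \<in> V" "deg E c = s" "\<And>v. v \<in> V \<Longrightarrow> v \<noteq> c \<Longrightarrow> deg E v = k"
    "levels V E c \<delta>"
  using assms by (simp_all add: rooted_def)

text \<open>The witness that a girth of at least \<open>g\<close> is exactly \<open>g\<close>. The
  cycle avoids the root, so it survives the subdivision of edges there.\<close>

definition cycle_off :: "nat \<Rightarrow> ('a \<Rightarrow> 'a \<Rightarrow> bool) \<Rightarrow> 'a \<Rightarrow> bool" where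
  "cycle_off g E r \<longleftrightarrow> (\<exists>p. inj_on p {..<g} \<and> (\<forall>i<g. p i \<noteq> r \<and> E (p i) (p (Suc i mod g))))"

text \<open>Filling up degrees gives no control over connectedness; the component of the root
  inherits degrees and girth.\<close>

lemma component_rooted:
  assumes "ugraph V E" "girth_ge g E" "c \<in> V" "deg E c = s" "\<And>v. v \<in> V \<Longrightarrow> v \<noteq> c \<Longrightarrow> deg E v = k"
  defines "E' \<equiv> \<lambda>x y. E x y \<and> E\<^sup>*\<^sup>* c x" and "V' \<equiv> {v. E\<^sup>*\<^sup>* c v}"
  shows "rooted k g s V' E' c (gdist E' c)" "V' \<subseteq> V"
proof -
  have E_in: "E x y \<Longrightarrow> x \<in> V \<and> y \<in> V \<and> x \<noteq> y \<and> E y x" for x y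
    using assms(1) by (auto simp: ugraph_def)
  show sub: "V' \<subseteq> V"
  proof
    fix v assume "v \<in> V'"
    then have "E\<^sup>*\<^sup>* c v" by (simp add: V'_def)
    then show "v \<in> V" by (cases rule: rtranclp.cases) (use assms(3) E_in in auto)
  qed
  have G: "ugraph V' E'"
    unfolding ugraph_def
  proof (intro conjI allI impI)
    show "finite V'" using sub assms(1) by (auto simp: ugraph_def finite_subset)
    fix x y assume "E' x y"
    then have "E x y" "E\<^sup>*\<^sup>* c x" by (auto simp: E'_def)
    then show "x \<in> V'" "y \<in> V'" "x \<noteq> y" "E' y x"
      using E_in by (auto simp: V'_def E'_def)
  qed
  have deg: "deg E' v = deg E v" if "v \<in> V'" for v
    using that by (simp add: deg_def E'_def V'_def)
  have c: "c \<in> V'" by (simp add: V'_def)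
  have reach: "E'\<^sup>*\<^sup>* c v" if "v \<in> V'" for v
  proof -
    have "E\<^sup>*\<^sup>* c v" using that by (simp add: V'_def)
    then show ?thesis
    proof (induction rule: rtranclp_induct)
      case (step y z)
      then have "E' y z" by (simp add: E'_def)
      then show ?case using step.IH by (rule rtranclp.rtrancl_into_rtrancl[rotated])
    qed simp
  qed
  show "rooted k g s V' E' c (gdist E' c)"
    unfolding rooted_def
  proof (intro conjI ballI impI)
    show "girth_ge g E'" by (rule girth_ge_mono[OF assms(2)]) (simp add: E'_def)
    show "levels V' E' c (gdist E' c)" by (rule levels_gdist[OF G reach])
  qed (use G c deg assms(4,5) sub in auto)
qed

subsection \<open>Gluing\<close>

lemma fresh_copy:
  fixes A :: "'a set" and V :: "nat set"
  assumes inf: "infinite (UNIV :: 'a set)" and A: "finite A" "r \<in> A"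
    and R: "rooted k g s V E c \<delta>"
  shows "\<exists>L F \<epsilon>. rooted k g s L F r \<epsilon> \<and> L \<inter> A = {r} \<and> \<epsilon> ` L = \<delta> ` V \<and> card L = card V \<and>
    (cycle_off g E c \<longrightarrow> cycle_off g F r)"
proof -
  note RD = rootedD[OF R]
  obtain f0 :: "nat \<Rightarrow> 'a" where f0: "inj f0" "range f0 \<inter> A = {}"
    using fresh_embedding[OF inf A(1)] .
  define f where "f = f0(c := r)"
  have "f0 y \<noteq> r" for y using f0(2) A(2) by auto
  then have inj: "inj f"
    using f0(1) unfolding f_def inj_def by (metis fun_upd_apply)
  then have injV: "inj_on f V" by (rule inj_on_subset) simp
  let ?L = "f ` V" and ?F = "relabel f E" and ?\<epsilon> = "\<lambda>x. \<delta> (inv f x)"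
  have e: "?\<epsilon> (f x) = \<delta> x" for x using inj by simp
  have fc: "f c = r" by (simp add: f_def)
  have "levels ?L ?F r ?\<epsilon>"
    unfolding levels_def
  proof (intro conjI allI impI ballI)
    show "?\<epsilon> r = 0" using e[of c] fc RD(6) by (simp add: levels_def)
    show "?\<epsilon> x \<le> Suc (?\<epsilon> y)" if "?F x y" for x y
      using that RD(6) e by (auto simp: relabel_def levels_def)
    fix v assume "v \<in> ?L" "v \<noteq> r"
    then obtain w where w: "w \<in> V" "v = f w" "w \<noteq> c" using fc by auto
    then obtain u where "u \<in> V" "E u w" "\<delta> w = Suc (\<delta> u)" using RD(6) by (auto simp: levels_def)
    then show "\<exists>u\<in>?L. ?F u v \<and> ?\<epsilon> v = Suc (?\<epsilon> u)"
      using w e by (auto simp: relabel_def)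
  qed
  moreover have "deg ?F v = k" if "v \<in> ?L" "v \<noteq> r" for v
    using that fc relabel_deg[OF RD(1) injV] RD(5) by auto
  moreover have "deg ?F r = s" using relabel_deg[OF RD(1) injV RD(3)] fc RD(4) by simp
  ultimately have "rooted k g s ?L ?F r ?\<epsilon>"
    using relabel_graph[OF RD(1) injV] relabel_girth_ge[OF RD(1) injV RD(2)] RD(3) fc
    by (auto simp: rooted_def)
  moreover have "?L \<inter> A = {r}"
    using RD(3) A(2) f0(2) by (auto simp: f_def split: if_splits)
  moreover have "?\<epsilon> ` ?L = \<delta> ` V" using e by (simp add: image_image)
  moreover have "card ?L = card V" using injV by (rule card_image)
  moreover have "cycle_off g ?F r" if "cycle_off g E c"
  proof -
    from that obtain p where p: "inj_on p {..<g}" "\<forall>i<g. p i \<noteq> c \<and> E (p i) (p (Suc i mod g))"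
      by (auto simp: cycle_off_def)
    have "inj_on (f \<circ> p) {..<g}" using p(1) inj by (auto intro: comp_inj_on inj_on_subset)
    moreover have "f (p i) \<noteq> r" if "i < g" for i using p(2) that fc inj by (metis injD)
    ultimately show ?thesis
      unfolding cycle_off_def using p(2) by (intro exI[of _ "f \<circ> p"]) (auto simp: relabel_def)
  qed
  ultimately show ?thesis by blast
qed

text \<open>Every way from \<open>c\<close> into the attached part leads through \<open>r\<close>,
  so the depths there add to the depth of \<open>r\<close>.\<close>

lemma wedge_levels:
  assumes "ugraph V E" "ugraph L F" "V \<inter> L = {r}" "levels V E c \<delta>" "levels L F r \<epsilon>"
  shows "levels (V \<union> L) (wedge E F) c (\<lambda>x. if x \<in> V then \<delta> x else \<delta> r + \<epsilon> x)"
    (is "levels _ _ _ ?\<delta>")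
  unfolding levels_def
proof (intro conjI allI impI ballI)
  have L: "?\<delta> x = \<delta> r + \<epsilon> x" if "x \<in> L" for x
  proof (cases "x \<in> V")
    case True
    then have "x = r" using that assms(3) by auto
    then show ?thesis using True assms(5) by (simp add: levels_def)
  qed simp
  have r: "r \<in> V" using assms(3) by auto
  \<comment> \<open>That \<open>c\<close> lies in \<open>V\<close> has to be derived, from the walk
    that joins it to \<open>r\<close>.\<close>
  show "?\<delta> c = 0"
  proof (cases "c \<in> V")
    case False
    have "(E ^^ \<delta> r) c r" by (rule levels_walk[OF assms(4) r])
    then have "c = r \<or> (\<exists>y. E c y)" by (metis relpowp_E2 relpowp_0_E)
    then show ?thesis using False r assms(1) by (auto simp: ugraph_def)
  qed (use assms(4) in \<open>simp add: levels_def\<close>)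
  show "?\<delta> x \<le> Suc (?\<delta> y)" if "wedge E F x y" for x y
  proof -
    from that consider "E x y" | "F x y" by (auto simp: wedge_def)
    then show ?thesis
    proof cases
      case 1
      then show ?thesis using assms(1,4) by (auto simp: ugraph_def levels_def)
    next
      case 2
      then have "x \<in> L" "y \<in> L" "\<epsilon> x \<le> Suc (\<epsilon> y)" using assms(2,5) by (auto simp: ugraph_def levels_def)
      then show ?thesis using L by simp
    qed
  qed
  fix v assume v: "v \<in> V \<union> L" "v \<noteq> c"
  show "\<exists>u\<in>V \<union> L. wedge E F u v \<and> ?\<delta> v = Suc (?\<delta> u)"
  proof (cases "v \<in> V")
    case True
    then obtain u where "u \<in> V" "E u v" "\<delta> v = Suc (\<delta> u)"
      using assms(4) v by (auto simp: levels_def)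
    then show ?thesis using True by (auto simp: wedge_def)
  next
    case False
    then have "v \<in> L" "v \<noteq> r" using v r by auto
    then obtain u where u: "u \<in> L" "F u v" "\<epsilon> v = Suc (\<epsilon> u)"
      using assms(5) by (auto simp: levels_def)
    have "?\<delta> v = Suc (?\<delta> u)" using L[OF \<open>v \<in> L\<close>] L[OF u(1)] u(3) by simp
    then show ?thesis using u by (auto simp: wedge_def)
  qed
qed

subsection \<open>Rooted graphs of prescribed depth\<close>

definition subdiv :: "('a \<Rightarrow> 'a \<Rightarrow> bool) \<Rightarrow> 'a \<Rightarrow> 'a \<Rightarrow> 'a \<Rightarrow> 'a \<Rightarrow> 'a \<Rightarrow> bool" where
  "subdiv E a b w x y \<longleftrightarrow> avoid E a b x y \<or> {x, y} = {a, w} \<or> {x, y} = {w, b}"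

locale subdivision =
  fixes V :: "'a set" and E a b w g
  assumes G: "ugraph V E" and ab: "E a b" and w: "w \<notin> V" and girth_geE: "girth_ge g E"
begin

lemma E_in: "E x y \<Longrightarrow> x \<in> V \<and> y \<in> V \<and> x \<noteq> y \<and> E y x \<and> x \<noteq> w \<and> y \<noteq> w"
  using G w by (auto simp: ugraph_def)

lemma sub_graph: "ugraph (insert w V) (subdiv E a b w)"
  unfolding ugraph_def
proof (intro conjI allI impI)
  show "finite (insert w V)" using G by (simp add: ugraph_def)
  fix x y assume "subdiv E a b w x y"
  then consider "avoid E a b x y" | "{x, y} = {a, w}" | "{x, y} = {w, b}" by (auto simp: subdiv_def)
  then have "x \<in> insert w V \<and> y \<in> insert w V \<and> x \<noteq> y \<and> subdiv E a b w y x"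
  proof cases
    case 1
    then show ?thesis using E_in[of x y] by (auto simp: subdiv_def avoid_def insert_commute)
  next
    case 2
    then have "{y, x} = {a, w}" by (simp add: insert_commute)
    with 2 show ?thesis using E_in[OF ab] by (auto simp: subdiv_def doubleton_eq_iff)
  next
    case 3
    then have "{y, x} = {w, b}" by (simp add: insert_commute)
    with 3 show ?thesis using E_in[OF ab] by (auto simp: subdiv_def doubleton_eq_iff)
  qed
  then show "x \<in> insert w V" "y \<in> insert w V" "x \<noteq> y" "subdiv E a b w y x" by simp_all
qed

lemma sub_deg_new: "deg (subdiv E a b w) w = 2"
proof -
  have "{y. subdiv E a b w w y} = {a, b}"
    using E_in[OF ab] E_in[of w] by (auto simp: subdiv_def avoid_def doubleton_eq_iff)
  then show ?thesis using E_in[OF ab] by (simp add: deg_def)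
qed

lemma sub_deg_old:
  assumes "x \<in> V"
  shows "deg (subdiv E a b w) x = deg E x"
proof -
  have abw: "a \<noteq> b" "a \<noteq> w" "b \<noteq> w" "E b a" using E_in[OF ab] by auto
  have xw: "x \<noteq> w" using assms w by auto
  have fin: "finite {y. E x y}" using G by (rule graph_nbrs)
  have "w \<notin> {y. E x y}" using E_in[of x w] by auto
  then have sw: "card (insert w ({y. E x y} - {z})) = card {y. E x y}" if "E x z" for z
    using that fin card_Suc_Diff1[of "{y. E x y}" z] by (simp del: card_Diff_insert)
  have "{y. subdiv E a b w x y} = (if x = a then insert w ({y. E x y} - {b})
      else if x = b then insert w ({y. E x y} - {a}) else {y. E x y})"
    using abw xw by (auto simp: subdiv_def avoid_def doubleton_eq_iff)
  then show ?thesis using sw[of b] sw[of a] ab abw by (auto simp: deg_def)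
qed

text \<open>Subdividing only lengthens cycles. In each case \<open>w\<close> can take the value of
  one end of the subdivided edge.\<close>

lemma sub_girth_ge: "girth_ge g (subdiv E a b w)"
proof (rule girth_geI)
  show "subdiv E a b w y x" if "subdiv E a b w x y" for x y using sub_graph that by (rule graph_sym)
  have abw: "a \<noteq> b" "a \<noteq> w" "b \<noteq> w" "E b a" using E_in[OF ab] by auto
  have potential: "potential g (subdiv E a b w) s t (\<phi>(w := q))"
    if "\<And>x y. avoid E a b x y \<Longrightarrow> {x, y} \<noteq> {s, t} \<Longrightarrow> \<phi> x \<le> \<phi> y + 1"
      "{a, w} \<noteq> {s, t} \<Longrightarrow> \<bar>\<phi> a - q\<bar> \<le> 1" "{w, b} \<noteq> {s, t} \<Longrightarrow> \<bar>\<phi> b - q\<bar> \<le> 1"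
      "(\<phi>(w := q)) s + int g \<le> (\<phi>(w := q)) t + 1" for \<phi> q s t
  proof (rule potentialI)
    fix x y assume "subdiv E a b w x y" and ne: "{x, y} \<noteq> {s, t}"
    then consider "avoid E a b x y" | "{x, y} = {a, w}" | "{x, y} = {w, b}" by (auto simp: subdiv_def)
    then show "(\<phi>(w := q)) x \<le> (\<phi>(w := q)) y + 1"
    proof cases
      case 1
      then show ?thesis using that(1)[OF 1 ne] E_in[of x y] by (simp add: avoid_def)
    next
      case 2
      then show ?thesis using that(2) ne abw by (auto simp: doubleton_eq_iff)
    next
      case 3
      then show ?thesis using that(3) ne abw by (auto simp: doubleton_eq_iff)
    qed
  qed (rule that(4))
  obtain \<chi> where \<chi>: "potential g E a b \<chi>" using girth_geE ab by (auto simp: girth_ge_def)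
  have \<chi>_le: "\<chi> x \<le> \<chi> y + 1" if "avoid E a b x y" for x y
    using that potential_le[OF \<chi>] by (simp add: avoid_def)
  fix s t assume "subdiv E a b w s t"
  then consider "avoid E a b s t" | "s = a \<and> t = w \<or> s = w \<and> t = a" | "s = w \<and> t = b \<or> s = b \<and> t = w"
    by (auto simp: subdiv_def doubleton_eq_iff)
  then show "(\<exists>\<phi>. potential g (subdiv E a b w) s t \<phi>) \<or> (\<exists>\<phi>. potential g (subdiv E a b w) t s \<phi>)"
  proof cases
    case 1
    then have st: "E s t" "{s, t} \<noteq> {a, b}" by (auto simp: avoid_def)
    then obtain \<phi> where \<phi>: "potential g E s t \<phi>" using girth_geE unfolding girth_ge_def by blast
    have ne: "{a, b} \<noteq> {s, t}" "{b, a} \<noteq> {s, t}" using st(2) by (simp_all add: insert_commute)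
    have "\<phi> a \<le> \<phi> b + 1" "\<phi> b \<le> \<phi> a + 1"
      using potential_le[OF \<phi> ab ne(1)] potential_le[OF \<phi> abw(4) ne(2)] by auto
    then have "potential g (subdiv E a b w) s t (\<phi>(w := \<phi> a))"
      using E_in[OF st(1)] \<phi> potential_le[OF \<phi>] by (intro potential) (auto simp: potential_def avoid_def)
    then show ?thesis by blast
  next
    case 2
    have "potential g (subdiv E a b w) a w (\<chi>(w := \<chi> b))"
      using \<chi> \<chi>_le abw by (intro potential) (auto simp: potential_def)
    then show ?thesis using 2 by blast
  next
    case 3
    have "potential g (subdiv E a b w) w b (\<chi>(w := \<chi> a))"
      using \<chi> \<chi>_le abw by (intro potential) (auto simp: potential_def)
    then show ?thesis using 3 by blast
  qed
qed

end

lemma deg2_nbrs: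
  assumes "deg E c = 2"
  obtains a b where "a \<noteq> b" "{y. E c y} = {a, b}"
  using assms unfolding deg_def card_2_iff by blast

text \<open>Root degree 2 complements the root degree \<open>k - 2\<close> of the long part. The
  depth \<open>j\<close> is the free parameter that adjusts the diameter exactly.\<close>

definition tail :: "nat \<Rightarrow> nat \<Rightarrow> nat \<Rightarrow> nat set \<Rightarrow> (nat \<Rightarrow> nat \<Rightarrow> bool) \<Rightarrow> nat \<Rightarrow> (nat \<Rightarrow> nat) \<Rightarrow> bool" where
  "tail k g j V E c \<delta> \<longleftrightarrow> rooted k g 2 V E c \<delta> \<and> Max (\<delta> ` V) = j \<and> cycle_off g E c"

text \<open>Hides the construction of the glued graph behind the data that \<open>tail_step\<close>
  uses; \<open>D\<close> is the set of depths in the attached piece.\<close>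

definition attachment where
  "attachment k g s r c D V E \<delta> V' E' \<delta>' \<longleftrightarrow>
    ugraph V' E' \<and> girth_ge g E' \<and> levels V' E' c \<delta>' \<and> V \<subseteq> V' \<and>
    (\<forall>x\<in>V. x \<noteq> r \<longrightarrow> deg E' x = deg E x) \<and> deg E' r = deg E r + s \<and>
    (\<forall>x\<in>V'-V. deg E' x = k) \<and> (\<forall>x\<in>V. \<delta>' x = \<delta> x) \<and>
    \<delta>' ` V' = \<delta> ` V \<union> (\<lambda>i. \<delta> r + i) ` D \<and> (\<forall>x y. E x y \<longrightarrow> E' x y)"

lemma attachmentD:
  assumes "attachment k g s r c D V E \<delta> V' E' \<delta>'"
  shows "ugraph V' E'" "girth_ge g E'" "levels V' E' c \<delta>'" "V \<subseteq> V'"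
    "\<And>x. x \<in> V \<Longrightarrow> x \<noteq> r \<Longrightarrow> deg E' x = deg E x" "deg E' r = deg E r + s"
    "\<And>x. x \<in> V' \<Longrightarrow> x \<notin> V \<Longrightarrow> deg E' x = k" "\<And>x. x \<in> V \<Longrightarrow> \<delta>' x = \<delta> x"
    "\<delta>' ` V' = \<delta> ` V \<union> (\<lambda>i. \<delta> r + i) ` D" "\<And>x y. E x y \<Longrightarrow> E' x y"
  using assms unfolding attachment_def by simp_all

lemma wedge_copy:
  fixes V :: "'a set"
  assumes inf: "infinite (UNIV :: 'a set)"
    and V: "ugraph V E" "girth_ge g E" "levels V E c \<delta>" "r \<in> V" "r \<noteq> c"
    and R: "rooted k g s (VR :: nat set) ER cR \<delta>R"
  shows "\<exists>V' E' \<delta>'. attachment k g s r c (\<delta>R ` VR) V E \<delta> V' E' \<delta>'"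
proof -
  obtain L F \<epsilon> where L: "rooted k g s L F r \<epsilon>" "L \<inter> V = {r}" "\<epsilon> ` L = \<delta>R ` VR"
    using fresh_copy[OF inf graph_finite[OF V(1)] V(4) R] by blast
  note LD = rootedD[OF L(1)]
  have int: "V \<inter> L = {r}" "V \<inter> L \<subseteq> {r}" using L(2) by auto
  let ?\<delta> = "\<lambda>x. if x \<in> V then \<delta> x else \<delta> r + \<epsilon> x"
  have e: "?\<delta> x = \<delta> r + \<epsilon> x" if "x \<in> L" for x
  proof (cases "x \<in> V")
    case True
    then have "x = r" using that int by auto
    then show ?thesis using True LD(6) by (simp add: levels_def)
  qed simp
  have "?\<delta> ` (V \<union> L) = ?\<delta> ` V \<union> ?\<delta> ` L" by (rule image_Un)
  also have "?\<delta> ` V = \<delta> ` V" by simp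
  also have "?\<delta> ` L = (\<lambda>x. \<delta> r + \<epsilon> x) ` L" using e by (rule image_cong[OF refl])
  also have "\<dots> = (\<lambda>i. \<delta> r + i) ` (\<delta>R ` VR)" unfolding L(3)[symmetric] image_image ..
  finally have im: "?\<delta> ` (V \<union> L) = \<delta> ` V \<union> (\<lambda>i. \<delta> r + i) ` (\<delta>R ` VR)" .
  have d1: "deg (wedge E F) x = deg E x" if "x \<in> V" "x \<noteq> r" for x
    using that int by (intro wedge_deg1[OF LD(1)]) auto
  have d2: "deg (wedge E F) r = deg E r + s"
    using wedge_deg_root[OF V(1) LD(1) int(2)] LD(4) by simp
  have d3: "deg (wedge E F) x = k" if "x \<in> (V \<union> L) - V" for x
    using that wedge_deg2[OF V(1), of x] LD(5)[of x] V(4) by auto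
  have "attachment k g s r c (\<delta>R ` VR) V E \<delta> (V \<union> L) (wedge E F) ?\<delta>"
    unfolding attachment_def
  proof (intro conjI ballI impI allI)
    show "levels (V \<union> L) (wedge E F) c ?\<delta>" by (rule wedge_levels[OF V(1) LD(1) int(1) V(3) LD(6)])
    show "ugraph (V \<union> L) (wedge E F)" by (rule wedge_graph[OF V(1) LD(1)])
    show "girth_ge g (wedge E F)" by (rule wedge_girth_ge[OF V(1) LD(1) int(2) V(2) LD(2)])
  qed (use d1 d2 d3 im in \<open>auto simp: wedge_def\<close>)
  then show ?thesis by blast
qed

lemma cycle_off_mono: "cycle_off g E r \<Longrightarrow> (\<And>x y. E x y \<Longrightarrow> x \<noteq> r \<Longrightarrow> y \<noteq> r \<Longrightarrow> E' x y) \<Longrightarrow> g > 0 \<Longrightarrow> cycle_off g E' r"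
  unfolding cycle_off_def by (meson mod_less_divisor)

text \<open>Subdividing the two edges at the root pushes everything else one level down. The two new
  vertices have degree 2, and each receives a piece with root degree \<open>k - 2\<close>. Once
  \<open>j\<close> is at least the depth of this piece, the depth grows by exactly 1.\<close>

lemma tail_step:
  assumes T: "tail k g j V E c \<delta>" and R: "rooted k g (k - 2) (VR :: nat set) ER cR \<delta>R" and k: "k \<ge> 3" and g: "g \<ge> 3"
  shows "\<exists>V' E' \<delta>'. tail k g (max (Suc j) (Suc (Max (\<delta>R ` VR)))) V' E' c \<delta>'"
proof -
  have rt: "rooted k g 2 V E c \<delta>" and j: "Max (\<delta> ` V) = j" and cyc: "cycle_off g E c"
    using T by (auto simp: tail_def)
  note D = rootedD[OF rt]
  have finV: "finite V" using D(1) by (rule graph_finite)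
  obtain a b where ab: "a \<noteq> b" "{y. E c y} = {a, b}" using D(4) by (rule deg2_nbrs)
  then have Ec: "E c y \<longleftrightarrow> y = a \<or> y = b" for y by blast
  have in_V: "x \<in> V \<and> y \<in> V \<and> x \<noteq> y \<and> E y x" if "E x y" for x y
    using that D(1) by (auto simp: ugraph_def)
  obtain u where u: "u \<notin> V" using ex_new_if_finite[OF infinite_UNIV_nat finV] ..
  obtain w where w: "w \<notin> insert u V" using ex_new_if_finite[OF infinite_UNIV_nat] finV by blast
  have cab: "c \<noteq> a" "c \<noteq> b" "a \<in> V" "b \<in> V" "E a c" "E b c" using Ec in_V by blast+
  have uw: "u \<noteq> c" "u \<noteq> a" "u \<noteq> b" "w \<noteq> c" "w \<noteq> a" "w \<noteq> b" "u \<noteq> w"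
    using u w cab D(3) by auto
  interpret s1: subdivision V E c a u g
    by unfold_locales (use D Ec u in auto)
  let ?E1 = "subdiv E c a u"
  have cb: "?E1 c b" using Ec[of b] ab uw cab by (auto simp: subdiv_def avoid_def doubleton_eq_iff)
  interpret s2: subdivision "insert u V" ?E1 c b w g
    by unfold_locales (use s1.sub_graph s1.sub_girth_ge cb w in auto)
  let ?E2 = "subdiv ?E1 c b w" and ?V2 = "insert w (insert u V)"
  have E2: "?E2 x y \<longleftrightarrow> (E x y \<and> x \<noteq> c \<and> y \<noteq> c) \<or> {x, y} \<in> {{c, u}, {u, a}, {c, w}, {w, b}}" for x y
  proof -
    have "E x y \<and> {x, y} \<noteq> {c, a} \<and> {x, y} \<noteq> {c, b} \<longleftrightarrow> E x y \<and> x \<noteq> c \<and> y \<noteq> c"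
    proof
      assume *: "E x y \<and> {x, y} \<noteq> {c, a} \<and> {x, y} \<noteq> {c, b}"
      then have "x \<noteq> c" using Ec[of y] by auto
      moreover have "y \<noteq> c" using * Ec[of x] in_V[of x y] by (auto simp: insert_commute)
      ultimately show "E x y \<and> x \<noteq> c \<and> y \<noteq> c" using * by blast
    qed (auto simp: doubleton_eq_iff)
    moreover have "{c, u} \<noteq> {c, b}" "{u, a} \<noteq> {c, b}"
      using uw cab by (auto simp: doubleton_eq_iff)
    ultimately show ?thesis
      unfolding subdiv_def avoid_def insert_iff empty_iff by metis
  qed
  define \<delta>2 where "\<delta>2 x = (if x = c then 0 else if x = u \<or> x = w then 1 else Suc (\<delta> x))" for x
  have lev: "levels ?V2 ?E2 c \<delta>2"
    unfolding levels_def
  proof (intro conjI allI impI ballI)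
    show "\<delta>2 c = 0" by (simp add: \<delta>2_def)
    have dab: "\<delta> a \<le> 1" "\<delta> b \<le> 1"
      using D(6) cab(5,6) unfolding levels_def by fastforce+
    show "\<delta>2 x \<le> Suc (\<delta>2 y)" if "?E2 x y" for x y
      using that unfolding E2
    proof (elim disjE)
      assume "E x y \<and> x \<noteq> c \<and> y \<noteq> c"
      moreover from this have "x \<in> V" "y \<in> V" "\<delta> x \<le> Suc (\<delta> y)"
        using in_V D(6) by (auto simp: levels_def)
      ultimately show ?thesis using u w by (auto simp: \<delta>2_def)
    qed (use uw dab cab in \<open>auto simp: \<delta>2_def doubleton_eq_iff\<close>)
    fix v assume v: "v \<in> ?V2" "v \<noteq> c"
    show "\<exists>x\<in>?V2. ?E2 x v \<and> \<delta>2 v = Suc (\<delta>2 x)"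
    proof (cases "v = u \<or> v = w")
      case True
      then show ?thesis using D(3) uw unfolding E2 by (intro bexI[of _ c]) (auto simp: \<delta>2_def)
    next
      case False
      then have "v \<in> V" using v by auto
      then obtain x where x: "x \<in> V" "E x v" "\<delta> v = Suc (\<delta> x)"
        using D(6) v by (auto simp: levels_def)
      show ?thesis
      proof (cases "x = c")
        case True
        then have dv: "\<delta> v = 1" and vab: "v = a \<or> v = b" using x Ec D(6) by (auto simp: levels_def)
        have "\<delta>2 v = Suc (\<delta>2 u)" "\<delta>2 v = Suc (\<delta>2 w)"
          using dv v(2) False uw by (simp_all add: \<delta>2_def)
        moreover have "?E2 u a" "?E2 w b" unfolding E2 by simp_all
        ultimately show ?thesis using vab by (metis insertI1 insertI2)
      next
        case xc: False
        have "x \<noteq> u" "x \<noteq> w" using x(1) u w by auto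
        then have "\<delta>2 v = Suc (\<delta>2 x)" using x(3) v(2) False xc by (simp add: \<delta>2_def)
        moreover have "?E2 x v" using x(2) v(2) xc unfolding E2 by blast
        ultimately show ?thesis using x(1) by blast
      qed
    qed
  qed
  have uV2: "u \<in> ?V2" by simp
  obtain V3 E3 \<delta>3 where att3: "attachment k g (k - 2) u c (\<delta>R ` VR) ?V2 ?E2 \<delta>2 V3 E3 \<delta>3"
    using wedge_copy[OF infinite_UNIV_nat s2.sub_graph s2.sub_girth_ge lev uV2 uw(1) R] by blast
  note A3 = attachmentD[OF att3]
  have V3: "w \<in> V3" "u \<in> V3" "V \<subseteq> V3" using A3(4) by auto
  obtain V4 E4 \<delta>4 where att4: "attachment k g (k - 2) w c (\<delta>R ` VR) V3 E3 \<delta>3 V4 E4 \<delta>4"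
    using wedge_copy[OF infinite_UNIV_nat A3(1-3) V3(1) uw(4) R] by blast
  note A4 = attachmentD[OF att4]
  have d2: "deg ?E2 x = deg E x" if "x \<in> V" for x
    using that s2.sub_deg_old[of x] s1.sub_deg_old[of x] by simp
  have du: "deg ?E2 u = 2" using s2.sub_deg_old[of u] s1.sub_deg_new by simp
  have dw: "deg ?E2 w = 2" by (rule s2.sub_deg_new)
  have c4: "c \<in> V4" using D(3) V3(3) A4(4) by blast
  have "deg E4 c = 2"
  proof -
    have "deg E4 c = deg E3 c" using A4(5)[of c] D(3) V3(3) uw by blast
    also have "\<dots> = deg ?E2 c" using A3(5)[of c] D(3) uw by blast
    finally show ?thesis using d2[OF D(3)] D(4) by simp
  qed
  moreover have "deg E4 v = k" if v: "v \<in> V4" "v \<noteq> c" for v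
  proof -
    consider "v = u" | "v = w" | "v \<in> V" "v \<noteq> u" "v \<noteq> w" | "v \<in> V3" "v \<notin> ?V2" | "v \<notin> V3"
      by blast
    then show ?thesis
    proof cases
      case 1
      have "deg E4 u = deg E3 u" using A4(5)[OF V3(2)] uw by simp
      then show ?thesis using 1 A3(6) du k by simp
    next
      case 2
      have "deg E3 w = deg ?E2 w" using A3(5)[of w] uw by simp
      then show ?thesis using 2 A4(6) dw k by simp
    next
      case 3
      have "deg E4 v = deg E3 v" using A4(5)[of v] V3(3) 3 by blast
      also have "\<dots> = deg ?E2 v" using A3(5)[of v] 3 by blast
      finally show ?thesis using d2[OF 3(1)] D(5)[OF 3(1) v(2)] by simp
    next
      case 4
      have "deg E4 v = deg E3 v" using A4(5)[OF 4(1)] 4(2) by blast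
      then show ?thesis using A3(7)[OF 4] by simp
    next
      case 5
      then show ?thesis by (rule A4(7)[OF v(1)])
    qed
  qed
  ultimately have "rooted k g 2 V4 E4 c \<delta>4" using A4(1-3) c4 by (simp add: rooted_def)
  moreover have "cycle_off g E4 c"
  proof (rule cycle_off_mono[OF cyc])
    show "E4 x y" if "E x y" "x \<noteq> c" "y \<noteq> c" for x y
      using that E2[of x y] A3(10) A4(10) by blast
  qed (use g in simp)
  moreover have "Max (\<delta>4 ` V4) = max (Suc j) (Suc (Max (\<delta>R ` VR)))"
  proof -
    note RD = rootedD[OF R]
    have finR: "finite (\<delta>R ` VR)" "\<delta>R ` VR \<noteq> {}" using RD(1,3) graph_finite by auto
    have "\<delta>3 w = 1" "\<delta>2 u = 1" using A3(8)[of w] uw by (simp_all add: \<delta>2_def)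
    then have im: "\<delta>4 ` V4 = \<delta>2 ` ?V2 \<union> Suc ` (\<delta>R ` VR)"
      unfolding A3(9) A4(9) by (simp add: Un_assoc)
    have R1: "Max (Suc ` (\<delta>R ` VR)) = Suc (Max (\<delta>R ` VR))"
      using finR by (simp add: mono_Max_commute[of Suc] mono_Suc)
    have j1: "j \<ge> 1"
    proof -
      have "\<delta> a \<noteq> 0"
      proof
        assume "\<delta> a = 0"
        then show False using D(6) cab by (auto simp: levels_def)
      qed
      moreover have "\<delta> a \<le> j" unfolding j[symmetric] using cab finV by simp
      ultimately show ?thesis by simp
    qed
    have "Max (\<delta>2 ` ?V2) = Suc j"
    proof (rule Max_eqI)
      show "finite (\<delta>2 ` ?V2)" using finV by simp
      show "y \<le> Suc j" if "y \<in> \<delta>2 ` ?V2" for y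
        using that finV j j1 by (auto simp: \<delta>2_def)
      have "j \<in> \<delta> ` V" using Max_in[of "\<delta> ` V"] j finV D(3) by auto
      then obtain v where v: "v \<in> V" "\<delta> v = j" by auto
      then have "v \<noteq> c" using j1 D(6) by (auto simp: levels_def)
      then have "\<delta>2 v = Suc j" using v u w by (auto simp: \<delta>2_def)
      then show "Suc j \<in> \<delta>2 ` ?V2" using v(1) by (metis imageI insertI2)
    qed
    then show ?thesis
      unfolding im using finV finR R1 by (subst Max_Un) auto
  qed
  ultimately show ?thesis unfolding tail_def by blast
qed

definition cyc_next :: "nat \<Rightarrow> nat \<Rightarrow> nat" where
  "cyc_next g x = (if Suc x = g then 0 else Suc x)"

definition cyc_graph :: "nat \<Rightarrow> nat \<Rightarrow> nat \<Rightarrow> bool" where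
  "cyc_graph g x y \<longleftrightarrow> x < g \<and> y < g \<and> (y = cyc_next g x \<or> x = cyc_next g y)"

lemma cyc_graph_graph: "g \<ge> 3 \<Longrightarrow> ugraph {..<g} (cyc_graph g)"
  by (auto simp: ugraph_def cyc_graph_def cyc_next_def split: if_splits)

lemma cyc_graph_deg:
  assumes "g \<ge> 3" "v < g"
  shows "deg (cyc_graph g) v = 2"
proof -
  have "{w. cyc_graph g v w} = {cyc_next g v, if v = 0 then g - 1 else v - 1}"
    using assms by (auto simp: cyc_graph_def cyc_next_def split: if_splits)
  moreover have "cyc_next g v \<noteq> (if v = 0 then g - 1 else v - 1)"
    using assms by (auto simp: cyc_next_def)
  ultimately show ?thesis by (simp add: deg_def)
qed

lemma cyc_graph_girth_ge:
  assumes "g \<ge> 3"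
  shows "girth_ge g (cyc_graph g)"
proof (rule girth_geI)
  show "cyc_graph g y x" if "cyc_graph g x y" for x y using that by (auto simp: cyc_graph_def)
  have potential: "\<exists>\<phi>. potential g (cyc_graph g) u v \<phi>" if u: "u < g" and v: "v = cyc_next g u" for u v
  proof -
    define \<psi> where "\<psi> x = (if x \<ge> v then int x - int v else int x + int g - int v)" for x
    have uv: "\<psi> v = 0" "\<psi> u = int g - 1"
      using u assms by (auto simp: \<psi>_def v cyc_next_def)
    have step: "\<psi> (cyc_next g x) = \<psi> x + 1" if "x < g" "x \<noteq> u" for x
    proof (cases "Suc x = g")
      case True
      then have "v \<noteq> 0" using that u by (auto simp: v cyc_next_def split: if_splits)
      moreover have "v < g" using u assms by (auto simp: v cyc_next_def)
      ultimately show ?thesis using True by (auto simp: \<psi>_def cyc_next_def)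
    next
      case False
      then have "Suc x \<noteq> v" using that u by (auto simp: v cyc_next_def split: if_splits)
      then show ?thesis using False by (auto simp: \<psi>_def cyc_next_def)
    qed
    have "potential g (cyc_graph g) u v (\<lambda>x. - \<psi> x)"
    proof (rule potentialI)
      show "- \<psi> u + int g \<le> - \<psi> v + 1" using uv by simp
      fix x y assume xy: "cyc_graph g x y" "{x, y} \<noteq> {u, v}"
      then consider "x < g" "y = cyc_next g x" "x \<noteq> u" | "y < g" "x = cyc_next g y" "y \<noteq> u"
        unfolding cyc_graph_def v by (metis insert_commute)
      then show "- \<psi> x \<le> - \<psi> y + 1" using step by cases auto
    qed
    then show ?thesis by blast
  qed
  fix u v assume "cyc_graph g u v"
  then show "(\<exists>\<phi>. potential g (cyc_graph g) u v \<phi>) \<or> (\<exists>\<phi>. potential g (cyc_graph g) v u \<phi>)"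
    using potential unfolding cyc_graph_def by blast
qed

text \<open>A \<open>g\<close>-cycle with a pendant root \<open>g\<close> at its vertex 0 is filled
  up. The demand \<open>(s - 1) + (k - 3) + (g - 1) * (k - 2)\<close> is even if \<open>k\<close>
  and \<open>s\<close> are.\<close>

lemma rooted_exists:
  assumes k: "k \<ge> 3" and g: "g \<ge> 3" and s: "s \<ge> 1" "even k \<Longrightarrow> even s"
  shows "\<exists>(V :: nat set) E c \<delta>. rooted k g s V E c \<delta> \<and> cycle_off g E c"
proof -
  let ?C = "cyc_graph g" and ?S = "single_edge 0 g"
  let ?P = "wedge ?C ?S" and ?V = "{..<g} \<union> {0, g}"
  have g0: "0 \<noteq> g" using g by simp
  note C = cyc_graph_graph[OF g] and S = single_edge_graph[OF g0]
  have int: "{..<g} \<inter> {0, g} \<subseteq> {0}" by auto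
  have P: "ugraph ?V ?P" by (rule wedge_graph[OF C S])
  have girth_geP: "girth_ge g ?P" by (rule wedge_girth_ge[OF C S int cyc_graph_girth_ge[OF g] single_edge_girth_ge[OF g0]])
  have d0: "deg ?P 0 = 3"
    using wedge_deg_root[OF C S int] cyc_graph_deg[OF g, of 0] single_edge_deg(1)[OF g0] g by simp
  have dg: "deg ?P g = 1"
    using wedge_deg2[OF C, of g] single_edge_deg(2)[OF g0] by simp
  have dv: "deg ?P v = 2" if "v < g" "v \<noteq> 0" for v
    using that wedge_deg1[OF S, of v] cyc_graph_deg[OF g, of v] by simp
  define b where "b v = (if v = g then s - 1 else if v = 0 then k - 3 else k - 2)" for v
  have V: "?V = insert g {..<g}" using g by auto
  have "sum b ?V = b g + sum b {..<g}" unfolding V by simp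
  also have "sum b {..<g} = b 0 + sum b ({..<g} - {0})" using g by (intro sum.remove) auto
  also have "sum b ({..<g} - {0}) = (\<Sum>v\<in>{..<g} - {0}. k - 2)"
    by (intro sum.cong) (auto simp: b_def)
  finally have "sum b ?V = (s - 1) + ((k - 3) + (g - 1) * (k - 2))"
    using g by (simp add: b_def)
  then have ev: "even k \<Longrightarrow> even (sum b ?V)" using s k by simp
  obtain V' E' where ext: "extension k g b ?V ?P V' E'"
    using fill[of k g, OF _ g] k infinite_UNIV_nat P girth_geP ev by (metis le_trans one_le_numeral)
  note X = extensionD[OF ext]
  have dE: "deg E' v = (if v = g then s else k)" if "v \<in> V'" for v
  proof (cases "v \<in> ?V")
    case True
    then show ?thesis using X(5)[OF True] d0 dg dv[of v] k s g0 by (auto simp: b_def)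
  next
    case False
    then show ?thesis using X(6)[OF that] by auto
  qed
  have gV: "g \<in> V'" using X(3) by auto
  let ?E = "\<lambda>x y. E' x y \<and> E'\<^sup>*\<^sup>* g x"
  have rt: "rooted k g s {v. E'\<^sup>*\<^sup>* g v} ?E g (gdist ?E g)"
    by (rule component_rooted(1)[OF X(1,2) gV]) (use dE gV in auto)
  have PE: "E' x y" if "?P x y" for x y
    using that X(4)[of x y] P by (auto simp: ugraph_def)
  have E'i: "E' i (cyc_next g i)" if "i < g" for i
  proof (rule PE)
    have "cyc_next g i < g" using that by (simp add: cyc_next_def)
    then show "?P i (cyc_next g i)" using that by (simp add: wedge_def cyc_graph_def)
  qed
  have reach: "E'\<^sup>*\<^sup>* g i" if "i < g" for i
    using that
  proof (induction i)
    case 0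
    have "E' g 0" by (rule PE) (auto simp: wedge_def single_edge_def)
    then show ?case by blast
  next
    case (Suc i)
    then have "E' i (Suc i)" using E'i[of i] by (simp add: cyc_next_def)
    then show ?case using Suc by (meson Suc_lessD rtranclp.rtrancl_into_rtrancl)
  qed
  have "cycle_off g ?E g"
    unfolding cycle_off_def
  proof (intro exI[of _ id] conjI allI impI)
    fix i assume i: "i < g"
    have "Suc i mod g = cyc_next g i" using i by (simp add: cyc_next_def)
    then show "E' (id i) (id (Suc i mod g))" "E'\<^sup>*\<^sup>* g (id i)" using E'i[OF i] reach[OF i] by simp_all
  qed auto
  with rt show ?thesis by blast
qed

lemma tails_exist:
  assumes k: "k \<ge> 3" and g: "g \<ge> 3"
  shows "\<exists>j0. \<forall>j\<ge>j0. \<exists>V E c \<delta>. tail k g j V E c \<delta>"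
proof -
  have "even k \<Longrightarrow> even (2 :: nat)" "even k \<Longrightarrow> even (k - 2)" "k - 2 \<ge> 1" using k by auto
  from rooted_exists[OF k g _ this(1)] obtain V E c \<delta> where
    "rooted k g 2 (V :: nat set) E c \<delta>" "cycle_off g E c" by auto
  then have T: "tail k g (Max (\<delta> ` V)) V E c \<delta>" by (simp add: tail_def)
  from rooted_exists[OF k g \<open>k - 2 \<ge> 1\<close> \<open>even k \<Longrightarrow> even (k - 2)\<close>] obtain VR ER cR \<delta>R where
    R: "rooted k g (k - 2) (VR :: nat set) ER cR \<delta>R" by auto
  let ?j0 = "max (Suc (Max (\<delta> ` V))) (Suc (Max (\<delta>R ` VR)))"
  have "\<exists>V E c \<delta>. tail k g j V E c \<delta>" if "j \<ge> ?j0" for j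
    using that
  proof (induction j rule: dec_induct)
    case base
    then show ?case using tail_step[OF T R k g] by blast
  next
    case (step j)
    then obtain V' E' c' \<delta>' where "tail k g j V' E' c' \<delta>'" by blast
    from tail_step[OF this R k g] step(1) show ?case by (metis max.absorb1 max.bounded_iff Suc_le_mono le_SucI)
  qed
  then show ?thesis by blast
qed

section \<open>Long graphs from a periodic layered graph\<close>

lemma card_nbrs_split:
  assumes "finite A" "finite B" "finite C"
  shows "card ((\<lambda>b. (Suc t, b)) ` A \<union> (\<lambda>b. (Suc (Suc t), b)) ` B \<union> (\<lambda>b. (t :: nat, b :: nat)) ` C) =
    card A + card B + card C"
proof -
  have "card (((\<lambda>b. (Suc t, b)) ` A \<union> (\<lambda>b. (Suc (Suc t), b)) ` B) \<union> (\<lambda>b. (t, b)) ` C) =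
      card ((\<lambda>b. (Suc t, b)) ` A \<union> (\<lambda>b. (Suc (Suc t), b)) ` B) + card ((\<lambda>b. (t, b)) ` C)"
    by (rule card_Un_disjoint) (use assms in auto)
  moreover have "card ((\<lambda>b. (Suc t, b)) ` A \<union> (\<lambda>b. (Suc (Suc t), b)) ` B) =
      card ((\<lambda>b. (Suc t, b)) ` A) + card ((\<lambda>b. (Suc (Suc t), b)) ` B)"
    by (rule card_Un_disjoint) (use assms in auto)
  ultimately show ?thesis by (simp add: card_image inj_on_def)
qed

locale layered =
  fixes F k g m w
  assumes valid: "valid k g F" and per: "\<And>t. F (t + m) = F t" and m: "m > 0"
    and w: "(\<Sum>t<m. layer_size F t) = w" and k: "k \<ge> 3" and g: "g \<ge> 3"
begin

lemma adm: "admissible k g F t" and girth_geF: "girth_ge g (adj F)"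
  using valid by (auto simp: valid_iff)

lemmas A = admissibleD[OF adm]

definition n_up where "n_up t a = card {b. inter F t a b}"
definition n_down where "n_down t a = card {b. inter F t b a}"
definition n_same where "n_same t a = card {b. b \<noteq> a \<and> intra F t a b}"
definition e where "e = card {(a, b). inter F 0 a b}"

lemma n_sum: "intra F (Suc t) a a \<Longrightarrow> n_down t a + n_same (Suc t) a + n_up (Suc t) a = k"
  unfolding n_up_def n_down_def n_same_def using A(8) by simp

lemma finite_up: "finite {b. inter F t a b}" "finite {b. inter F t b a}" "finite {b. intra F t a b}"
proof -
  have "{b. inter F t a b} \<subseteq> snd ` {(a, b). inter F t a b}"
    "{b. inter F t b a} \<subseteq> fst ` {(a, b). inter F t a b}"
    "{b. intra F t a b} \<subseteq> snd ` {(a, b). intra F t a b}" by force+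
  then show "finite {b. inter F t a b}" "finite {b. inter F t b a}" "finite {b. intra F t a b}"
    using finite_inter finite_intra by (meson finite_imageI finite_subset)+
qed

lemma F_mult: "F (t + N * m) = F t"
proof (induction N)
  case (Suc N)
  have "F (t + Suc N * m) = F ((t + N * m) + m)" by (simp add: ac_simps)
  then show ?case using per Suc by simp
qed simp

lemma sum_layers: "(\<Sum>t=i..<i + N * m. layer_size F t) = N * w"
proof (induction N)
  case (Suc N)
  have "(\<Sum>t=i..<i + Suc N * m. layer_size F t) =
      (\<Sum>t=i..<i + N * m. layer_size F t) + (\<Sum>t=i + N * m..<i + N * m + m. layer_size F t)"
    by (subst sum.atLeastLessThan_concat) (auto simp: ac_simps)
  also have "(\<Sum>t=i + N * m..<i + N * m + m. layer_size F t) = w"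
    unfolding w[symmetric] by (rule periodic_sum) (rule layer_size_cong, rule per)
  finally show ?case using Suc by simp
qed simp

lemma sum_n_up: "(\<Sum>a\<in>{a. intra F t a a}. n_up t a) = card {(a, b). inter F t a b}"
proof -
  have "{(a, b). inter F t a b} = (SIGMA a:{a. intra F t a a}. {b. inter F t a b})"
    using A(6) by auto
  then show ?thesis using finite_layer finite_up by (simp add: n_up_def)
qed

lemma sum_n_down: "(\<Sum>a\<in>{a. intra F (Suc t) a a}. n_down t a) = card {(a, b). inter F t a b}"
proof -
  have "{(a, b). inter F t a b} = (\<lambda>(x, y). (y, x)) ` (SIGMA a:{a. intra F (Suc t) a a}. {b. inter F t b a})"
    using A(7) by (auto simp: image_iff)
  then have "card {(a, b). inter F t a b} = card (SIGMA a:{a. intra F (Suc t) a a}. {b. inter F t b a})"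
    by (simp add: card_image inj_on_def split_def prod_eq_iff)
  then show ?thesis using finite_layer finite_up by (simp add: n_down_def)
qed

context
  fixes N T assumes T: "T = N * m" and T2: "T \<ge> 2"
begin

text \<open>The extra vertex \<open>(0, 0)\<close> is the future root. It replaces one of the edges
  that layer 1 has lost downwards and so sits at the start of the spine.\<close>

definition VP where "VP = insert (0, 0) (SIGMA t:{1..T}. {a. intra F t a a})"
definition EP where "EP x y \<longleftrightarrow> (adj F x y \<and> fst x \<in> {1..T} \<and> fst y \<in> {1..T}) \<or> {x, y} = {(0, 0), (1, 0)}"

lemma adj_present: "adj F x y \<Longrightarrow> intra F (fst x) (snd x) (snd x) \<and> intra F (fst y) (snd y) (snd y)"
  unfolding adj_def using A(3,4,6,7) by metis

lemma EP_adj: "EP x y \<Longrightarrow> adj F x y"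
  using A(2)[of 0] by (auto simp: EP_def doubleton_eq_iff adj_def)

lemma EP_graph: "ugraph VP EP"
  unfolding ugraph_def
proof (intro conjI allI impI)
  show "finite VP" unfolding VP_def using finite_layer by simp
  fix x y assume xy: "EP x y"
  have 10: "(1, 0) \<in> VP" using A(1)[of 1] T2 by (simp add: VP_def)
  have "x \<in> VP \<and> y \<in> VP"
    using xy adj_present[OF EP_adj[OF xy]] 10
    unfolding EP_def VP_def by (cases x; cases y) (auto simp: doubleton_eq_iff)
  then show "x \<in> VP" "y \<in> VP" by auto
  show "x \<noteq> y" using EP_adj[OF xy] by (auto simp: adj_def)
  show "EP y x" using xy adj_sym[of F x y] A(3) unfolding EP_def by (metis insert_commute)
qed

lemma EP_girth_ge: "girth_ge g EP"
  by (rule girth_ge_mono[OF girth_geF EP_adj])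

lemma EP_deg_root: "deg EP (0, 0) = 1"
proof -
  have "{y. EP (0, 0) y} = {(1, 0)}" by (auto simp: EP_def doubleton_eq_iff)
  then show ?thesis by (simp add: deg_def)
qed

lemma EP_deg:
  assumes "Suc t \<le> T"
  shows "deg EP (Suc t, a) = (if t = 0 then of_bool (a = 0) else n_down t a) + n_same (Suc t) a +
    (if Suc t = T then 0 else n_up (Suc t) a)"
proof -
  let ?D = "if t = 0 then (if a = 0 then {0} else {}) else {b. inter F t b a}"
  let ?U = "if Suc t = T then {} else {b. inter F (Suc t) a b}"
  let ?S = "{b. b \<noteq> a \<and> intra F (Suc t) a b}"
  have "{y. EP (Suc t, a) y} = (\<lambda>b. (Suc t, b)) ` ?S \<union> (\<lambda>b. (Suc (Suc t), b)) ` ?U \<union> (\<lambda>b. (t, b)) ` ?D"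
  proof (intro set_eqI iffI)
    fix y assume "y \<in> {y. EP (Suc t, a) y}"
    then show "y \<in> (\<lambda>b. (Suc t, b)) ` ?S \<union> (\<lambda>b. (Suc (Suc t), b)) ` ?U \<union> (\<lambda>b. (t, b)) ` ?D"
      by (cases y) (auto simp: EP_def adj_def doubleton_eq_iff)
  next
    fix y assume "y \<in> (\<lambda>b. (Suc t, b)) ` ?S \<union> (\<lambda>b. (Suc (Suc t), b)) ` ?U \<union> (\<lambda>b. (t, b)) ` ?D"
    then show "y \<in> {y. EP (Suc t, a) y}"
      using assms by (auto simp: EP_def adj_def doubleton_eq_iff split: if_splits)
  qed
  moreover have "finite ?S" by (rule finite_subset[OF _ finite_up(3)[of "Suc t" a]]) auto
  ultimately have "deg EP (Suc t, a) = card ?S + card ?U + card ?D"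
    using finite_up card_nbrs_split[of ?S ?U ?D t] by (simp add: deg_def)
  then show ?thesis by (simp add: n_same_def n_up_def n_down_def)
qed

text \<open>The demand at the lower end: the edges lost towards layer 0, less the one replaced by
  the root. The root has degree 1 and needs \<open>k - 3\<close> more to reach \<open>k - 2\<close>.
  \<open>br\<close> is the demand at the upper end.\<close>

definition bl where "bl v = (if v = (0, 0) then k - 3
  else if fst v = 1 then n_down 0 (snd v) - of_bool (snd v = 0) else 0)"
definition br where "br v = (if fst v = T then n_up T (snd v) else 0)"

lemma n_down_pos: "n_down 0 0 \<ge> 1"
proof -
  have "0 \<in> {b. inter F 0 b 0}" using A(2) by simp
  then show ?thesis unfolding n_down_def using finite_up by (metis One_nat_def Suc_leI card_gt_0_iff empty_iff)
qed

lemma EP_total: "v \<in> VP \<Longrightarrow> deg EP v + bl v + br v = (if v = (0, 0) then k - 2 else k)"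
proof (cases "v = (0, 0)")
  case True
  then show ?thesis using EP_deg_root k T2 by (simp add: bl_def br_def)
next
  case False
  assume "v \<in> VP"
  then obtain t a where v: "v = (Suc t, a)" "Suc t \<le> T" "intra F (Suc t) a a"
    using False unfolding VP_def by (cases v; cases "fst v") auto
  show ?thesis
    using n_sum[OF v(3)] n_down_pos EP_deg[OF v(2), of a] v(1) T2
    by (auto simp: bl_def br_def)
qed

lemma sum_VP: "(\<Sum>v\<in>VP. f v) = f (0, 0) + (\<Sum>t=1..T. \<Sum>a\<in>{a. intra F t a a}. f (t, a))"
  for f :: "nat \<times> nat \<Rightarrow> nat"
proof -
  have "(\<Sum>v\<in>(SIGMA t:{1..T}. {a. intra F t a a}). f v) = (\<Sum>t=1..T. \<Sum>a\<in>{a. intra F t a a}. f (t, a))"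
    using finite_layer by (subst sum.Sigma) auto
  then show ?thesis unfolding VP_def using finite_layer by (subst sum.insert) auto
qed

text \<open>For even \<open>k\<close> and even cut size \<open>e\<close> the demand is even.
  Periodicity gives the same \<open>e\<close> at the upper end, so both fillings meet the parity
  condition.\<close>

lemma sum_bl: "sum bl VP + 1 = (k - 3) + e"
proof -
  have "(\<Sum>t=1..T. \<Sum>a\<in>{a. intra F t a a}. bl (t, a)) =
      (\<Sum>t=1..T. if t = 1 then \<Sum>a\<in>{a. intra F 1 a a}. n_down 0 a - of_bool (a = 0) else 0)"
    by (intro sum.cong refl) (auto simp: bl_def)
  also have "\<dots> = (\<Sum>a\<in>{a. intra F 1 a a}. n_down 0 a - of_bool (a = 0))"
    using T2 by simp
  also have "\<dots> = (n_down 0 0 - 1) + (\<Sum>a\<in>{a. intra F 1 a a} - {0}. n_down 0 a)"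
    using finite_layer A(1)[of 1] by (subst sum.remove[of _ 0]) auto
  finally have "sum bl VP + 1 = (k - 3) + (n_down 0 0 + (\<Sum>a\<in>{a. intra F 1 a a} - {0}. n_down 0 a))"
    using n_down_pos by (simp add: sum_VP bl_def)
  also have "n_down 0 0 + (\<Sum>a\<in>{a. intra F 1 a a} - {0}. n_down 0 a) = (\<Sum>a\<in>{a. intra F 1 a a}. n_down 0 a)"
    using finite_layer A(1)[of 1] by (subst sum.remove[of _ 0]) auto
  also have "\<dots> = e" using sum_n_down[of 0] by (simp add: e_def)
  finally show ?thesis .
qed

lemma sum_br: "sum br VP = e"
proof -
  have "(\<Sum>t=1..T. \<Sum>a\<in>{a. intra F t a a}. br (t, a)) =
      (\<Sum>t=1..T. if t = T then \<Sum>a\<in>{a. intra F T a a}. n_up T a else 0)"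
    by (intro sum.cong refl) (auto simp: br_def)
  also have "\<dots> = (\<Sum>a\<in>{a. intra F T a a}. n_up T a)"
    using T2 by simp
  also have "\<dots> = e"
    unfolding sum_n_up e_def inter_def T using F_mult[of 0 N] by simp
  finally show ?thesis using T2 by (simp add: sum_VP br_def)
qed

lemma card_VP: "card VP = 1 + N * w"
proof -
  have "card VP = (\<Sum>v\<in>VP. 1)" by simp
  also have "\<dots> = 1 + (\<Sum>t=1..T. layer_size F t)"
    unfolding sum_VP by (simp add: layer_size_def)
  also have "{1..T} = {1..<1 + N * m}" unfolding T by auto
  finally show ?thesis using sum_layers[of 1 N] by simp
qed

lemma even_e: "even k \<Longrightarrow> even e"
  unfolding e_def by (rule A(9))

text \<open>The ends are filled separately, so new vertices belong either to the bottom or to the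
  top. Hence \<open>ht\<close> changes by at most 1 along edges and puts the top of the spine at
  distance at least \<open>T - 1\<close> from the root. The overhead depends on \<open>e\<close>,
  not on \<open>N\<close>.\<close>

lemma long_graph:
  assumes C: "\<And>(V :: (nat \<times> nat) set) E b. infinite (UNIV :: (nat \<times> nat) set) \<Longrightarrow> ugraph V E \<Longrightarrow> girth_ge g E \<Longrightarrow>
    (even k \<Longrightarrow> even (sum b V)) \<Longrightarrow>
    \<exists>V' E'. extension k g b V E V' E' \<and> card V' \<le> card V + C * (sum b V + k)"
  shows "\<exists>(V :: (nat \<times> nat) set) E \<delta>. rooted k g (k - 2) V E (0, 0) \<delta> \<and> card V \<le> N * w + (1 + C * (2 * k + e) + C * (e + k)) \<and>
    (\<exists>v\<in>V. T \<le> Suc (\<delta> v))"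
proof -
  have inf: "infinite (UNIV :: (nat \<times> nat) set)" by (simp add: finite_prod)
  have "even k \<Longrightarrow> even (sum bl VP)"
  proof -
    assume "even k"
    then have "odd (k - 3 + e)" using even_e k by simp
    then show "even (sum bl VP)" using sum_bl by (metis even_add odd_one)
  qed
  from C[OF inf EP_graph EP_girth_ge this] obtain V1 E1 where
    ext1: "extension k g bl VP EP V1 E1" and c1: "card V1 \<le> card VP + C * (sum bl VP + k)" by blast
  note X1 = extensionD[OF ext1]
  \<comment> \<open>Vertices added at the bottom already have degree \<open>k\<close>, so their
    demand is 0.\<close>
  define br' where "br' v = (if v \<in> VP then br v else 0)" for v
  have "sum br' V1 = sum br' VP"
    using graph_finite[OF X1(1)] X1(3) by (intro sum.mono_neutral_right) (auto simp: br'_def)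
  also have "\<dots> = sum br VP" by (intro sum.cong) (auto simp: br'_def)
  finally have sbr: "sum br' V1 = e" using sum_br by simp
  have "even k \<Longrightarrow> even (sum br' V1)" using sbr even_e by simp
  from C[OF inf X1(1,2) this] obtain V2 E2 where
    ext2: "extension k g br' V1 E1 V2 E2" and c2: "card V2 \<le> card V1 + C * (sum br' V1 + k)" by blast
  note X2 = extensionD[OF ext2]
  have deg2: "deg E2 v = (if v = (0, 0) then k - 2 else k)" if "v \<in> V2" for v
  proof -
    have 00: "(0, 0) \<in> VP" by (simp add: VP_def)
    consider "v \<in> VP" | "v \<in> V1" "v \<notin> VP" | "v \<notin> V1" using that by blast
    then show ?thesis
    proof cases
      case 1
      then have "deg E2 v = deg EP v + bl v + br v"
        using X2(5)[of v] X1(5)[of v] X1(3) by (auto simp: br'_def)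
      then show ?thesis using EP_total[OF 1] by simp
    next
      case 2
      then show ?thesis using X2(5)[of v] X1(6)[of v] 00 by (auto simp: br'_def)
    next
      case 3
      then show ?thesis using X2(6)[OF that] 00 X1(3) by auto
    qed
  qed
  \<comment> \<open>Everything added at the bottom gets height 1, like the root, and everything
    added at the top gets height \<open>T\<close>.\<close>
  define ht where "ht v = (if v \<in> VP then max 1 (fst v) else if v \<in> V1 then 1 else T)" for v
  have old: "E2 x y \<longleftrightarrow> EP x y" if "x \<in> VP" "y \<in> VP" for x y
    using that X1(3,4) X2(4) by (metis subsetD)
  have sym2: "E2 x y \<Longrightarrow> E2 y x" for x y using X2(1) by (rule graph_sym)
  have EP_E2: "E2 x y" if "EP x y" for x y
    using that old EP_graph unfolding ugraph_def by blast
  have ht_VP: "ht x \<le> Suc (ht y)" if "E2 x y" "x \<in> VP" "y \<in> VP" for x y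
    using that old EP_adj adj_layers[of F x y] by (fastforce simp: ht_def)
  have ht_V1: "ht x = 1 \<and> ht y = 1" if xy: "E2 x y" "x \<in> V1" "x \<notin> VP" "y \<in> V1" for x y
  proof (cases "y \<in> VP")
    case True
    have "E1 x y" using X2(4) xy by simp
    then have "bl y > 0" using X1(7)[of x y] xy True by simp
    then have "y = (0, 0) \<or> fst y = 1" unfolding bl_def by (auto split: if_splits)
    then show ?thesis using xy True by (auto simp: ht_def)
  qed (use xy in \<open>simp add: ht_def\<close>)
  have ht_V2: "ht x = T \<and> ht y = T" if xy: "E2 x y" "x \<notin> V1" for x y
  proof (cases "y \<in> V1")
    case True
    have "x \<in> V2" using xy(1) X2(1) unfolding ugraph_def by blast
    then have "br' y > 0" using X2(7)[of x y] xy True by simp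
    then have "y \<in> VP" "fst y = T" unfolding br'_def br_def by (auto split: if_splits)
    then show ?thesis using xy X1(3) T2 by (auto simp: ht_def)
  qed (use xy X1(3) in \<open>auto simp: ht_def\<close>)
  have lip: "ht x \<le> Suc (ht y)" if "E2 x y" for x y
  proof -
    consider "x \<in> VP" "y \<in> VP" | "x \<notin> V1" | "y \<notin> V1" | "x \<in> V1" "y \<in> V1" "x \<notin> VP" | "x \<in> V1" "y \<in> V1" "y \<notin> VP"
      by blast
    then show ?thesis
    proof cases
      case 1
      then show ?thesis using ht_VP that by blast
    next
      case 2
      then show ?thesis using ht_V2[OF that] by simp
    next
      case 3
      then show ?thesis using ht_V2[OF sym2[OF that]] by simp
    next
      case 4
      then show ?thesis using ht_V1[of x y] that by simp
    next
      case 5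
      then show ?thesis using ht_V1[of y x] sym2[OF that] by simp
    qed
  qed
  have 00: "(0, 0) \<in> VP" "(0, 0) \<in> V2" using X1(3) X2(3) by (auto simp: VP_def)
  let ?E = "\<lambda>x y. E2 x y \<and> E2\<^sup>*\<^sup>* (0, 0) x" and ?V = "{v. E2\<^sup>*\<^sup>* (0, 0) v}"
  let ?\<delta> = "gdist ?E (0, 0)"
  have dd: "deg E2 (0, 0) = k - 2" "\<And>v. v \<in> V2 \<Longrightarrow> v \<noteq> (0, 0) \<Longrightarrow> deg E2 v = k"
    using deg2 00 by auto
  have comp: "rooted k g (k - 2) ?V ?E (0, 0) ?\<delta>" "?V \<subseteq> V2"
    using component_rooted[OF X2(1,2) 00(2) dd(1), of k] dd(2) by blast+
  have reach: "t < T \<Longrightarrow> E2\<^sup>*\<^sup>* (0, 0) (Suc t, 0)" for t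
  proof (induction t)
    case 0
    have "EP (0, 0) (Suc 0, 0)" by (simp add: EP_def)
    from EP_E2[OF this] show ?case by (rule r_into_rtranclp)
  next
    case (Suc t)
    then have "EP (Suc t, 0) (Suc (Suc t), 0)" using A(2) by (auto simp: EP_def adj_def)
    then have "E2 (Suc t, 0) (Suc (Suc t), 0)" by (rule EP_E2)
    then show ?case using Suc by (meson Suc_lessD rtranclp.rtrancl_into_rtrancl)
  qed
  have top: "(T, 0) \<in> ?V" using reach[of "T - 1"] T2 by simp
  have "(?E ^^ ?\<delta> (T, 0)) (0, 0) (T, 0)"
    by (rule levels_walk[OF rootedD(6)[OF comp(1)] top])
  then have "- int (ht (0, 0)) \<le> - int (ht (T, 0)) + int (?\<delta> (T, 0))"
    by (rule relpowp_lipschitz[rotated]) (use lip sym2 in force)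
  moreover have "ht (0, 0) = 1" "ht (T, 0) = T"
    using 00 T2 A(1)[of T] by (auto simp: ht_def VP_def)
  ultimately have "T \<le> Suc (?\<delta> (T, 0))" by simp
  moreover have "card ?V \<le> N * w + (1 + C * (2 * k + e) + C * (e + k))"
  proof -
    have "card ?V \<le> card V2" using comp(2) X2(1) by (intro card_mono) (auto simp: ugraph_def)
    also have "\<dots> \<le> card VP + C * (sum bl VP + k) + C * (e + k)" using c1 c2 sbr by simp
    also have "C * (sum bl VP + k) \<le> C * (2 * k + e)" using sum_bl by (intro mult_le_mono2) simp
    finally show ?thesis using card_VP by simp
  qed
  ultimately show ?thesis
    using comp(1) top by (intro exI[of _ ?V] exI[of _ ?E] exI[of _ ?\<delta>] conjI bexI[of _ "(T, 0)"])
qed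

end

end

section \<open>Gluing a tail to a long graph\<close>

definition diameter :: "'a set \<Rightarrow> ('a \<Rightarrow> 'a \<Rightarrow> bool) \<Rightarrow> nat \<Rightarrow> bool" where
  "diameter V E d \<longleftrightarrow> (\<forall>x\<in>V. \<forall>y\<in>V. \<exists>n\<le>d. (E ^^ n) x y) \<and>
     (\<exists>x\<in>V. \<exists>y\<in>V. \<forall>n<d. \<not> (E ^^ n) x y)"

lemma relpowp_sym: "(\<And>x y. E x y \<Longrightarrow> E y x) \<Longrightarrow> (E ^^ n) x y \<Longrightarrow> (E ^^ n) y x"
proof (induction n arbitrary: y)
  case (Suc n)
  then obtain z where "(E ^^ n) x z" "E z y" by auto
  then have "(E ^^ n) z x" "E y z" using Suc by auto
  then show ?case by (rule relpowp_Suc_I2[rotated])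
qed simp

lemma relpowp_mono':
  fixes E E' :: "'a \<Rightarrow> 'a \<Rightarrow> bool"
  shows "(\<And>x y. E x y \<Longrightarrow> E' x y) \<Longrightarrow> (E ^^ n) x y \<Longrightarrow> (E' ^^ n) x y"
  by (induction n arbitrary: y) auto

lemma relpowp_trans: "(E ^^ n) x y \<Longrightarrow> (E ^^ l) y z \<Longrightarrow> (E ^^ (n + l)) x z"
  by (auto simp: relpowp_add)

lemma levels_lip_walk:
  assumes "levels V E c \<delta>" "ugraph V E" "(E ^^ n) x y"
  shows "\<delta> y \<le> \<delta> x + n"
proof -
  have "- int (\<delta> x) \<le> - int (\<delta> y) + int n"
    by (rule relpowp_lipschitz[OF _ assms(3)])
      (use assms(1,2) in \<open>force simp: levels_def ugraph_def\<close>)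
  then show ?thesis by simp
qed

lemma levels_path:
  assumes "levels V E c \<delta>" "ugraph V E" "v \<in> V"
  shows "\<exists>p. p 0 = c \<and> p (\<delta> v) = v \<and> (\<forall>i<\<delta> v. E (p i) (p (Suc i))) \<and> (\<forall>i\<le>\<delta> v. \<delta> (p i) = i)"
proof -
  let ?n = "\<delta> v"
  obtain p where p: "p 0 = c" "p ?n = v" "\<And>i. i < ?n \<Longrightarrow> E (p i) (p (Suc i))"
    using levels_walk[OF assms(1,3)] unfolding relpowp_fun_conv by blast
  have walk: "(E ^^ (j - i)) (p i) (p j)" if "i \<le> j" "j \<le> ?n" for i j
    unfolding relpowp_fun_conv
    by (rule exI[of _ "\<lambda>l. p (i + l)"]) (use p(3) that in auto)
  have "\<delta> (p i) = i" if "i \<le> ?n" for i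
  proof (rule antisym)
    show "\<delta> (p i) \<le> i"
      using levels_lip_walk[OF assms(1,2) walk[of 0 i]] that p(1) assms(1) by (simp add: levels_def)
    show "i \<le> \<delta> (p i)"
      using levels_lip_walk[OF assms(1,2) walk[of i ?n]] that p(2) by simp
  qed
  then show ?thesis using p by blast
qed

lemma closure_cyclic:
  assumes "ugraph V E" "\<And>v. v \<in> V \<Longrightarrow> deg E v = k" "girth_ge g E" "g \<ge> 3" "d \<ge> 3"
    "\<And>x y. E x y \<Longrightarrow> h x \<le> Suc (h y)" "\<And>i. i < d \<Longrightarrow> E (p i) (p (Suc i))"
    "\<And>i. i \<le> d \<Longrightarrow> h (p i) = i"
  shows "cyclic k g (d - 1) (card V)"
proof -
  interpret surgery V E k g h p d by unfold_locales (use assms in auto)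
  show ?thesis using cyclic_closure by (simp add: m_def)
qed

locale glue =
  fixes VM :: "'a set" and EM c \<delta> L F \<epsilon> k g
  assumes M: "rooted k g (k - 2) VM EM c \<delta>" and T: "rooted k g 2 L F c \<epsilon>"
    and int: "VM \<inter> L = {c}" and k: "k \<ge> 3" and g: "g \<ge> 3"
begin

abbreviation "V \<equiv> VM \<union> L"
abbreviation "E \<equiv> wedge EM F"

lemmas MD = rootedD[OF M] and TD = rootedD[OF T]

lemma graphE: "ugraph V E" by (rule wedge_graph[OF MD(1) TD(1)])

lemma girth_geE: "girth_ge g E"
  by (rule wedge_girth_ge[OF MD(1) TD(1) _ MD(2) TD(2), of c]) (use int in simp)

lemma card_V: "card V \<le> card VM + card L" by (rule card_Un_le)

lemma regular: "v \<in> V \<Longrightarrow> deg E v = k"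
proof -
  assume v: "v \<in> V"
  consider "v = c" | "v \<in> VM" "v \<noteq> c" "v \<notin> L" | "v \<in> L" "v \<noteq> c" "v \<notin> VM" using v int by blast
  then show ?thesis
  proof cases
    case 1
    then show ?thesis using wedge_deg_root[OF MD(1) TD(1)] int MD(4) TD(4) k by simp
  next
    case 2
    then show ?thesis using wedge_deg1[OF TD(1)] MD(5) by simp
  next
    case 3
    then show ?thesis using wedge_deg2[OF MD(1)] TD(5) by simp
  qed
qed

lemma sym: "E x y \<Longrightarrow> E y x" using graphE by (rule graph_sym)

lemma walks_to_root: "x \<in> VM \<Longrightarrow> (E ^^ \<delta> x) c x" "x \<in> L \<Longrightarrow> (E ^^ \<epsilon> x) c x"
proof -
  show "x \<in> VM \<Longrightarrow> (E ^^ \<delta> x) c x"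
    by (rule relpowp_mono'[OF _ levels_walk[OF MD(6)]]) (simp add: wedge_def)
  show "x \<in> L \<Longrightarrow> (E ^^ \<epsilon> x) c x"
    by (rule relpowp_mono'[OF _ levels_walk[OF TD(6)]]) (simp add: wedge_def)
qed

text \<open>\<open>R\<close> stands for a Lipschitz condition; it is kept abstract to serve
  functions into \<open>nat\<close> and into \<open>int\<close>.\<close>

lemma lip_extend:
  fixes h :: "'a \<Rightarrow> 'b" and R :: "'b \<Rightarrow> 'b \<Rightarrow> bool"
  assumes "\<And>x y. EM x y \<Longrightarrow> R (h x) (h y)" "\<And>x y. F x y \<Longrightarrow> R (h' x) (h' y)" "h c = h' c" "E x y"
  shows "R (if x \<in> VM then h x else h' x) (if y \<in> VM then h y else h' y)"
proof -
  from assms(4) consider "EM x y" | "F x y" by (auto simp: wedge_def)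
  then show ?thesis
  proof cases
    case 1
    then have "x \<in> VM" "y \<in> VM" using MD(1) by (auto simp: ugraph_def)
    then show ?thesis using assms(1)[OF 1] by simp
  next
    case 2
    then have "x \<in> L" "y \<in> L" using TD(1) by (auto simp: ugraph_def)
    then have "x \<in> VM \<Longrightarrow> x = c" "y \<in> VM \<Longrightarrow> y = c" using int by auto
    then have "(if x \<in> VM then h x else h' x) = h' x" "(if y \<in> VM then h y else h' y) = h' y"
      using assms(3) by auto
    then show ?thesis using assms(2)[OF 2] by simp
  qed
qed

lemma connected_M: "x \<in> VM \<Longrightarrow> y \<in> VM \<Longrightarrow> EM\<^sup>*\<^sup>* x y"
proof -
  assume "x \<in> VM" "y \<in> VM"
  then have "(EM ^^ \<delta> x) x c" "(EM ^^ \<delta> y) c y"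
    using levels_walk[OF MD(6)] relpowp_sym[of EM] graph_sym[OF MD(1)] by blast+
  then show ?thesis by (meson relpowp_imp_rtranclp rtranclp_trans)
qed

text \<open>The geodesic runs inside \<open>VM\<close>, and the whole tail can be put on the level
  of its root.\<close>

lemma close_M:
  assumes "y \<in> VM" "z \<in> VM" "gdist EM y z \<ge> 3"
  shows "cyclic k g (gdist EM y z - 1) (card V)"
proof -
  obtain p where p: "\<forall>i<gdist EM y z. EM (p i) (p (Suc i))" "\<forall>i\<le>gdist EM y z. gdist EM y (p i) = i"
    using geodesic[OF connected_M[OF assms(1,2)]] by blast
  have EM_in: "EM u v \<Longrightarrow> u \<in> VM \<and> v \<in> VM \<and> EM v u" for u v using MD(1) by (auto simp: ugraph_def)
  let ?h = "\<lambda>x. if x \<in> VM then gdist EM y x else gdist EM y c"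
  show ?thesis
  proof (rule closure_cyclic[OF graphE regular girth_geE g assms(3), where h = ?h and p = p])
    show "?h u \<le> Suc (?h v)" if "E u v" for u v
    proof (rule lip_extend[where h = "gdist EM y" and h' = "\<lambda>_. gdist EM y c" and R = "\<lambda>a b. a \<le> Suc b", OF _ _ _ that])
      show "gdist EM y u \<le> Suc (gdist EM y v)" if "EM u v" for u v
        using EM_in[OF that] connected_M assms(1) by (intro gdist_step) auto
    qed auto
    show "E (p i) (p (Suc i))" if "i < gdist EM y z" for i using p(1) that by (simp add: wedge_def)
    show "?h (p i) = i" if "i \<le> gdist EM y z" for i
    proof -
      have "EM (p i) (p (Suc i)) \<or> EM (p (i - 1)) (p i)"
        using p(1) that assms(3) by (cases "i < gdist EM y z") (auto simp: Suc_diff_le dest: spec[of _ "i - 1"])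
      then have "p i \<in> VM" using EM_in by blast
      then show ?thesis using p(2) that by simp
    qed
  qed
qed

lemma close_T:
  assumes "v \<in> L" "\<epsilon> v \<ge> 3"
  shows "cyclic k g (\<epsilon> v - 1) (card V)"
proof -
  obtain p where p: "\<forall>i<\<epsilon> v. F (p i) (p (Suc i))" "\<forall>i\<le>\<epsilon> v. \<epsilon> (p i) = i"
    using levels_path[OF TD(6,1) assms(1)] by blast
  let ?h = "\<lambda>x. if x \<in> VM then 0 else \<epsilon> x"
  have e0: "\<epsilon> c = 0" using TD(6) by (simp add: levels_def)
  show ?thesis
  proof (rule closure_cyclic[OF graphE regular girth_geE g assms(2), where h = ?h and p = p])
    show "?h u \<le> Suc (?h v)" if "E u v" for u v
      by (rule lip_extend[where h = "\<lambda>_. 0" and h' = \<epsilon> and R = "\<lambda>a b. a \<le> Suc b", OF _ _ _ that])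
        (use TD(6) e0 in \<open>auto simp: levels_def\<close>)
    show "E (p i) (p (Suc i))" if "i < \<epsilon> v" for i using p(1) that by (simp add: wedge_def)
    show "?h (p i) = i" if "i \<le> \<epsilon> v" for i
    proof (cases "p i \<in> VM")
      case True
      have "F (p i) (p (Suc i)) \<or> F (p (i - 1)) (p i)"
        using p(1) that assms(2) by (cases "i < \<epsilon> v") (auto simp: Suc_diff_le dest: spec[of _ "i - 1"])
      then have "p i \<in> L" using TD(1) by (auto simp: ugraph_def)
      then have "p i = c" using True int by auto
      then show ?thesis using p(2) that e0 True by fastforce
    qed (use p(2) that in simp)
  qed
qed

text \<open>Outside \<open>VM \<times> VM\<close>, vertices are joined through the root. That the
  bound is attained by deepest vertices of both parts is shown by the function that is
  \<open>\<delta>\<close> on one part and \<open>- \<epsilon>\<close> on the other.\<close>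

lemma glue_diameter:
  assumes D: "\<And>x y. x \<in> VM \<Longrightarrow> y \<in> VM \<Longrightarrow> gdist EM x y \<le> Max (\<delta> ` VM) + j"
    and j: "Max (\<epsilon> ` L) = j" "j \<le> Max (\<delta> ` VM)"
  shows "diameter V E (Max (\<delta> ` VM) + j)"
proof -
  let ?e = "Max (\<delta> ` VM)"
  have fin: "finite (\<delta> ` VM)" "finite (\<epsilon> ` L)" "\<delta> ` VM \<noteq> {}" "\<epsilon> ` L \<noteq> {}"
    using MD(1,3) TD(1,3) graph_finite by auto
  have dle: "\<delta> x \<le> ?e" if "x \<in> VM" for x using fin that by simp
  have ele: "\<epsilon> x \<le> j" if "x \<in> L" for x using fin that j(1)[symmetric] by simp
  have far: "\<exists>n\<le>?e + j. (E ^^ n) x y" if xy: "x \<in> V" "y \<in> V" for x y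
  proof -
    consider "x \<in> VM" "y \<in> VM" | "x \<in> VM" "y \<in> L" | "x \<in> L" "y \<in> VM" | "x \<in> L" "y \<in> L" using xy by blast
    then show ?thesis
    proof cases
      case 1
      have "(EM ^^ gdist EM x y) x y" by (rule gdist_walk[OF connected_M[OF 1]])
      then have "(E ^^ gdist EM x y) x y" by (rule relpowp_mono'[rotated]) (simp add: wedge_def)
      then show ?thesis using D[OF 1] by blast
    next
      case 2
      then have "(E ^^ (\<delta> x + \<epsilon> y)) x y"
        by (intro relpowp_trans[of _ E x c]) (auto intro: relpowp_sym[OF sym] walks_to_root)
      then show ?thesis using dle[OF 2(1)] ele[OF 2(2)] by (meson add_mono)
    next
      case 3
      then have "(E ^^ (\<epsilon> x + \<delta> y)) x y"
        by (intro relpowp_trans[of _ E x c]) (auto intro: relpowp_sym[OF sym] walks_to_root)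
      then show ?thesis using dle[OF 3(2)] ele[OF 3(1)] by (metis add.commute add_mono)
    next
      case 4
      then have "(E ^^ (\<epsilon> x + \<epsilon> y)) x y"
        by (intro relpowp_trans[of _ E x c]) (auto intro: relpowp_sym[OF sym] walks_to_root)
      then show ?thesis using ele[OF 4(2)] ele[OF 4(1)] j(2) by (meson add_mono le_trans)
    qed
  qed
  obtain x where x: "x \<in> VM" "\<delta> x = ?e" using Max_in[OF fin(1,3)] by auto
  obtain y where y: "y \<in> L" "\<epsilon> y = j" using Max_in[OF fin(2,4)] j(1) by auto
  have d0: "\<delta> c = 0" "\<epsilon> c = 0" using MD(6) TD(6) by (auto simp: levels_def)
  let ?\<phi> = "\<lambda>z. if z \<in> VM then int (\<delta> z) else - int (\<epsilon> z)"
  have lip: "?\<phi> u \<le> ?\<phi> v + 1" if "E u v" for u v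
  proof (rule lip_extend[where h = "\<lambda>z. int (\<delta> z)" and h' = "\<lambda>z. - int (\<epsilon> z)" and R = "\<lambda>a b. a \<le> b + 1", OF _ _ _ that])
    show "int (\<delta> u) \<le> int (\<delta> v) + 1" if "EM u v" for u v
      using that MD(6) by (force simp: levels_def)
    show "- int (\<epsilon> u) \<le> - int (\<epsilon> v) + 1" if "F u v" for u v
    proof -
      have "F v u" using that TD(1) by (auto simp: ugraph_def)
      then have "\<epsilon> v \<le> Suc (\<epsilon> u)" using TD(6) by (auto simp: levels_def)
      then show ?thesis by simp
    qed
  qed (use d0 in simp)
  have \<phi>y: "?\<phi> y = - int j"
  proof (cases "y \<in> VM")
    case True
    then have "y = c" using y(1) int by auto
    then show ?thesis using y d0 True by simp
  qed (use y in simp)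
  have "\<not> (E ^^ n) x y" if "n < ?e + j" for n
  proof
    assume "(E ^^ n) x y"
    from relpowp_lipschitz[where \<phi> = ?\<phi> and E = E, OF lip this] have "int ?e \<le> - int j + int n" using x \<phi>y by simp
    then show False using that by simp
  qed
  then show ?thesis unfolding diameter_def using far x(1) y(1) by blast
qed

end

text \<open>Closing up needs no more than a path of three edges with increasing levels, which a tail
  of depth at least 3 supplies.\<close>

lemma cyclic_exists:
  assumes k: "k \<ge> 3" and g: "g \<ge> 3"
  shows "\<exists>m w. cyclic k g m w"
proof -
  have "even k \<Longrightarrow> even (k - 2)" "k - 2 \<ge> 1" using k by auto
  from rooted_exists[OF k g this(2,1)] obtain VM :: "nat set" and EM c \<delta> where
    M: "rooted k g (k - 2) VM EM c \<delta>" by blast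
  obtain j0 where j0: "\<forall>j\<ge>j0. \<exists>V E c \<delta>. tail k g j V E c \<delta>" using tails_exist[OF k g] ..
  obtain VT ET cT \<delta>T where TT: "tail k g (max j0 3) VT ET cT \<delta>T" using j0 by fastforce
  obtain L F \<epsilon> where L: "rooted k g 2 L F c \<epsilon>" "L \<inter> VM = {c}" "\<epsilon> ` L = \<delta>T ` VT"
    using fresh_copy[OF infinite_UNIV_nat graph_finite[OF rootedD(1)[OF M]] rootedD(3)[OF M], of k g 2 VT ET cT \<delta>T] TT
    by (auto simp: tail_def)
  interpret glue VM EM c \<delta> L F \<epsilon> k g by unfold_locales (use M L k g in auto)
  have "Max (\<epsilon> ` L) = max j0 3" using L(3) TT by (simp add: tail_def)
  moreover have "finite (\<epsilon> ` L)" "\<epsilon> ` L \<noteq> {}" using TD(1,3) graph_finite by auto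
  ultimately obtain v where "v \<in> L" "\<epsilon> v = max j0 3" using Max_in by (metis imageE)
  then show ?thesis using close_T[of v] by auto
qed

text \<open>\<open>N\<close> periods account for about \<open>N * q\<close> of the diameter, and a
  tail supplies the rest exactly. Its depth stays in a range independent of \<open>d\<close>, so
  only boundedly many vertices are added.\<close>

theorem long_graphs:
  assumes k: "k \<ge> 3" and g: "g \<ge> 3" and min: "minimal k g q p"
  shows "\<exists>C d0. \<forall>d\<ge>d0. \<exists>(V :: (nat \<times> nat) set) E r. ugraph V E \<and> girth_ge g E \<and> (\<forall>v\<in>V. deg E v = k) \<and>
    cycle_off g E r \<and> diameter V E d \<and> q * card V \<le> p * d + C"
proof -
  have cyc: "cyclic k g q p" using min by (simp add: minimal_def)
  then obtain F where F: "q > 0" "\<And>t. F (t + q) = F t" "valid k g F" "(\<Sum>t<q. layer_size F t) = p"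
    by (auto simp: cyclic_def)
  interpret layered F k g q p by unfold_locales (use F k g in auto)
  \<comment> \<open>The spine makes every layer nonempty, so \<open>p\<close> is positive and can be
    cancelled below.\<close>
  have "intra F 0 0 0" by (rule A(1))
  then have "0 \<in> {a. intra F 0 a a}" by simp
  then have "layer_size F 0 > 0" unfolding layer_size_def using finite_layer by (metis card_gt_0_iff empty_iff)
  then have p: "p \<ge> 1" using F(1,4) by (metis One_nat_def Suc_leI finite_lessThan gr0I lessThan_iff less_irrefl sum_eq_0_iff)
  obtain C where C: "\<And>(V :: (nat \<times> nat) set) E b. infinite (UNIV :: (nat \<times> nat) set) \<Longrightarrow> ugraph V E \<Longrightarrow> girth_ge g E \<Longrightarrow>
    (even k \<Longrightarrow> even (sum b V)) \<Longrightarrow>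
    \<exists>V' E'. extension k g b V E V' E' \<and> card V' \<le> card V + C * (sum b V + k)"
    using fill[of k g, OF _ g] k by (metis le_trans one_le_numeral)
  define K where "K = 1 + C * (2 * k + e) + C * (e + k)"
  have long: "\<exists>(V :: (nat \<times> nat) set) E \<delta>. rooted k g (k - 2) V E (0, 0) \<delta> \<and> card V \<le> N * p + K \<and>
      (\<exists>v\<in>V. N * q \<le> Suc (\<delta> v))" if "N \<ge> 2" for N
  proof -
    have "2 * 1 \<le> N * q" using that F(1) by (intro mult_le_mono) auto
    then show ?thesis using long_graph[OF refl _ C, of N] unfolding K_def by simp
  qed
  obtain j0 where j0: "\<And>j. j \<ge> j0 \<Longrightarrow> \<exists>V E c \<delta>. tail k g j V E c \<delta>" using tails_exist[OF k g] by blast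
  then have "\<forall>j. \<exists>n. j \<ge> j0 \<longrightarrow> (\<exists>V E c \<delta>. tail k g j V E c \<delta> \<and> card V = n)" by blast
  from choice[OF this] obtain tc where
    tc: "\<And>j. j \<ge> j0 \<Longrightarrow> \<exists>V E c \<delta>. tail k g j V E c \<delta> \<and> card V = tc j" by blast
  have attach: "\<exists>L F' \<epsilon>. glue VM EM (0, 0) \<delta> L F' \<epsilon> k g \<and> card L = tc j \<and> Max (\<epsilon> ` L) = j \<and> cycle_off g F' (0, 0)"
    if M: "rooted k g (k - 2) VM EM (0, 0) \<delta>" and j: "j \<ge> j0" for VM :: "(nat \<times> nat) set" and EM \<delta> j
  proof -
    have inf: "infinite (UNIV :: (nat \<times> nat) set)" by (simp add: finite_prod)
    obtain VT ET cT \<delta>T where T: "tail k g j VT ET cT \<delta>T" "card VT = tc j" using tc[OF j] by blast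
    then have "rooted k g 2 VT ET cT \<delta>T" by (simp add: tail_def)
    from fresh_copy[OF inf graph_finite[OF rootedD(1)[OF M]] rootedD(3)[OF M] this]
    obtain L F' \<epsilon> where L: "rooted k g 2 L F' (0, 0) \<epsilon>" "L \<inter> VM = {(0, 0)}" "\<epsilon> ` L = \<delta>T ` VT"
      "card L = card VT" "cycle_off g ET cT \<longrightarrow> cycle_off g F' (0, 0)" by blast
    have "glue VM EM (0, 0) \<delta> L F' \<epsilon> k g" by unfold_locales (use M L k g in auto)
    moreover have "card L = tc j" "Max (\<epsilon> ` L) = j" "cycle_off g F' (0, 0)"
      using L(3-5) T by (simp_all add: tail_def)
    ultimately show ?thesis by blast
  qed
  \<comment> \<open>The slack in the distance bound: the overhead in vertices times
    \<open>q\<close>, and 3 to cover distances too short for closing up and the loss from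
    \<open>d\<close> to \<open>d - 1\<close>.\<close>
  define B where "B = (K + tc j0) * q + 3"
  \<comment> \<open>Two vertices farther apart would yield a closed-up graph that contradicts the minimality of
    \<open>p / q\<close>, so the upper bound on the diameter comes for free.\<close>
  have dist: "gdist EM y z \<le> N * q + B"
    if M: "rooted k g (k - 2) VM EM (0, 0) \<delta>" and c: "card VM \<le> N * p + K" and yz: "y \<in> VM" "z \<in> VM"
    for VM :: "(nat \<times> nat) set" and EM \<delta> N y z
  proof (cases "gdist EM y z \<ge> 3")
    case True
    obtain L F' \<epsilon> where G: "glue VM EM (0, 0) \<delta> L F' \<epsilon> k g" "card L = tc j0"
      using attach[OF M order_refl] by blast
    let ?D = "gdist EM y z - 1"
    have "p * ?D \<le> card (VM \<union> L) * q"
      by (rule minimalD[OF min glue.close_M[OF G(1) yz True]])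
    also have "\<dots> \<le> (N * p + (K + tc j0)) * q"
      using glue.card_V[OF G(1)] c G(2) by (intro mult_le_mono1) simp
    also have "\<dots> = p * (N * q) + (K + tc j0) * q" by (simp add: algebra_simps)
    also have "\<dots> \<le> p * (N * q) + p * ((K + tc j0) * q)" using p by simp
    finally have "p * ?D \<le> p * (N * q + (K + tc j0) * q)" by (simp only: distrib_left)
    then have "?D \<le> N * q + (K + tc j0) * q" using p by simp
    then show ?thesis by (simp add: B_def)
  qed (simp add: B_def)
  \<comment> \<open>\<open>J\<close> is the least tail depth used: tails of this depth exist, and
    distances inside the long part do not exceed its depth plus \<open>J\<close>. \<open>J1\<close>
    is the largest depth that the slack \<open>B\<close> and the rounding in \<open>N\<close> can
    require.\<close>
  define J where "J = max j0 (B + 2)"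
  define J1 where "J1 = J + B + q + 1"
  define Cm where "Cm = (\<Sum>j\<le>J1. tc j)"
  show ?thesis
  proof (rule exI[of _ "q * (K + Cm)"], rule exI[of _ "J + B + 2 * q + J1 + 1"], intro allI impI)
    fix d assume d: "J + B + 2 * q + J1 + 1 \<le> d"
    \<comment> \<open>As many periods as fit when \<open>J + B\<close> is reserved for the tail and
      the slack.\<close>
    define N where "N = (d - J - B) div q"
    have Nq: "N * q + B + J \<le> d" "d < N * q + q + B + J"
    proof -
      have "N * q \<le> d - J - B" unfolding N_def by simp
      then show "N * q + B + J \<le> d" using d by simp
      have "d - J - B < N * q + q"
        unfolding N_def using F(1) by (metis add.commute dividend_less_div_times)
      then show "d < N * q + q + B + J" using d by simp
    qed
    have "2 \<le> N"
    proof (rule ccontr)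
      assume "\<not> 2 \<le> N"
      then have "N * q \<le> 1 * q" by (intro mult_le_mono1) simp
      then show False using Nq(2) d by linarith
    qed
    then obtain VM :: "(nat \<times> nat) set" and EM \<delta> where M: "rooted k g (k - 2) VM EM (0, 0) \<delta>"
      and cM: "card VM \<le> N * p + K" and deep: "\<exists>v\<in>VM. N * q \<le> Suc (\<delta> v)" using long by blast
    note MD = rootedD[OF M]
    have fin: "finite (\<delta> ` VM)" "\<delta> ` VM \<noteq> {}" using MD(1,3) graph_finite by auto
    define e0 where "e0 = Max (\<delta> ` VM)"
    have lo: "N * q \<le> Suc e0"
    proof -
      from deep obtain v where "v \<in> VM" "N * q \<le> Suc (\<delta> v)" by blast
      moreover from this have "\<delta> v \<le> e0" unfolding e0_def using fin by simp
      ultimately show ?thesis by simp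
    qed
    have hi: "e0 \<le> N * q + B"
    proof -
      obtain v where v: "v \<in> VM" "\<delta> v = e0" unfolding e0_def using Max_in[OF fin] by auto
      have "EM\<^sup>*\<^sup>* (0, 0) v" using levels_walk[OF MD(6) v(1)] by (auto simp: rtranclp_power)
      then have "\<delta> v \<le> gdist EM (0, 0) v"
        using levels_lip_walk[OF MD(6,1) gdist_walk, of "(0, 0)" v] MD(6) by (simp add: levels_def)
      also have "\<dots> \<le> N * q + B" by (rule dist[OF M cM MD(3) v(1)])
      finally show ?thesis using v(2) by simp
    qed
    define j where "j = d - e0"
    have e0d: "e0 + j = d" using hi Nq(1) by (simp add: j_def)
    have jJ: "J \<le> j" "j \<le> J1" "j \<le> e0"
      using hi lo Nq d unfolding j_def J1_def by linarith+
    then have "j0 \<le> j" by (simp add: J_def)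
    from attach[OF M this] obtain L F' \<epsilon> where G: "glue VM EM (0, 0) \<delta> L F' \<epsilon> k g" "card L = tc j"
      "Max (\<epsilon> ` L) = j" "cycle_off g F' (0, 0)" by blast
    interpret G: glue VM EM "(0, 0)" \<delta> L F' \<epsilon> k g by (rule G(1))
    have "diameter G.V G.E (Max (\<delta> ` VM) + j)"
    proof (rule G.glue_diameter)
      show "gdist EM x y \<le> Max (\<delta> ` VM) + j" if "x \<in> VM" "y \<in> VM" for x y
        using dist[OF M cM that] lo jJ(1) unfolding e0_def[symmetric] J_def by linarith
      show "j \<le> Max (\<delta> ` VM)" using jJ(3) by (simp add: e0_def)
    qed (rule G(3))
    then have diam: "diameter G.V G.E d" using e0d by (simp add: e0_def)
    have "tc j \<le> Cm" unfolding Cm_def using jJ(2) by (intro member_le_sum) auto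
    then have "card G.V \<le> N * p + (K + Cm)" using G.card_V cM G(2) by simp
    then have "q * card G.V \<le> q * (N * p + (K + Cm))" by (rule mult_le_mono2)
    also have "\<dots> = p * (N * q) + q * (K + Cm)" by (simp add: algebra_simps)
    also have "p * (N * q) \<le> p * d" using Nq(1) by (intro mult_le_mono2) simp
    finally have "q * card G.V \<le> p * d + q * (K + Cm)" by simp
    moreover have "cycle_off g G.E (0, 0)"
      by (rule cycle_off_mono[OF G(4)]) (use g in \<open>auto simp: wedge_def\<close>)
    ultimately show "\<exists>(V :: (nat \<times> nat) set) E r. ugraph V E \<and> girth_ge g E \<and> (\<forall>v\<in>V. deg E v = k) \<and>
        cycle_off g E r \<and> diameter V E d \<and> q * card V \<le> p * d + q * (K + Cm)"
      using G.graphE G.girth_geE G.regular diam by blast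
  qed
qed

section \<open>Transfer to pair digraphs\<close>

definition edge :: "'a pair_pre_digraph \<Rightarrow> 'a \<Rightarrow> 'a \<Rightarrow> bool" where
  "edge G x y \<longleftrightarrow> (x, y) \<in> parcs G"

definition mk_graph :: "'a set \<Rightarrow> ('a \<Rightarrow> 'a \<Rightarrow> bool) \<Rightarrow> 'a pair_pre_digraph" where
  "mk_graph V E = \<lparr> pverts = V, parcs = {(x, y). E x y} \<rparr>"

lemma edge_mk_graph: "edge (mk_graph V E) = E" "pverts (mk_graph V E) = V"
  by (auto simp: edge_def mk_graph_def fun_eq_iff)

lemma pair_graph_iff: "pair_graph G \<longleftrightarrow> ugraph (pverts G) (edge G)"
proof
  assume "pair_graph G"
  then interpret pair_graph G .
  show "ugraph (pverts G) (edge G)"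
    unfolding ugraph_def edge_def
  proof (intro conjI allI impI)
    show "finite (pverts G)" by (rule pair_finite_verts)
    fix x y assume xy: "(x, y) \<in> parcs G"
    show "x \<in> pverts G" "y \<in> pverts G" using arc_fst_in_verts[OF xy] arc_snd_in_verts[OF xy] by auto
    show "x \<noteq> y" using pair_no_loops[OF xy] by simp
    show "(y, x) \<in> parcs G" using pair_sym_arcs xy by (auto simp: symmetric_def sym_def)
  qed
next
  assume g: "ugraph (pverts G) (edge G)"
  then have *: "(x, y) \<in> parcs G \<Longrightarrow> x \<in> pverts G \<and> y \<in> pverts G \<and> x \<noteq> y \<and> (y, x) \<in> parcs G" for x y
    by (auto simp: ugraph_def edge_def)
  have "finite (parcs G)"
    by (rule finite_subset[of _ "pverts G \<times> pverts G"]) (use * g in \<open>auto simp: ugraph_def\<close>)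
  then show "pair_graph G"
    using * g by unfold_locales (auto simp: ugraph_def symmetric_def sym_def)
qed

lemma out_degree_deg: "out_degree (with_proj G) v = deg (edge G) v"
proof -
  have "out_arcs (with_proj G) v = Pair v ` {w. edge G v w}"
    by (auto simp: out_arcs_def edge_def)
  then show ?thesis by (simp add: out_degree_def deg_def card_image inj_on_def)
qed

context pair_graph
begin

lemma walk_relpowp: "awalk u p v \<Longrightarrow> (edge G ^^ length p) u v"
proof (induction p arbitrary: u)
  case (Cons a p)
  then have "edge G u (snd a)" "awalk (snd a) p v" by (auto simp: awalk_Cons_iff edge_def)
  from relpowp_Suc_I2[OF this(1) Cons.IH[OF this(2)]] show ?case by simp
qed (simp add: awalk_Nil_iff)

lemma relpowp_walk: "(edge G ^^ n) u v \<Longrightarrow> u \<in> pverts G \<Longrightarrow> \<exists>p. awalk u p v \<and> length p = n"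
proof (induction n arbitrary: u)
  case 0
  then show ?case by (intro exI[of _ "[]"]) (simp add: awalk_Nil_iff)
next
  case (Suc n)
  then obtain w where w: "edge G u w" "(edge G ^^ n) w v" by (metis relpowp_Suc_D2)
  then have "w \<in> pverts G" using in_arcsD2 by (auto simp: edge_def)
  then obtain p where "awalk w p v" "length p = n" using Suc.IH w(2) by blast
  then show ?case using w(1) by (intro exI[of _ "(u, w) # p"]) (auto simp: awalk_Cons_iff edge_def)
qed

lemma cost_length: "awalk_cost (\<lambda>_. 1) p = real (length p)"
  by (induction p) auto

lemma mu_gdist:
  assumes "u \<in> pverts G"
  shows "\<mu> (\<lambda>_. 1) u v = (if (edge G)\<^sup>*\<^sup>* u v then ereal (real (gdist (edge G) u v)) else \<infinity>)"
proof (cases "(edge G)\<^sup>*\<^sup>* u v")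
  case True
  obtain p where p: "awalk u p v" "length p = gdist (edge G) u v"
    using relpowp_walk[OF gdist_walk[OF True] assms] by blast
  have "\<mu> (\<lambda>_. 1) u v = ereal (real (gdist (edge G) u v))"
    unfolding \<mu>_def
  proof (rule antisym)
    show "(INF p\<in>{p. awalk u p v}. ereal (awalk_cost (\<lambda>_. 1) p)) \<le> ereal (real (gdist (edge G) u v))"
      using p by (intro INF_lower2[of p]) (auto simp: cost_length)
    show "ereal (real (gdist (edge G) u v)) \<le> (INF p\<in>{p. awalk u p v}. ereal (awalk_cost (\<lambda>_. 1) p))"
      by (rule INF_greatest) (auto simp: cost_length intro: gdist_le walk_relpowp)
  qed
  then show ?thesis using True by simp
next
  case False
  then have "{p. awalk u p v} = {}" using walk_relpowp by (auto simp: rtranclp_power)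
  then show ?thesis using False unfolding \<mu>_def by (simp add: top_ereal_def)
qed

end

lemma SUP_attained:
  fixes f :: "'a \<Rightarrow> ereal"
  assumes "finite A" "A \<noteq> {}"
  shows "\<exists>a\<in>A. (SUP x\<in>A. f x) = f a"
proof -
  have "(SUP x\<in>A. f x) = Max (f ` A)" using assms by (intro cSup_eq_Max) auto
  moreover have "Max (f ` A) \<in> f ` A" using assms by (intro Max_in) auto
  ultimately show ?thesis by (simp add: image_iff)
qed

lemma diameter_pair:
  assumes G: "pair_graph G" and d: "graph_diameter G = ereal (real d)"
  shows "\<exists>u\<in>pverts G. \<exists>v\<in>pverts G. (edge G)\<^sup>*\<^sup>* u v \<and> gdist (edge G) u v = d"
proof -
  interpret pair_graph G by fact
  have fin: "finite (pverts G)" by (rule pair_finite_verts)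
  have ne: "pverts G \<noteq> {}" using d by (auto simp: graph_diameter_def bot_ereal_def)
  obtain u where u: "u \<in> pverts G" "(SUP v\<in>pverts G. \<mu> (\<lambda>_. 1) u v) = ereal (real d)"
    using SUP_attained[OF fin ne, of "\<lambda>u. SUP v\<in>pverts G. \<mu> (\<lambda>_. 1) u v"] d
    by (auto simp: graph_diameter_def)
  obtain v where v: "v \<in> pverts G" "\<mu> (\<lambda>_. 1) u v = ereal (real d)"
    using SUP_attained[OF fin ne, of "\<lambda>v. \<mu> (\<lambda>_. 1) u v"] u(2) by auto
  then show ?thesis using mu_gdist[OF u(1), of v] u(1) by (auto split: if_splits)
qed

lemma diameter_graph_diameter:
  assumes G: "pair_graph G" and d: "diameter (pverts G) (edge G) d"
  shows "graph_diameter G = ereal (real d)"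
proof -
  interpret pair_graph G by fact
  have le: "\<mu> (\<lambda>_. 1) u v \<le> ereal (real d)" if "u \<in> pverts G" "v \<in> pverts G" for u v
  proof -
    have "\<exists>n\<le>d. (edge G ^^ n) u v" using d that by (simp add: diameter_def)
    then obtain n where n: "n \<le> d" "(edge G ^^ n) u v" by blast
    then have "(edge G)\<^sup>*\<^sup>* u v" "gdist (edge G) u v \<le> d" by (auto simp: rtranclp_power dest: gdist_le)
    then show ?thesis using mu_gdist[OF that(1)] by simp
  qed
  obtain u v where uv: "u \<in> pverts G" "v \<in> pverts G" "\<And>n. n < d \<Longrightarrow> \<not> (edge G ^^ n) u v"
    using d by (auto simp: diameter_def)
  have ge: "ereal (real d) \<le> \<mu> (\<lambda>_. 1) u v"
    using mu_gdist[OF uv(1), of v] uv(3)[of "gdist (edge G) u v"] gdist_walk[of "edge G" u v]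
    by (cases "(edge G)\<^sup>*\<^sup>* u v") (auto simp: not_less[symmetric])
  show ?thesis
    unfolding graph_diameter_def
  proof (rule antisym)
    show "(SUP u\<in>pverts G. SUP v\<in>pverts G. \<mu> (\<lambda>_. 1) u v) \<le> ereal (real d)"
      by (intro SUP_least le)
    show "ereal (real d) \<le> (SUP u\<in>pverts G. SUP v\<in>pverts G. \<mu> (\<lambda>_. 1) u v)"
      by (rule SUP_upper2[OF uv(1)], rule SUP_upper2[OF uv(2)], rule ge)
  qed
qed

definition arcs_of :: "(nat \<Rightarrow> 'a) \<Rightarrow> nat \<Rightarrow> nat \<Rightarrow> ('a \<times> 'a) list" where
  "arcs_of f a b = map (\<lambda>i. (f i, f (Suc i))) [a..<b]"

lemma arcs_of_simps:
  assumes "a \<le> b"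
  shows "pcas (f a) (arcs_of f a b) (f b)" "pawalk_verts (f a) (arcs_of f a b) = map f [a..<Suc b]"
proof -
  have "pcas (f a) (arcs_of f a b) (f b) \<and> pawalk_verts (f a) (arcs_of f a b) = map f [a..<Suc b]"
    using assms
  proof (induction "b - a" arbitrary: a)
    case 0
    then show ?case by (simp add: arcs_of_def)
  next
    case (Suc n)
    then have "n = b - Suc a" "Suc a \<le> b" by auto
    from Suc.hyps(1)[OF this] have
      IH: "pcas (f (Suc a)) (arcs_of f (Suc a) b) (f b)"
      "pawalk_verts (f (Suc a)) (arcs_of f (Suc a) b) = map f [Suc a..<Suc b]" by auto
    have "arcs_of f a b = (f a, f (Suc a)) # arcs_of f (Suc a) b"
      using Suc by (simp add: arcs_of_def upt_conv_Cons)
    moreover have "map f [a..<Suc b] = f a # map f [Suc a..<Suc b]"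
      using Suc by (simp add: upt_conv_Cons del: upt_Suc)
    ultimately show ?case using IH by simp
  qed
  then show "pcas (f a) (arcs_of f a b) (f b)" "pawalk_verts (f a) (arcs_of f a b) = map f [a..<Suc b]" by auto
qed

context pair_graph
begin

lemma cycle_of_walk:
  assumes "n > 0" "\<And>i. i < n \<Longrightarrow> edge G (f i) (f (Suc i))" "f n = f 0" "inj_on f {1..n}"
  shows "cycle (arcs_of f 0 n)"
proof -
  have "awalk (f 0) (arcs_of f 0 n) (f n)"
    unfolding awalk_def cas_with_proj_eq
  proof (intro conjI)
    show "f 0 \<in> pverts G" using assms(2)[OF assms(1)] in_arcsD1 by (auto simp: edge_def)
    show "set (arcs_of f 0 n) \<subseteq> parcs G" using assms(2) by (auto simp: arcs_of_def edge_def)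
    show "pcas (f 0) (arcs_of f 0 n) (f n)" by (rule arcs_of_simps) simp
  qed
  moreover have "tl (pawalk_verts (f 0) (arcs_of f 0 n)) = map f [1..<Suc n]"
    by (simp add: arcs_of_simps(2) upt_conv_Cons map_tl[symmetric] del: upt_Suc)
  moreover have "distinct (map f [1..<Suc n])"
    using assms(4) by (simp add: distinct_map atLeastLessThanSuc_atLeastAtMost del: upt_Suc)
  moreover have "arcs_of f 0 n \<noteq> []" using assms(1) by (simp add: arcs_of_def)
  ultimately show ?thesis
    unfolding cycle_def awalk_verts_with_proj_eq using assms(3) by (intro exI[of _ "f 0"]) auto
qed

text \<open>A shortest walk from \<open>v\<close> to \<open>u\<close> avoiding the edge has at least
  2 steps and no repeated vertex, so the edge closes it to a cycle that \<open>graph_girth\<close>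
  counts.\<close>

lemma girth_ge_of_graph_girth:
  assumes "graph_girth G = enat g"
  shows "girth_ge g (edge G)"
  unfolding girth_ge_def potential_walk_iff
proof (intro allI impI notI)
  fix u v n assume uv: "edge G u v" and n: "Suc n < g" "(avoid (edge G) u v ^^ n) v u"
  have ne: "u \<noteq> v" using uv by (auto simp: edge_def dest: pair_no_loops)
  let ?A = "avoid (edge G) u v"
  have "?A\<^sup>*\<^sup>* v u" using n(2) by (auto simp: rtranclp_power)
  from geodesic[OF this] obtain p where p: "p 0 = v" "p (gdist ?A v u) = u"
    "\<forall>i<gdist ?A v u. ?A (p i) (p (Suc i))" "\<forall>i\<le>gdist ?A v u. gdist ?A v (p i) = i" by blast
  let ?n = "gdist ?A v u"
  have le: "?n \<le> n" by (rule gdist_le[OF n(2)])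
  have n2: "?n \<ge> 2"
  proof (rule ccontr)
    assume "\<not> 2 \<le> ?n"
    then consider "?n = 0" | "?n = 1" by linarith
    then show False
    proof cases
      case 1
      then show False using p ne by simp
    next
      case 2
      then have "?A v u" using p by auto
      then show False by (simp add: avoid_def insert_commute)
    qed
  qed
  define f where "f i = (if i = 0 then u else p (i - 1))" for i
  have "cycle (arcs_of f 0 (Suc ?n))"
  proof (rule cycle_of_walk)
    show "edge G (f i) (f (Suc i))" if "i < Suc ?n" for i
      using that p uv by (cases i) (auto simp: f_def avoid_def)
    show "f (Suc ?n) = f 0" using p by (simp add: f_def)
    show "inj_on f {1..Suc ?n}"
    proof (rule inj_onI)
      fix i j assume "i \<in> {1..Suc ?n}" "j \<in> {1..Suc ?n}" "f i = f j"
      then have "p (i - 1) = p (j - 1)" "i - 1 \<le> ?n" "j - 1 \<le> ?n" by (auto simp: f_def)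
      then have "i - 1 = j - 1" using p(4) by metis
      then show "i = j" using \<open>i \<in> _\<close> \<open>j \<in> _\<close> by auto
    qed
  qed simp
  moreover have "length (arcs_of f 0 (Suc ?n)) = Suc ?n" by (simp add: arcs_of_def)
  ultimately have "graph_girth G \<le> enat (Suc ?n)"
    unfolding graph_girth_def using n2 by (intro INF_lower2[of "arcs_of f 0 (Suc ?n)"]) auto
  then show False using assms le n(1) by simp
qed

text \<open>Dropping the first arc \<open>(u, v)\<close> leaves a walk from \<open>v\<close> back to
  \<open>u\<close>. It meets \<open>v\<close> only at its start and does not step to
  \<open>u\<close> at once, so it avoids the edge.\<close>

lemma girth_ge_cycle:
  assumes girth_ge: "girth_ge g (edge G)" and p: "cycle p" "3 \<le> length p"
  shows "g \<le> length p"
proof -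
  obtain u where u: "awalk u p u" "distinct (tl (pawalk_verts u p))"
    using p(1) unfolding cycle_def awalk_verts_with_proj_eq by blast
  obtain e q where eq: "p = e # q" using p(2) by (cases p) auto
  define v where "v = snd e"
  have e: "e = (u, v)" "edge G u v" and q: "awalk v q u"
    using u(1) eq by (auto simp: awalk_Cons_iff v_def edge_def)
  have dq: "distinct (pawalk_verts v q)" using u(2) eq e by simp
  have q2: "length q \<ge> 2" using p(2) eq by simp
  have len: "length (pawalk_verts x r) = Suc (length r)" for x and r :: "('a \<times> 'a) list"
    by (induction r arbitrary: x) auto
  have walk: "(avoid (edge G) u v ^^ length r) x u"
    if "awalk x r u" "distinct (pawalk_verts x r)" "v \<notin> set (pawalk_verts x r)" for x r
    using that
  proof (induction r arbitrary: x)
    case (Cons a r)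
    then have a: "edge G x (snd a)" "fst a = x" "awalk (snd a) r u" by (auto simp: awalk_Cons_iff edge_def)
    have "snd a \<in> set (pawalk_verts (snd a) r)" by (cases r) (use a(3) in \<open>auto simp: awalk_Cons_iff\<close>)
    then have "x \<noteq> v" "snd a \<noteq> v" using Cons.prems a by auto
    then have "avoid (edge G) u v x (snd a)" using a(1) by (auto simp: avoid_def doubleton_eq_iff)
    moreover have "(avoid (edge G) u v ^^ length r) (snd a) u" using Cons a(3) by auto
    ultimately have "(avoid (edge G) u v ^^ Suc (length r)) x u" by (rule relpowp_Suc_I2)
    then show ?case by simp
  qed (auto simp: awalk_Nil_iff)
  obtain b r where br: "q = b # r" using q2 by (cases q) auto
  have b: "edge G v (snd b)" "fst b = v" "awalk (snd b) r u"
    using q br by (auto simp: awalk_Cons_iff edge_def)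
  have d: "distinct (pawalk_verts (snd b) r)" "v \<notin> set (pawalk_verts (snd b) r)" using dq br b by auto
  \<comment> \<open>Here \<open>3 \<le> length p\<close> enters: it excludes an edge run back and
    forth.\<close>
  have "snd b \<noteq> u"
  proof
    assume "snd b = u"
    obtain c r' where "r = c # r'" using q2 br by (cases r) auto
    moreover have "u \<in> set (pawalk_verts x s)" if "awalk x s u" for x s
      using that by (induction s arbitrary: x) (auto simp: awalk_Cons_iff awalk_Nil_iff)
    ultimately show False using d(1) b(3) \<open>snd b = u\<close> by (auto simp: awalk_Cons_iff)
  qed
  moreover have "snd b \<noteq> v" using b(1) by (auto simp: edge_def dest: pair_no_loops)
  ultimately have "avoid (edge G) u v v (snd b)" using b(1) by (auto simp: avoid_def doubleton_eq_iff)
  then have "(avoid (edge G) u v ^^ Suc (length r)) v u" by (rule relpowp_Suc_I2[OF _ walk[OF b(3) d]])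
  then have "(avoid (edge G) u v ^^ length q) v u" by (simp only: br list.size add_0_right add_Suc_right)
  moreover have "\<exists>\<phi>. potential g (edge G) u v \<phi>" using girth_ge e(2) by (simp add: girth_ge_def)
  ultimately have "\<not> Suc (length q) < g" unfolding potential_walk_iff by blast
  then show ?thesis using eq by simp
qed

lemma girth_eqI:
  assumes "girth_ge g (edge G)" "cycle_off g (edge G) r" "g \<ge> 3"
  shows "graph_girth G = enat g"
proof (rule antisym)
  show "enat g \<le> graph_girth G"
    unfolding graph_girth_def by (rule INF_greatest) (use girth_ge_cycle[OF assms(1)] in auto)
  obtain p where p: "inj_on p {..<g}" "\<And>i. i < g \<Longrightarrow> edge G (p i) (p (Suc i mod g))"
    using assms(2) by (auto simp: cycle_off_def)
  define f where "f i = p (i mod g)" for i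
  have "cycle (arcs_of f 0 g)"
  proof (rule cycle_of_walk)
    show "edge G (f i) (f (Suc i))" if "i < g" for i using p(2)[OF that] that by (simp add: f_def)
    show "inj_on f {1..g}"
    proof (rule inj_onI)
      fix i j assume ij: "i \<in> {1..g}" "j \<in> {1..g}" "f i = f j"
      have "i mod g = j mod g"
        using ij(3) p(1) assms(3) by (auto simp: f_def dest!: inj_onD)
      then show "i = j" using ij(1,2) by (cases "i = g"; cases "j = g") auto
    qed
  qed (use assms(3) in \<open>auto simp: f_def\<close>)
  then show "graph_girth G \<le> enat g"
    unfolding graph_girth_def
    using assms(3) by (intro INF_lower2[of "arcs_of f 0 g"]) (auto simp: arcs_of_def)
qed

end

section \<open>Bounds on the minimum order and the growth rate\<close>

lemma relabel_relpowp:
  assumes "inj f"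
  shows "(relabel f E ^^ n) (f x) (f y) \<longleftrightarrow> (E ^^ n) x y"
proof
  show "(E ^^ n) x y \<Longrightarrow> (relabel f E ^^ n) (f x) (f y)"
  proof (induction n arbitrary: y)
    case (Suc n)
    then obtain w where "(E ^^ n) x w" "E w y" by auto
    then have "(relabel f E ^^ n) (f x) (f w)" "relabel f E (f w) (f y)"
      using Suc.IH by (blast, auto simp: relabel_def)
    then show ?case by auto
  qed simp
  have "(relabel f E ^^ n) (f x) z \<Longrightarrow> \<exists>y. z = f y \<and> (E ^^ n) x y" for z
  proof (induction n arbitrary: z)
    case (Suc n)
    then obtain w where w: "(relabel f E ^^ n) (f x) w" "relabel f E w z" by auto
    then obtain y where y: "w = f y" "(E ^^ n) x y" using Suc.IH by blast
    from w(2) obtain a b where ab: "E a b" "w = f a" "z = f b" by (auto simp: relabel_def)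
    then have "a = y" using y(1) assms by (auto dest: injD)
    then show ?case using ab y(2) by auto
  qed auto
  then show "(relabel f E ^^ n) (f x) (f y) \<Longrightarrow> (E ^^ n) x y" using assms by (metis injD)
qed

lemma min_order_le:
  fixes V :: "'a set"
  assumes G: "ugraph V E" "girth_ge g E" "\<forall>v\<in>V. deg E v = k" "cycle_off g E r" "diameter V E d" "g \<ge> 3"
  and f: "inj (f :: 'a \<Rightarrow> nat)"
  shows "min_order k g d \<le> enat (card V)"
proof -
  have fV: "inj_on f V" using f by (rule inj_on_subset) simp
  let ?V = "f ` V" and ?E = "relabel f E"
  let ?G = "mk_graph ?V ?E"
  have pg: "pair_graph ?G"
    unfolding pair_graph_iff edge_mk_graph by (rule relabel_graph[OF G(1) fV])
  interpret pair_graph ?G by (rule pg)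
  obtain p where p: "inj_on p {..<g}" "\<And>i. i < g \<Longrightarrow> p i \<noteq> r \<and> E (p i) (p (Suc i mod g))"
    using G(4) by (auto simp: cycle_off_def)
  have "inj_on (f \<circ> p) {..<g}" using p(1) f by (auto intro: comp_inj_on inj_on_subset)
  moreover have "f (p i) \<noteq> f r" if "i < g" for i using p(2)[OF that] f by (metis injD)
  ultimately have cyc: "cycle_off g (edge ?G) (f r)"
    unfolding cycle_off_def edge_mk_graph using p(2)
    by (intro exI[of _ "f \<circ> p"]) (auto simp: relabel_def)
  have "graph_girth ?G = enat g"
    by (rule girth_eqI[OF _ cyc G(6)]) (unfold edge_mk_graph, rule relabel_girth_ge[OF G(1) fV G(2)])
  moreover have "diameter (pverts ?G) (edge ?G) d"
    using G(5) relabel_relpowp[OF f, where E = E] unfolding edge_mk_graph diameter_def by auto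
  then have "graph_diameter ?G = ereal (real d)" by (rule diameter_graph_diameter[OF pg])
  moreover have "\<forall>v\<in>pverts ?G. out_degree (with_proj ?G) v = k"
    unfolding out_degree_deg edge_mk_graph using relabel_deg[OF G(1) fV] G(3) by auto
  ultimately have "kgd_graph k g d ?G" using pg by (simp add: kgd_graph_def)
  then have "min_order k g d \<le> enat (card (pverts ?G))"
    unfolding min_order_def by (intro INF_lower2[of ?G]) auto
  then show ?thesis using card_image[OF fV] by (simp add: edge_mk_graph)
qed

text \<open>An optimal graph, closed up along a geodesic of length \<open>d\<close>, has ratio
  \<open>n / (d - 1)\<close>, which is at least \<open>p / q\<close>.\<close>

lemma min_order_ge:
  assumes min: "minimal k g q p" and g: "g \<ge> 3" and d: "d \<ge> 3"
    and n: "min_order k g d = enat n"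
  shows "p * (d - 1) \<le> n * q"
proof -
  have "\<exists>G \<in> {G :: nat pair_pre_digraph. kgd_graph k g d G}. enat (card (pverts G)) = enat n"
  proof -
    let ?A = "(\<lambda>G. enat (card (pverts G))) ` {G :: nat pair_pre_digraph. kgd_graph k g d G}"
    have inf: "Inf ?A = enat n" using n by (simp add: min_order_def)
    then have "?A \<noteq> {}" by (metis Inf_enat_def enat.simps(3))
    then have "Inf ?A \<in> ?A" by (metis Inf_enat_def LeastI ex_in_conv)
    then show ?thesis using inf by auto
  qed
  then obtain G :: "nat pair_pre_digraph" where G: "kgd_graph k g d G" "card (pverts G) = n" by auto
  then have pg: "pair_graph G" by (simp add: kgd_graph_def)
  interpret pair_graph G by (rule pg)
  have gr: "ugraph (pverts G) (edge G)" using pg by (simp add: pair_graph_iff)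
  have girth_ge: "girth_ge g (edge G)" using G(1) girth_ge_of_graph_girth by (simp add: kgd_graph_def)
  have reg: "deg (edge G) v = k" if "v \<in> pverts G" for v
    using G(1) that by (simp add: kgd_graph_def out_degree_deg)
  obtain u v where uv: "u \<in> pverts G" "(edge G)\<^sup>*\<^sup>* u v" "gdist (edge G) u v = d"
    using diameter_pair[OF pg] G(1) by (auto simp: kgd_graph_def)
  obtain f where f: "\<forall>i<d. edge G (f i) (f (Suc i))" "\<forall>i\<le>d. gdist (edge G) u (f i) = i" "f 0 = u"
    using geodesic[OF uv(2)] uv(3) by auto
  \<comment> \<open>Vertices that cannot be reached from \<open>u\<close> are put on level \<open>0\<close>.\<close>
  let ?h = "\<lambda>x. if (edge G)\<^sup>*\<^sup>* u x then gdist (edge G) u x else 0"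
  have reach: "(edge G)\<^sup>*\<^sup>* u (f i)" if "i \<le> d" for i
    using that by (induction i) (use f in \<open>auto intro: rtranclp.rtrancl_into_rtrancl\<close>)
  have "cyclic k g (d - 1) (card (pverts G))"
  proof (rule closure_cyclic[OF gr reg girth_ge g d, where h = ?h and p = f])
    show "?h x \<le> Suc (?h y)" if "edge G x y" for x y
    proof -
      have yx: "edge G y x" using gr that by (rule graph_sym)
      have "(edge G)\<^sup>*\<^sup>* u x \<longleftrightarrow> (edge G)\<^sup>*\<^sup>* u y"
        using that yx by (meson rtranclp.rtrancl_into_rtrancl)
      then show ?thesis using gdist_step[of "edge G" u y x, OF _ yx] by auto
    qed
    show "?h (f i) = i" if "i \<le> d" for i using f(2) reach[OF that] that by simp
  qed (use f in auto)
  from minimalD[OF min this] G(2) show ?thesis by simp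
qed

text \<open>For large \<open>d\<close> the minimum order \<open>n\<close> satisfies
  \<open>p * (d - 1) \<le> q * n \<le> p * d + C\<close>, so \<open>p / q\<close> is an admissible
  slope and no smaller one is.\<close>

theorem growth_rate_minimal:
  assumes k: "k \<ge> 3" and g: "g \<ge> 3" and min: "minimal k g q p"
  shows "order_bound k g (real p / real q)" "\<And>c. order_bound k g c \<Longrightarrow> real p / real q \<le> c"
proof -
  have q: "q > 0" using min by (auto simp: minimal_def cyclic_def)
  obtain C d0 where long: "\<And>d. d \<ge> d0 \<Longrightarrow> \<exists>(V :: (nat \<times> nat) set) E r. ugraph V E \<and> girth_ge g E \<and>
    (\<forall>v\<in>V. deg E v = k) \<and> cycle_off g E r \<and> diameter V E d \<and> q * card V \<le> p * d + C"
    using long_graphs[OF k g min] by blast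
  have up: "\<exists>n. min_order k g d = enat n \<and> q * n \<le> p * d + C" if "d \<ge> d0" for d
  proof -
    from long[OF that] obtain V :: "(nat \<times> nat) set" and E r where V: "ugraph V E" "girth_ge g E"
      "\<forall>v\<in>V. deg E v = k" "cycle_off g E r" "diameter V E d" "q * card V \<le> p * d + C" by blast
    have "min_order k g d \<le> enat (card V)"
      by (rule min_order_le[OF V(1-5) g, of prod_encode]) (simp add: inj_prod_encode)
    then obtain n where n: "min_order k g d = enat n" "n \<le> card V" by (cases "min_order k g d") auto
    then have "q * n \<le> q * card V" by simp
    then show ?thesis using n(1) V(6) le_trans by blast
  qed
  show "order_bound k g (real p / real q)"
    unfolding order_bound_def
  proof (intro exI[of _ "real C"] eventually_sequentiallyI[of d0])
    fix d assume "d0 \<le> d"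
    then obtain n where n: "min_order k g d = enat n" "q * n \<le> p * d + C" using up by blast
    have "real q * real n \<le> real p * real d + real C"
      using n(2) by (metis of_nat_add of_nat_le_iff of_nat_mult)
    also have "real C \<le> real q * real C" using q by (simp add: mult_le_cancel_right1)
    finally have "real n \<le> real p / real q * real d + real C"
      using q by (simp add: field_simps)
    then show "ereal_of_enat (min_order k g d) \<le> ereal (real p / real q * real d + real C)"
      using n(1) by simp
  qed
  fix c assume "order_bound k g c"
  then obtain C' d1 where C': "\<And>d. d \<ge> d1 \<Longrightarrow> ereal_of_enat (min_order k g d) \<le> ereal (c * real d + C')"
    unfolding order_bound_def eventually_sequentially by blast
  define a where "a = real p / real q"
  have "a \<le> c"
  proof (rule ccontr)
    assume "\<not> a \<le> c"
    then have pos: "a - c > 0" by simp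
    \<comment> \<open>From this \<open>N\<close> on, the gap \<open>(a - c) * d\<close> exceeds the
      additive constants.\<close>
    obtain N :: nat where N: "real N > (C' + a) / (a - c)"
      using reals_Archimedean2 by blast
    define d where "d = max (max d0 d1) (max 3 N)"
    have dd: "d0 \<le> d" "d1 \<le> d" "3 \<le> d" "N \<le> d" by (simp_all add: d_def)
    obtain n where n: "min_order k g d = enat n" using up[OF dd(1)] by blast
    have "p * (d - 1) \<le> n * q" by (rule min_order_ge[OF min g dd(3) n])
    then have "real p * real (d - 1) \<le> real n * real q" by (metis of_nat_le_iff of_nat_mult)
    moreover have "real (d - 1) = real d - 1" using dd(3) by (simp add: of_nat_diff)
    ultimately have "a * (real d - 1) \<le> real n" using q by (simp add: a_def field_simps)
    also have "real n \<le> c * real d + C'" using C'[OF dd(2)] n by simp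
    finally have "(a - c) * real d \<le> C' + a" by (simp add: algebra_simps)
    then have "real d \<le> (C' + a) / (a - c)"
      using pos by (simp add: field_simps)
    moreover have "real N \<le> real d" using dd(4) by simp
    ultimately show False using N by simp
  qed
  then show "real p / real q \<le> c" by (simp add: a_def)
qed

theorem theorem2:
  shows "\<exists>(P :: prog) (T :: nat \<Rightarrow> nat \<Rightarrow> nat). \<forall>k \<ge> 3. \<forall>g \<ge> 3.
    order_bound k g (growth_rate k g) \<and>
    (\<forall>c. order_bound k g c \<longrightarrow> growth_rate k g \<le> c) \<and>
    (\<exists>t s. runs P (input k g) t s \<and> t \<le> T k g \<and> outputs s (growth_rate k g))"
proof -
  obtain P where P: "\<And>k g. \<exists>q p. minimal k g q p \<Longrightarrow>
      \<exists>t s. runs P (input k g) t s \<and> minimal k g (s 1) (s 0)"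
    using minimal_program by blast
  \<comment> \<open>The running time itself serves as the bound: the program halts on the input
    \<open>k\<close>, \<open>g\<close>, so the time is a function of \<open>k\<close> and
    \<open>g\<close> alone.\<close>
  define T where "T k g = (SOME t. \<exists>s. runs P (input k g) t s \<and> minimal k g (s 1) (s 0))" for k g
  show ?thesis
  proof (intro exI[of _ P] exI[of _ T] allI impI)
    fix k g :: nat assume k: "3 \<le> k" and g: "3 \<le> g"
    obtain q p where min: "minimal k g q p"
      using cyclic_exists[OF k g] minimal_exists by blast
    then have "\<exists>t. \<exists>s. runs P (input k g) t s \<and> minimal k g (s 1) (s 0)" using P by blast
    then have "\<exists>s. runs P (input k g) (T k g) s \<and> minimal k g (s 1) (s 0)"
      unfolding T_def by (rule someI_ex)
    then obtain s where s: "runs P (input k g) (T k g) s" "minimal k g (s 1) (s 0)" by blast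
    note gm = growth_rate_minimal[OF k g s(2)]
    have eq: "growth_rate k g = real (s 0) / real (s 1)"
      unfolding growth_rate_def by (rule Least_equality) (use gm in auto)
    have "s 1 \<noteq> 0" using s(2) by (auto simp: minimal_def cyclic_def)
    then have "outputs s (growth_rate k g)" by (simp add: outputs_def eq)
    then show "order_bound k g (growth_rate k g) \<and>
        (\<forall>c. order_bound k g c \<longrightarrow> growth_rate k g \<le> c) \<and>
        (\<exists>t s. runs P (input k g) t s \<and> t \<le> T k g \<and> outputs s (growth_rate k g))"
      using gm s(1) unfolding eq by blast
  qed
qed

end
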